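(* Let $\mathcal{R}$ be a rigid, suitable, shift-invariant and unital Banach subalgebra of $\mathcal{L}(l^2(\mathbb{Z}))$, and let $h_1,h_2:\mathbb{Z}^+\to\mathbb{Z}$ be fractal sequences for $\mathcal{R}$ with associated homomorphisms $\mathcal{U}_1$ and $\mathcal{U}_2$, respectively, such that $h(n):=h_2(n)-h_1(n)>0$ and $h(n)\to\infty$ as $n\to\infty$. If $A_1,\dots,A_r\in\mathcal{R}$ and $A=e^{A_1}\cdots e^{A_r}$, then $$\lim_{n\to\infty}\frac{\det\big(P_{h_1(n),h_2(n)}AP_{h_1(n),h_2(n)}\big)}{\exp\big(\operatorname{trace}(P_{h_1(n),h_2(n)}(A_1+\cdots+A_r)P_{h_1(n),h_2(n)})\big)}=\det(\mathcal{B}_1)\det(\mathcal{B}_2),$$ where $$\mathcal{B}_1=T(\mathcal{U}_1A)\,e^{-T(\mathcal{U}_1A_r)}\cdots e^{-T(\mathcal{U}_1A_1)},\qquad \mathcal{B}_2=e^{T(\mathcal{U}_2A_1)}\cdots e^{T(\mathcal{U}_2A_r)}\,T(\mathcal{U}_2(A^{-1})).$$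
   Context: $\mathbb{Z}^+=\{0,1,2,\dots\}$. $\mathcal{L}(H)$ is the algebra of bounded linear operators on a complex Hilbert space $H$; $\mathcal{C}_1$ is the ideal of trace class operators with trace norm $\|\cdot\|_{\mathcal{C}_1}$. A Banach subalgebra $\mathcal{R}$ of $\mathcal{L}(l^2(\mathbb{Z}))$ is a subalgebra equipped with its own complete norm $\|\cdot\|_{\mathcal{R}}$ making it a Banach algebra (with continuous multiplication); it is unital if it contains the identity $I$. On $l^2(\mathbb{Z})$: $P$ sends $(x_k)$ to $(y_k)$ with $y_k=x_k$ for $k\ge0$, $y_k=0$ for $k<0$; $J:(x_k)\mapsto(x_{-k-1})$; $U_n:(x_k)\mapsto(x_{k-n})$. For $A\in\mathcal{L}(l^2(\mathbb{Z}))$ put $T(A)=PAP$, $H(A)=PAJP$ (regarded as operators on $l^2(\mathbb{Z}^+)\cong\operatorname{im}P$) and $\widetilde{A}=JAJ$. For integers $n_1<n_2$, $P_{n_1,n_2}$ is the projection on $l^2(\mathbb{Z})$ keeping the coordinates $x_k$ with $n_1\le k<n_2$ and setting the others to $0$; $P_{n_1,n_2}AP_{n_1,n_2}$ is identified with a matrix of order $n_2-n_1$ for determinants and traces. $\mathcal{R}$ is rigid if for each $A\in\mathcal{R}$: if $T(A)$ or $T(\widetilde{A})$ is compact, then $A=0$. $\mathcal{R}$ is suitable if (a) $\|A\|_{\mathcal{L}(l^2(\mathbb{Z}))}\le\|A\|_{\mathcal{R}}$ for all $A\in\mathcal{R}$; (b) for all $A,B\in\mathcal{R}$ the operators $H(A)H(\widetilde{B})$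 and $H(\widetilde{A})H(B)$ are trace class, and there is $M>0$ with $\max\{\|H(A)H(\widetilde{B})\|_{\mathcal{C}_1},\|H(\widetilde{A})H(B)\|_{\mathcal{C}_1}\}\le M\|A\|_{\mathcal{R}}\|B\|_{\mathcal{R}}$ for all $A,B\in\mathcal{R}$. $\mathcal{R}$ is shift-invariant if $U_{-n}AU_n\in\mathcal{R}$ and $\|U_{-n}AU_n\|_{\mathcal{R}}=\|A\|_{\mathcal{R}}$ for all $A\in\mathcal{R}$, $n\in\mathbb{Z}$. For shift-invariant $\mathcal{R}$, a sequence $h:\mathbb{Z}^+\to\mathbb{Z}$ is fractal for $\mathcal{R}$ with associated $\mathcal{U}:\mathcal{R}\to\mathcal{R}$ if for each $A\in\mathcal{R}$ there is $\mathcal{U}A\in\mathcal{R}$ with $\lim_{n\to\infty}\|U_{-h(n)}AU_{h(n)}-\mathcal{U}A\|_{\mathcal{R}}=0$ (then $\mathcal{U}$ is an isometric Banach algebra homomorphism). $\det(\mathcal{B}_j)$ denotes the operator (Fredholm) determinant on $l^2(\mathbb{Z}^+)$ of an operator of the form identity plus trace class; $\mathcal{B}_1$ and $\mathcal{B}_2$ are of this form. *)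

theory Defs
  imports
    "HOL-Analysis.Infinite_Sum"
    "HOL-Analysis.Bounded_Linear_Function"
    "HOL-Analysis.L2_Norm"
    "Jordan_Normal_Form.Determinant"
begin

section \<open>The complex Hilbert space of square-summable families\<close>

typedef 'a l2 = "{x :: 'a \<Rightarrow> complex. (\<lambda>k. (cmod (x k))\<^sup>2) summable_on UNIV}"
  by (rule exI[of _ "\<lambda>_. 0"]) simp

setup_lifting type_definition_l2

abbreviation coord :: "'a l2 \<Rightarrow> 'a \<Rightarrow> complex" where "coord \<equiv> Rep_l2"

lemma l2_memI:
  assumes "\<And>F. finite F \<Longrightarrow> L2_set (\<lambda>k. cmod (f k)) F \<le> C"
  shows "(\<lambda>k. (cmod (f k))\<^sup>2) summable_on UNIV"
    and "sqrt (\<Sum>\<^sub>\<infinity>k. (cmod (f k))\<^sup>2) \<le> C"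
proof -
  have C: "C \<ge> 0" using assms[of "{}"] by simp
  have b: "(\<Sum>k\<in>F. (cmod (f k))\<^sup>2) \<le> C\<^sup>2" if "finite F" for F
  proof -
    have "sqrt (\<Sum>k\<in>F. (cmod (f k))\<^sup>2) \<le> C"
      using assms[OF that] by (simp add: L2_set_def)
    then show ?thesis by (rule sqrt_le_D)
  qed
  show s: "(\<lambda>k. (cmod (f k))\<^sup>2) summable_on UNIV"
    by (rule nonneg_bdd_above_summable_on) (auto intro!: bdd_aboveI2 b)
  have "(\<Sum>\<^sub>\<infinity>k. (cmod (f k))\<^sup>2) \<le> C\<^sup>2"
    by (rule infsum_le_finite_sums[OF s b])
  then show "sqrt (\<Sum>\<^sub>\<infinity>k. (cmod (f k))\<^sup>2) \<le> C"
    by (rule real_le_lsqrt[OF C])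
qed

lemma l2_finite_le:
  assumes "(\<lambda>k. (cmod (f k))\<^sup>2) summable_on UNIV" "finite F"
  shows "L2_set (\<lambda>k. cmod (f k)) F \<le> sqrt (\<Sum>\<^sub>\<infinity>k. (cmod (f k))\<^sup>2)"
  unfolding L2_set_def real_sqrt_le_iff
  by (rule finite_sum_le_infsum) (use assms in auto)

lemma l2_add_finite:
  "L2_set (\<lambda>k. cmod (f k + g k)) F \<le> L2_set (\<lambda>k. cmod (f k)) F + L2_set (\<lambda>k. cmod (g k)) F"
  by (rule order_trans[OF L2_set_mono L2_set_triangle_ineq]) (auto intro: norm_triangle_ineq)

lemma l2_scale_finite:
  "L2_set (\<lambda>k. cmod (c * f k)) F = cmod c * L2_set (\<lambda>k. cmod (f k)) F"
  by (simp add: norm_mult L2_set_right_distrib)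

lemma l2_add_closed:
  assumes "(\<lambda>k. (cmod (f k))\<^sup>2) summable_on UNIV" "(\<lambda>k. (cmod (g k))\<^sup>2) summable_on UNIV"
  shows "(\<lambda>k. (cmod (f k + g k))\<^sup>2) summable_on UNIV"
  by (rule l2_memI(1)[OF order_trans[OF l2_add_finite add_mono[OF l2_finite_le l2_finite_le]]])
    (use assms in auto)

lemma l2_scale_closed:
  assumes "(\<lambda>k. (cmod (f k))\<^sup>2) summable_on UNIV"
  shows "(\<lambda>k. (cmod (c * f k))\<^sup>2) summable_on UNIV"
  using summable_on_cmult_right[OF assms, of "(cmod c)\<^sup>2"]
  by (simp add: norm_mult power_mult_distrib)

lift_definition l2_scale :: "complex \<Rightarrow> 'a l2 \<Rightarrow> 'a l2" is "\<lambda>c x k. c * x k"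
  by (rule l2_scale_closed)

lift_definition l2_basis :: "'a \<Rightarrow> 'a l2" is "\<lambda>j k. if k = j then 1 else 0"
proof -
  fix j :: 'a
  show "(\<lambda>k. (cmod (if k = j then 1 else 0))\<^sup>2) summable_on UNIV"
    by (rule summable_on_cong_neutral[where T="{j}", THEN iffD2]) auto
qed

instantiation l2 :: (type) real_normed_vector
begin

lift_definition zero_l2 :: "'a l2" is "\<lambda>_. 0" by simp
lift_definition plus_l2 :: "'a l2 \<Rightarrow> 'a l2 \<Rightarrow> 'a l2" is "\<lambda>x y k. x k + y k"
  by (rule l2_add_closed)
lift_definition minus_l2 :: "'a l2 \<Rightarrow> 'a l2 \<Rightarrow> 'a l2" is "\<lambda>x y k. x k - y k"
  using l2_add_closed[OF _ l2_scale_closed[of _ "-1"]] by fastforce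
lift_definition uminus_l2 :: "'a l2 \<Rightarrow> 'a l2" is "\<lambda>x k. - x k" by simp
lift_definition scaleR_l2 :: "real \<Rightarrow> 'a l2 \<Rightarrow> 'a l2" is "\<lambda>r x k. r *\<^sub>R x k"
  using l2_scale_closed by (fastforce simp: scaleR_conv_of_real)
lift_definition norm_l2 :: "'a l2 \<Rightarrow> real" is "\<lambda>x. sqrt (\<Sum>\<^sub>\<infinity>k. (cmod (x k))\<^sup>2)" .
definition sgn_l2 :: "'a l2 \<Rightarrow> 'a l2" where "sgn_l2 x = inverse (norm x) *\<^sub>R x"
definition dist_l2 :: "'a l2 \<Rightarrow> 'a l2 \<Rightarrow> real" where "dist_l2 x y = norm (x - y)"
definition uniformity_l2 :: "('a l2 \<times> 'a l2) filter"
  where "uniformity_l2 = (INF e\<in>{0<..}. principal {(x, y). dist x y < e})"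
definition open_l2 :: "'a l2 set \<Rightarrow> bool"
  where "open_l2 S = (\<forall>x\<in>S. \<forall>\<^sub>F (x', y) in uniformity. x' = x \<longrightarrow> y \<in> S)"

instance
proof
  fix x y :: "'a l2" and r :: real
  show "(norm x = 0) = (x = 0)"
  proof
    assume "norm x = 0"
    then have "cmod (Rep_l2 x k) = 0" for k
      using l2_finite_le[of "Rep_l2 x" "{k}"] Rep_l2[of x] by (simp add: norm_l2.rep_eq)
    then show "x = 0" by transfer auto
  qed (transfer, simp)
  show "norm (x + y) \<le> norm x + norm y"
    unfolding norm_l2.rep_eq plus_l2.rep_eq
    by (rule l2_memI(2)[OF order_trans[OF l2_add_finite add_mono[OF l2_finite_le l2_finite_le]]])
      (use Rep_l2 in auto)
  show "norm (r *\<^sub>R x) = \<bar>r\<bar> * norm x"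
    by transfer (simp add: power_mult_distrib infsum_cmult_right' real_sqrt_mult)
qed (simp_all add: sgn_l2_def dist_l2_def uniformity_l2_def open_l2_def,
     (transfer; auto simp: algebra_simps)+)

end

lemma l2_coord_le: "cmod (coord x k) \<le> norm x"
  using l2_finite_le[of "coord x" "{k}"] Rep_l2[of x] by (simp add: norm_l2.rep_eq)

lemma norm_l2_basis: "norm (l2_basis j) = 1"
proof -
  have "(\<Sum>\<^sub>\<infinity>k. (cmod (if k = j then 1 else 0))\<^sup>2) = (\<Sum>\<^sub>\<infinity>k\<in>{j}. (1::real))"
    by (rule infsum_cong_neutral) auto
  then show ?thesis by (simp add: norm_l2.rep_eq l2_basis.rep_eq)
qed

instance l2 :: (type) banach
proof
  fix X :: "nat \<Rightarrow> 'a l2"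
  assume X: "Cauchy X"
  have "Cauchy (\<lambda>n. coord (X n) k)" for k
  proof (rule metric_CauchyI)
    fix e :: real assume "e > 0"
    then obtain M where "\<forall>m\<ge>M. \<forall>n\<ge>M. dist (X m) (X n) < e" using metric_CauchyD[OF X] by blast
    moreover have "dist (coord (X m) k) (coord (X n) k) \<le> dist (X m) (X n)" for m n
      using l2_coord_le[of "X m - X n" k] by (simp add: dist_norm minus_l2.rep_eq)
    ultimately show "\<exists>M. \<forall>m\<ge>M. \<forall>n\<ge>M. dist (coord (X m) k) (coord (X n) k) < e"
      by (meson le_less_trans)
  qed
  then have "\<forall>k. \<exists>l. (\<lambda>n. coord (X n) k) \<longlonglongrightarrow> l" by (simp add: Cauchy_convergent_iff convergent_def)
  then obtain x where x: "\<And>k. (\<lambda>n. coord (X n) k) \<longlonglongrightarrow> x k" by metis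
  have key: "L2_set (\<lambda>k. cmod (coord (X n) k - x k)) F \<le> e"
    if "\<And>m. m \<ge> M \<Longrightarrow> norm (X n - X m) \<le> e" "finite F" for n M e F
  proof (rule LIMSEQ_le_const2)
    show "(\<lambda>m. L2_set (\<lambda>k. cmod (coord (X n) k - coord (X m) k)) F)
            \<longlonglongrightarrow> L2_set (\<lambda>k. cmod (coord (X n) k - x k)) F"
      unfolding L2_set_def by (intro tendsto_intros x)
    have "L2_set (\<lambda>k. cmod (coord (X n) k - coord (X m) k)) F \<le> e" if "m \<ge> M" for m
      using l2_finite_le[of "coord (X n - X m)" F] \<open>finite F\<close> Rep_l2[of "X n - X m"]
        \<open>m \<ge> M \<Longrightarrow> norm (X n - X m) \<le> e\<close>[OF that]
      by (simp add: minus_l2.rep_eq norm_l2.rep_eq)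
    then show "\<exists>N. \<forall>m\<ge>N. L2_set (\<lambda>k. cmod (coord (X n) k - coord (X m) k)) F \<le> e" by blast
  qed
  obtain M where "\<forall>m\<ge>M. \<forall>n\<ge>M. norm (X m - X n) < 1" using CauchyD[OF X, of 1] by auto
  then have M: "\<And>m n. m \<ge> M \<Longrightarrow> n \<ge> M \<Longrightarrow> norm (X n - X m) \<le> 1"
    by (simp add: less_imp_le)
  have "(\<lambda>k. (cmod (coord (X M) k - x k))\<^sup>2) summable_on UNIV"
    by (rule l2_memI(1)[OF key[of M M 1]]) (use M in auto)
  moreover have "(\<lambda>k. (cmod (coord (X M) k))\<^sup>2) summable_on UNIV"
    using Rep_l2[of "X M"] by simp
  ultimately have "(\<lambda>k. (cmod (coord (X M) k + (-1) * (coord (X M) k - x k)))\<^sup>2) summable_on UNIV"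
    by (intro l2_add_closed l2_scale_closed)
  then have mem: "(\<lambda>k. (cmod (x k))\<^sup>2) summable_on UNIV" by simp
  define L where "L = Abs_l2 x"
  have L: "coord L = x" using mem by (simp add: L_def Abs_l2_inverse)
  have "X \<longlonglongrightarrow> L"
  proof (rule LIMSEQ_I)
    fix e :: real assume "e > 0"
    then obtain M where M: "\<forall>m\<ge>M. \<forall>n\<ge>M. norm (X m - X n) < e / 2"
      using CauchyD[OF X, of "e/2"] by auto
    have "norm (X n - L) \<le> e / 2" if "n \<ge> M" for n
      unfolding norm_l2.rep_eq minus_l2.rep_eq L
      by (rule l2_memI(2)[OF key[of M n "e/2"]]) (use M that less_imp_le in auto)
    then show "\<exists>M. \<forall>n\<ge>M. norm (X n - L) < e" using \<open>e > 0\<close>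
      by (intro exI[of _ M]) (fastforce intro: le_less_trans)
  qed
  then show "convergent X" by (rule convergentI)
qed

lemma l2_scale_simps:
  "l2_scale c (x + y) = l2_scale c x + l2_scale c y"
  "l2_scale c (x - y) = l2_scale c x - l2_scale c y"
  "l2_scale c (- x) = - l2_scale c x"
  "l2_scale c 0 = 0"
  "l2_scale c (r *\<^sub>R x) = r *\<^sub>R l2_scale c x"
  "l2_scale c (l2_scale d x) = l2_scale d (l2_scale c x)"
  by (transfer; auto simp: algebra_simps scaleR_conv_of_real)+

lemma norm_l2_scale: "norm (l2_scale c x) = cmod c * norm x"
  by transfer (simp add: norm_mult power_mult_distrib infsum_cmult_right' real_sqrt_mult)

lemma bounded_linear_l2_scale: "bounded_linear (l2_scale c)"
  by (rule bounded_linear_intro[where K="cmod c"])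
    (simp_all add: l2_scale_simps norm_l2_scale)

lifting_forget l2.lifting

definition l2_inner :: "'a l2 \<Rightarrow> 'a l2 \<Rightarrow> complex"
  where "l2_inner x y = (\<Sum>\<^sub>\<infinity>k. coord x k * cnj (coord y k))"

section \<open>The Banach algebra of bounded operators\<close>

text \<open>\<^typ>\<open>'a l2 \<Rightarrow>\<^sub>L 'a l2\<close> contains all bounded real-linear maps; the operators are the
  complex-linear ones among them.\<close>

typedef 'a l2op =
  "{f :: 'a l2 \<Rightarrow>\<^sub>L 'a l2. \<forall>c x. blinfun_apply f (l2_scale c x) = l2_scale c (blinfun_apply f x)}"
  by (rule exI[of _ 0]) (simp add: l2_scale_simps)

setup_lifting type_definition_l2op

lift_definition app :: "'a l2op \<Rightarrow> 'a l2 \<Rightarrow> 'a l2"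
  is "\<lambda>f. blinfun_apply f" .

instantiation l2op :: (type) real_normed_algebra_1
begin

lift_definition zero_l2op :: "'a l2op" is 0 by (simp add: l2_scale_simps)
lift_definition one_l2op :: "'a l2op" is id_blinfun by simp
lift_definition plus_l2op :: "'a l2op \<Rightarrow> 'a l2op \<Rightarrow> 'a l2op" is "(+)"
  by (simp add: blinfun.add_left l2_scale_simps)
lift_definition minus_l2op :: "'a l2op \<Rightarrow> 'a l2op \<Rightarrow> 'a l2op" is "(-)"
  by (simp add: blinfun.diff_left l2_scale_simps)
lift_definition uminus_l2op :: "'a l2op \<Rightarrow> 'a l2op" is uminus
  by (simp add: blinfun.minus_left l2_scale_simps)
lift_definition scaleR_l2op :: "real \<Rightarrow> 'a l2op \<Rightarrow> 'a l2op" is "(*\<^sub>R)"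
  by (simp add: blinfun.scaleR_left l2_scale_simps)
lift_definition times_l2op :: "'a l2op \<Rightarrow> 'a l2op \<Rightarrow> 'a l2op" is "(o\<^sub>L)" by simp
lift_definition norm_l2op :: "'a l2op \<Rightarrow> real" is norm .
definition sgn_l2op :: "'a l2op \<Rightarrow> 'a l2op" where "sgn_l2op A = inverse (norm A) *\<^sub>R A"
definition dist_l2op :: "'a l2op \<Rightarrow> 'a l2op \<Rightarrow> real" where "dist_l2op A B = norm (A - B)"
definition uniformity_l2op :: "('a l2op \<times> 'a l2op) filter"
  where "uniformity_l2op = (INF e\<in>{0<..}. principal {(x, y). dist x y < e})"
definition open_l2op :: "'a l2op set \<Rightarrow> bool"
  where "open_l2op S = (\<forall>x\<in>S. \<forall>\<^sub>F (x', y) in uniformity. x' = x \<longrightarrow> y \<in> S)"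

instance
proof
  fix A B C :: "'a l2op" and r s :: real
  show "dist A B = norm (A - B)" "sgn A = inverse (norm A) *\<^sub>R A"
    "uniformity = (INF e\<in>{0<..}. principal {(x :: 'a l2op, y). dist x y < e})"
    by (simp_all add: dist_l2op_def sgn_l2op_def uniformity_l2op_def)
  show "open S = (\<forall>x\<in>S. \<forall>\<^sub>F (x', y) in uniformity. x' = x \<longrightarrow> y \<in> S)" for S :: "'a l2op set"
    by (rule open_l2op_def)
  show "A + B + C = A + (B + C)" "A + B = B + A" "0 + A = A" "- A + A = 0" "A - B = A + - B"
    "r *\<^sub>R (A + B) = r *\<^sub>R A + r *\<^sub>R B" "(r + s) *\<^sub>R A = r *\<^sub>R A + s *\<^sub>R A"
    "r *\<^sub>R s *\<^sub>R A = (r * s) *\<^sub>R A" "1 *\<^sub>R A = A"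
    by (transfer; simp add: algebra_simps)+
  show "A * B * C = A * (B * C)" "(A + B) * C = A * C + B * C" "A * (B + C) = A * B + A * C"
    "r *\<^sub>R A * B = r *\<^sub>R (A * B)" "A * r *\<^sub>R B = r *\<^sub>R (A * B)" "1 * A = A" "A * 1 = A"
    by (transfer; auto intro!: blinfun_eqI simp: blinfun.bilinear_simps)+
  show "(norm A = 0) = (A = 0)" "norm (r *\<^sub>R A) = \<bar>r\<bar> * norm A"
    by (transfer; simp)+
  show "norm (A + B) \<le> norm A + norm B" by transfer (rule norm_triangle_ineq)
  show "norm (A * B) \<le> norm A * norm B" by transfer (rule norm_blinfun_compose)
  have "norm (1 :: 'a l2op) \<le> 1" by transfer (rule norm_blinfun_id_le)
  moreover have "1 \<le> norm (1 :: 'a l2op)"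
    by (transfer, use norm_blinfun[of id_blinfun "l2_basis undefined"] in \<open>simp add: norm_l2_basis\<close>)
  ultimately show "norm (1 :: 'a l2op) = 1" by (rule antisym)
  then show "(0 :: 'a l2op) \<noteq> 1" using \<open>(norm A = 0) = (A = 0)\<close>
    by (metis norm_l2op.rep_eq norm_zero zero_l2op.rep_eq zero_neq_one)
qed

end

instance l2op :: (type) banach
proof
  fix X :: "nat \<Rightarrow> 'a l2op"
  assume X: "Cauchy X"
  have "Cauchy (\<lambda>n. Rep_l2op (X n))"
    using X unfolding Cauchy_def dist_norm
    by (simp add: norm_l2op.rep_eq minus_l2op.rep_eq)
  then obtain f where f: "(\<lambda>n. Rep_l2op (X n)) \<longlonglongrightarrow> f"
    by (auto simp: Cauchy_convergent_iff convergent_def)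
  have "blinfun_apply f (l2_scale c x) = l2_scale c (blinfun_apply f x)" for c x
  proof (rule LIMSEQ_unique)
    show "(\<lambda>n. blinfun_apply (Rep_l2op (X n)) (l2_scale c x)) \<longlonglongrightarrow> blinfun_apply f (l2_scale c x)"
      by (intro tendsto_intros f)
    have "(\<lambda>n. l2_scale c (blinfun_apply (Rep_l2op (X n)) x)) \<longlonglongrightarrow> l2_scale c (blinfun_apply f x)"
      by (intro bounded_linear.tendsto[OF bounded_linear_l2_scale] tendsto_intros f)
    moreover have "blinfun_apply (Rep_l2op (X n)) (l2_scale c x)
        = l2_scale c (blinfun_apply (Rep_l2op (X n)) x)" for n
      using Rep_l2op[of "X n"] by simp
    ultimately show "(\<lambda>n. blinfun_apply (Rep_l2op (X n)) (l2_scale c x))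
        \<longlonglongrightarrow> l2_scale c (blinfun_apply f x)"
      by simp
  qed
  then have "Rep_l2op (Abs_l2op f) = f" by (simp add: Abs_l2op_inverse)
  then have "X \<longlonglongrightarrow> Abs_l2op f"
    using f unfolding LIMSEQ_iff by (simp add: norm_l2op.rep_eq minus_l2op.rep_eq)
  then show "convergent X" by (rule convergentI)
qed

lift_definition op_scale :: "complex \<Rightarrow> 'a l2op \<Rightarrow> 'a l2op"
  is "\<lambda>c f. Blinfun (l2_scale c) o\<^sub>L f"
  by (simp add: bounded_linear_Blinfun_apply[OF bounded_linear_l2_scale] l2_scale_simps(6))

lemma app_op_scale: "app (op_scale c A) x = l2_scale c (app A x)"
  by transfer (simp add: bounded_linear_Blinfun_apply[OF bounded_linear_l2_scale])

definition op_inv :: "'a l2op \<Rightarrow> 'a l2op"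
  where "op_inv A = (THE B. A * B = 1 \<and> B * A = 1)"

definition entry :: "'a l2op \<Rightarrow> 'a \<Rightarrow> 'a \<Rightarrow> complex"
  where "entry A i j = coord (app A (l2_basis j)) i"

section \<open>Compact and trace class operators, Fredholm determinant\<close>

definition compact_op :: "'a l2op \<Rightarrow> bool"
  where "compact_op A \<longleftrightarrow> compact (closure (app A ` cball 0 1))"

definition op_adj :: "'a l2op \<Rightarrow> 'a l2op"
  where "op_adj A = (THE B. \<forall>x y. l2_inner (app A x) y = l2_inner x (app B y))"

definition positive_op :: "'a l2op \<Rightarrow> bool"
  where "positive_op S \<longleftrightarrow> (\<forall>x. l2_inner (app S x) x \<in> \<real> \<and> 0 \<le> Re (l2_inner (app S x) x))"

definition op_abs :: "'a l2op \<Rightarrow> 'a l2op"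
  where "op_abs A = (THE S. positive_op S \<and> S * S = op_adj A * A)"

text \<open>The trace of \<open>|A|\<close>, computed in the standard basis, has nonnegative terms.\<close>

definition trace_class :: "'a l2op \<Rightarrow> bool"
  where "trace_class A \<longleftrightarrow> (\<lambda>k. Re (entry (op_abs A) k k)) summable_on UNIV"

definition trace_norm :: "'a l2op \<Rightarrow> real"
  where "trace_norm A = (\<Sum>\<^sub>\<infinity>k. Re (entry (op_abs A) k k))"

text \<open>For \<open>K\<close> trace class, \<open>det (I + K) = (\<Sum>m. tr (\<Lambda>\<^sup>m K))\<close>. The trace of
  the \<open>m\<close>-th exterior power, written out in the standard basis, is Fredholm's expression
  \<open>1/m! \<Sum> det (K(i\<^sub>a, i\<^sub>b))\<close>, summed over all \<open>m\<close>-tuples of indices.\<close>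

definition fredholm_det :: "'a l2op \<Rightarrow> complex"
  where "fredholm_det B =
    (\<Sum>m. (\<Sum>\<^sub>\<infinity>is\<in>{is :: 'a list. length is = m}.
        det (mat m m (\<lambda>(a, b). entry (B - 1) (is ! a) (is ! b)))) / fact m)"

section \<open>The concrete operators\<close>

text \<open>\<open>coord_map S f\<close> sends \<open>(x\<^sub>k)\<close> to \<open>(y\<^sub>k)\<close> with \<open>y\<^sub>k = x\<^bsub>f k\<^esub>\<close> for
  \<open>k \<in> S\<close> and \<open>y\<^sub>k = 0\<close> otherwise; it is only used with \<open>f\<close> injective on \<open>S\<close>.\<close>

definition coord_map :: "'b set \<Rightarrow> ('b \<Rightarrow> 'a) \<Rightarrow> 'a l2 \<Rightarrow>\<^sub>L 'b l2"
  where "coord_map S f = Blinfun (\<lambda>x. Abs_l2 (\<lambda>k. if k \<in> S then coord x (f k) else 0))"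

lemma coord_coord_map:
  fixes f :: "'b \<Rightarrow> 'a" and S :: "'b set"
  assumes "inj_on f S"
  shows "coord (blinfun_apply (coord_map S f) x) k = (if k \<in> S then coord x (f k) else 0)"
proof -
  let ?g = "\<lambda>x k. if k \<in> S then coord x (f k) else (0::complex)"
  have fin: "L2_set (\<lambda>k. cmod (?g x k)) F \<le> norm x" if "finite F" for x F
  proof -
    have "L2_set (\<lambda>k. cmod (?g x k)) F = L2_set (\<lambda>k. cmod (coord x (f k))) (F \<inter> S)"
      unfolding L2_set_def using that
      by (auto simp: sum.inter_restrict intro!: sum.cong)
    also have "\<dots> = L2_set (\<lambda>j. cmod (coord x j)) (f ` (F \<inter> S))"
      unfolding L2_set_def using inj_on_subset[OF assms, of "F \<inter> S"] by (simp add: sum.reindex)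
    also have "\<dots> \<le> norm x"
      using l2_finite_le[of "coord x" "f ` (F \<inter> S)"] Rep_l2[of x] that
      by (simp add: norm_l2.rep_eq)
    finally show ?thesis .
  qed
  have rep: "coord (Abs_l2 (?g x)) = ?g x" for x
    using l2_memI(1)[OF fin[of _ x]] by (intro Abs_l2_inverse) blast
  have "bounded_linear (\<lambda>x. Abs_l2 (?g x))"
  proof (rule bounded_linear_intro[where K=1])
    fix x y :: "'a l2" and r :: real
    show "Abs_l2 (?g (x + y)) = Abs_l2 (?g x) + Abs_l2 (?g y)"
      by (rule Rep_l2_inject[THEN iffD1], rule ext) (simp add: plus_l2.rep_eq rep)
    show "Abs_l2 (?g (r *\<^sub>R x)) = r *\<^sub>R Abs_l2 (?g x)"
      by (rule Rep_l2_inject[THEN iffD1], rule ext) (simp add: scaleR_l2.rep_eq rep)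
    show "norm (Abs_l2 (?g x)) \<le> norm x * 1"
      using l2_memI(2)[OF fin[of _ x]] by (simp add: norm_l2.rep_eq[of "Abs_l2 _"] rep)
  qed
  then show ?thesis by (simp add: coord_map_def bounded_linear_Blinfun_apply rep)
qed

lemma coord_map_scale:
  assumes "inj_on f S"
  shows "blinfun_apply (coord_map S f) (l2_scale c x) = l2_scale c (blinfun_apply (coord_map S f) x)"
  by (rule Rep_l2_inject[THEN iffD1], rule ext) (simp add: l2_scale.rep_eq coord_coord_map[OF assms])

lift_definition proj_op :: "'a set \<Rightarrow> 'a l2op" is "\<lambda>S. coord_map S (\<lambda>k. k)"
  by (simp add: coord_map_scale)

definition P_op :: "int l2op" where "P_op = proj_op {0..}"

definition P_sec :: "int \<Rightarrow> int \<Rightarrow> int l2op" where "P_sec n\<^sub>1 n\<^sub>2 = proj_op {n\<^sub>1..<n\<^sub>2}"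

lift_definition J_op :: "int l2op" is "coord_map UNIV (\<lambda>k. - k - 1)"
  by (simp add: coord_map_scale inj_on_def)

lift_definition U_op :: "int \<Rightarrow> int l2op" is "\<lambda>n. coord_map UNIV (\<lambda>k. k - n)"
  by (simp add: coord_map_scale inj_on_def)

lemma coord_proj_op: "coord (app (proj_op S) x) k = (if k \<in> S then coord x k else 0)"
  by (simp add: app.rep_eq proj_op.rep_eq coord_coord_map)

lemma coord_J_op: "coord (app J_op x) k = coord x (- k - 1)"
  by (simp add: app.rep_eq J_op.rep_eq coord_coord_map inj_on_def)

lemma coord_U_op: "coord (app (U_op n) x) k = coord x (k - n)"
  by (simp add: app.rep_eq U_op.rep_eq coord_coord_map inj_on_def)

lemma inj_on_nat: "inj_on nat {0..}"
  by (auto simp: inj_on_def)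

text \<open>An operator on \<open>l\<^sup>2(\<int>)\<close> of the form \<open>P A P\<close> regarded as an operator on
  \<open>l\<^sup>2\<close> over \<^typ>\<open>nat\<close>: extend by zero, apply, restrict.\<close>

lift_definition on_nat :: "int l2op \<Rightarrow> nat l2op"
  is "\<lambda>f. coord_map UNIV int o\<^sub>L f o\<^sub>L coord_map {0..} nat"
  by (simp add: coord_map_scale inj_on_nat)

lemma entry_on_nat: "entry (on_nat A) i j = entry A (int i) (int j)"
proof -
  have "blinfun_apply (coord_map {0..} nat) (l2_basis j) = l2_basis (int j)"
    by (rule Rep_l2_inject[THEN iffD1], rule ext)
      (auto simp: coord_coord_map[OF inj_on_nat] l2_basis.rep_eq)
  then show ?thesis
    by (simp add: entry_def app.rep_eq on_nat.rep_eq coord_coord_map)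
qed

definition T_op :: "int l2op \<Rightarrow> nat l2op" where "T_op A = on_nat (P_op * A * P_op)"

definition H_op :: "int l2op \<Rightarrow> nat l2op" where "H_op A = on_nat (P_op * A * J_op * P_op)"

definition flip :: "int l2op \<Rightarrow> int l2op" where "flip A = J_op * A * J_op"

definition sec_mat :: "int \<Rightarrow> int \<Rightarrow> int l2op \<Rightarrow> complex mat"
  where "sec_mat n\<^sub>1 n\<^sub>2 A =
    mat (nat (n\<^sub>2 - n\<^sub>1)) (nat (n\<^sub>2 - n\<^sub>1))
      (\<lambda>(i, j). entry (P_sec n\<^sub>1 n\<^sub>2 * A * P_sec n\<^sub>1 n\<^sub>2) (n\<^sub>1 + int i) (n\<^sub>1 + int j))"

definition sec_det :: "int \<Rightarrow> int \<Rightarrow> int l2op \<Rightarrow> complex"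
  where "sec_det n\<^sub>1 n\<^sub>2 A = det (sec_mat n\<^sub>1 n\<^sub>2 A)"

definition sec_trace :: "int \<Rightarrow> int \<Rightarrow> int l2op \<Rightarrow> complex"
  where "sec_trace n\<^sub>1 n\<^sub>2 A = (\<Sum>i<nat (n\<^sub>2 - n\<^sub>1). sec_mat n\<^sub>1 n\<^sub>2 A $$ (i, i))"

section \<open>Banach subalgebras of the operators on \<open>l\<^sup>2(\<int>)\<close>\<close>

definition banach_subalgebra :: "int l2op set \<Rightarrow> (int l2op \<Rightarrow> real) \<Rightarrow> bool"
  where "banach_subalgebra R nrm \<longleftrightarrow>
    0 \<in> R \<and> (\<forall>A\<in>R. \<forall>B\<in>R. A + B \<in> R \<and> A * B \<in> R) \<and> (\<forall>c. \<forall>A\<in>R. op_scale c A \<in> R) \<and>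
    (\<forall>A\<in>R. 0 \<le> nrm A \<and> (nrm A = 0 \<longleftrightarrow> A = 0)) \<and>
    (\<forall>c. \<forall>A\<in>R. nrm (op_scale c A) = cmod c * nrm A) \<and>
    (\<forall>A\<in>R. \<forall>B\<in>R. nrm (A + B) \<le> nrm A + nrm B) \<and>
    (\<exists>C. \<forall>A\<in>R. \<forall>B\<in>R. nrm (A * B) \<le> C * nrm A * nrm B) \<and>
    (\<forall>X. (\<forall>n. X n \<in> R) \<and> (\<forall>e>0. \<exists>M. \<forall>m\<ge>M. \<forall>n\<ge>M. nrm (X m - X n) < e) \<longrightarrow>
      (\<exists>L\<in>R. (\<lambda>n::nat. nrm (X n - L)) \<longlonglongrightarrow> 0))"

definition unital :: "int l2op set \<Rightarrow> bool" where "unital R \<longleftrightarrow> 1 \<in> R"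

definition rigid :: "int l2op set \<Rightarrow> bool"
  where "rigid R \<longleftrightarrow>
    (\<forall>A\<in>R. compact_op (T_op A) \<or> compact_op (T_op (flip A)) \<longrightarrow> A = 0)"

definition suitable :: "int l2op set \<Rightarrow> (int l2op \<Rightarrow> real) \<Rightarrow> bool"
  where "suitable R nrm \<longleftrightarrow>
    (\<forall>A\<in>R. norm A \<le> nrm A) \<and>
    (\<forall>A\<in>R. \<forall>B\<in>R. trace_class (H_op A * H_op (flip B)) \<and> trace_class (H_op (flip A) * H_op B)) \<and>
    (\<exists>M>0. \<forall>A\<in>R. \<forall>B\<in>R.
      max (trace_norm (H_op A * H_op (flip B))) (trace_norm (H_op (flip A) * H_op B))
        \<le> M * nrm A * nrm B)"

definition shift_invariant :: "int l2op set \<Rightarrow> (int l2op \<Rightarrow> real) \<Rightarrow> bool"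
  where "shift_invariant R nrm \<longleftrightarrow>
    (\<forall>A\<in>R. \<forall>n. U_op (- n) * A * U_op n \<in> R \<and> nrm (U_op (- n) * A * U_op n) = nrm A)"

text \<open>Only the values of \<open>U\<close> on \<open>R\<close> matter.\<close>

definition fractal ::
    "int l2op set \<Rightarrow> (int l2op \<Rightarrow> real) \<Rightarrow> (nat \<Rightarrow> int) \<Rightarrow> (int l2op \<Rightarrow> int l2op) \<Rightarrow> bool"
  where "fractal R nrm h U \<longleftrightarrow>
    (\<forall>A\<in>R. U A \<in> R \<and> (\<lambda>n. nrm (U_op (- h n) * A * U_op (h n) - U A)) \<longlonglongrightarrow> 0)"

end

theory Submission
  imports
    Defs
    "HOL-Complex_Analysis.Complex_Analysis"
    "HOL-Combinatorics.Multiset_Permutations"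
begin

text \<open>
  Shifting by \<open>h\<^sub>1(n)\<close> turns the sections into truncations \<open>P T(A\<^sub>n) P\<close> of Toeplitz operators on
  \<open>l\<^sup>2(\<nat>)\<close>, where \<open>P\<close> keeps the first \<open>N = h\<^sub>2(n) - h\<^sub>1(n)\<close> coordinates and \<open>Q = I - P\<close>. The proof
  is a Jacobi identity for complementary corners, carried out with Fredholm determinants. Put
  \<open>X\<^sub>i = T(A\<^sub>i)\<close> for the shifted \<open>A\<^sub>i\<close>, \<open>D\<^sub>i = P X\<^sub>i P + Q X\<^sub>i Q\<close>, \<open>E = exp D\<^sub>1 \<cdots> exp D\<^sub>r\<close>,
  \<open>G = T(A) E\<^sup>-\<^sup>1\<close> and \<open>G' = E T(A\<^sup>-\<^sup>1)\<close>. As \<open>E\<close> commutes with \<open>P\<close>, the determinant of \<open>P G P\<close> is the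
  quotient whose limit is sought.

  Three facts combine. First, \<open>X\<^sub>i - D\<^sub>i\<close> has finite rank and zero diagonal, and
  \<open>det (exp X exp (-D)) = exp (trace (X - D))\<close> whenever \<open>X - D\<close> is of trace class; hence
  \<open>det G = det (T(A) exp (-X\<^sub>r) \<cdots> exp (-X\<^sub>1))\<close>, which tends to \<open>det \<B>\<^sub>1\<close>. Secondly, the corner
  \<open>Q G' Q\<close>, shifted back by \<open>N\<close>, is \<open>exp T(A\<^sub>1) \<cdots> exp T(A\<^sub>r) T(A\<^sup>-\<^sup>1)\<close> for the operators
  shifted by \<open>h\<^sub>2(n)\<close>, so its determinant tends to \<open>det \<B>\<^sub>2\<close>. Thirdly, \<open>G G' = I - M\<close> where \<open>M\<close>
  is a product of two Hankel operators and converges in trace norm, so that \<open>M Q\<close> tends to zero.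
  Multiplying \<open>G (P + G' Q) = G P + Q - M Q\<close> on the right by \<open>I - Q G P\<close>, which has
  determinant one, gives
  \<open>det G \<cdot> det (P + G' Q) = det (P G P + Q + M Q (G P - I))\<close>.
  The last term is small in trace norm and \<open>P G P - P\<close> is bounded in trace norm uniformly in \<open>n\<close>, so the
  right side differs from \<open>det (P G P + Q)\<close> by a null sequence. No inverse of \<open>T(A)\<close>
  occurs, and the case \<open>det \<B>\<^sub>1 = 0\<close> is not special.

  The trace norm estimates come from Widom's formula \<open>T(AB) - T(A) T(B) = H(A) H(B~)\<close>: a map
  that is multiplicative up to a trace class error bounded by a multiple of the norms of the factors
  sends \<open>exp A\<^sub>1 \<cdots> exp A\<^sub>r\<close> to the product of the exponentials of the images, again up to trace
  class, with bounds and limits that can be followed through the exponential series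
  (lemmas \<open>exp_prod_defect_bounded\<close> and \<open>exp_prod_defect_trace_tendsto\<close>).

  The determinant theory is built from finite sections. Hadamard's inequality bounds
  \<open>det (I + K)\<close> on every section by a function of the trace norm of \<open>K\<close>; Cauchy's estimates for the
  polynomial \<open>det (I + z K)\<close> then give convergence of Fredholm's series, and Schwarz's
  lemma gives continuity in trace norm (lemmas \<open>sdet_bound\<close>, \<open>sdet_tendsto_fredholm_det\<close>,
  \<open>sdet_Lipschitz\<close>). Trace norms are handled by duality, and the link with \<open>|K|\<close> is
  a factorisation of \<open>K\<close> into two Hilbert-Schmidt operators.
\<close>

section \<open>Coordinates, inner product and adjoints\<close>

lemma l2_eqI: "(\<And>k. coord x k = coord y k) \<Longrightarrow> x = y"
  by (rule Rep_l2_inject[THEN iffD1]) auto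

lemmas coord_simps = plus_l2.rep_eq minus_l2.rep_eq uminus_l2.rep_eq zero_l2.rep_eq
  scaleR_l2.rep_eq l2_scale.rep_eq l2_basis.rep_eq

lemma coord_sum: "coord (\<Sum>i\<in>I. f i) k = (\<Sum>i\<in>I. coord (f i) k)"
  by (induction I rule: infinite_finite_induct) (auto simp: coord_simps)

lemma app_add_right: "app A (x + y) = app A x + app A y"
  and app_diff_right: "app A (x - y) = app A x - app A y"
  and app_minus_right: "app A (- x) = - app A x"
  and app_zero_right [simp]: "app A 0 = 0"
  and app_scaleR_right: "app A (r *\<^sub>R x) = r *\<^sub>R app A x"
  by (simp_all add: app.rep_eq blinfun.bilinear_simps)

lemma app_scale: "app A (l2_scale c x) = l2_scale c (app A x)"
  using Rep_l2op[of A] by (simp add: app.rep_eq)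

lemma app_plus: "app (A + B) x = app A x + app B x"
  and app_minus: "app (A - B) x = app A x - app B x"
  and app_uminus: "app (- A) x = - app A x"
  and app_zero [simp]: "app 0 x = 0"
  and app_scaleR: "app (r *\<^sub>R A) x = r *\<^sub>R app A x"
  and app_one [simp]: "app 1 x = x"
  and app_times: "app (A * B) x = app A (app B x)"
  by (simp_all add: app.rep_eq plus_l2op.rep_eq minus_l2op.rep_eq uminus_l2op.rep_eq
      zero_l2op.rep_eq scaleR_l2op.rep_eq one_l2op.rep_eq times_l2op.rep_eq blinfun.bilinear_simps)

lemmas app_simps = app_add_right app_diff_right app_minus_right app_scaleR_right app_scale
  app_plus app_minus app_uminus app_scaleR app_times

lemma app_sum_right: "app A (\<Sum>i\<in>I. f i) = (\<Sum>i\<in>I. app A (f i))"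
  by (induction I rule: infinite_finite_induct) (auto simp: app_simps)

lemma norm_app: "norm (app A x) \<le> norm A * norm x"
  by (simp add: app.rep_eq norm_l2op.rep_eq norm_blinfun)

lemma bounded_linear_app: "bounded_linear (app A)"
  by (simp add: app.rep_eq[abs_def] blinfun.bounded_linear_right)

lemma bounded_linear_app_left: "bounded_linear (\<lambda>A. app A x)"
  by (rule bounded_linear_intro[where K="norm x"]) (auto simp: app_simps norm_app)

lemma op_eqI: "(\<And>x. app A x = app B x) \<Longrightarrow> A = B"
  by (rule Rep_l2op_inject[THEN iffD1], rule blinfun_eqI) (simp add: app.rep_eq)

lemma norm_l2op_le:
  assumes "\<And>x. norm (app A x) \<le> c * norm x" "0 \<le> c"
  shows "norm A \<le> c"
  unfolding norm_l2op.rep_eq using assms by (intro norm_blinfun_bound) (auto simp: app.rep_eq)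

lemma tendsto_app: "(A \<longlongrightarrow> A') F \<Longrightarrow> ((\<lambda>n. app (A n) x) \<longlongrightarrow> app A' x) F"
  by (rule bounded_linear.tendsto[OF bounded_linear_app_left])

lemma bounded_linear_coord: "bounded_linear (\<lambda>x. coord x k)"
  by (rule bounded_linear_intro[where K=1]) (auto simp: coord_simps l2_coord_le)

lemma tendsto_coord: "(x \<longlongrightarrow> y) F \<Longrightarrow> ((\<lambda>n. coord (x n) k) \<longlongrightarrow> coord y k) F"
  by (rule bounded_linear.tendsto[OF bounded_linear_coord])

lemma tendsto_entry: "(A \<longlongrightarrow> A') F \<Longrightarrow> ((\<lambda>n. entry (A n) i j) \<longlongrightarrow> entry A' i j) F"
  unfolding entry_def by (intro tendsto_coord tendsto_app)

lemma entry_simps: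
  "entry (A + B) i j = entry A i j + entry B i j"
  "entry (A - B) i j = entry A i j - entry B i j"
  "entry (- A) i j = - entry A i j"
  "entry 0 i j = 0"
  "entry (r *\<^sub>R A) i j = r *\<^sub>R entry A i j"
  "entry (op_scale c A) i j = c * entry A i j"
  by (simp_all add: entry_def app_simps app_op_scale coord_simps)

lemma entry_one: "entry 1 i j = (if i = j then 1 else 0)"
  by (simp add: entry_def coord_simps)

lemma entry_le: "cmod (entry A i j) \<le> norm A"
  using order_trans[OF l2_coord_le norm_app[of A "l2_basis j"]] by (simp add: entry_def norm_l2_basis)

lemma summable_coord: "(\<lambda>k. (cmod (coord x k))\<^sup>2) summable_on UNIV"
  using Rep_l2[of x] by simp

lemma norm_l2_sq: "(norm x)\<^sup>2 = (\<Sum>\<^sub>\<infinity>k. (cmod (coord x k))\<^sup>2)"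
  unfolding norm_l2.rep_eq by (rule real_sqrt_pow2) (simp add: infsum_nonneg)

lemma sum_coord_le: "finite F \<Longrightarrow> (\<Sum>k\<in>F. (cmod (coord x k))\<^sup>2) \<le> (norm x)\<^sup>2"
  unfolding norm_l2_sq by (rule finite_sum_le_infsum) (auto simp: summable_coord)

lemma norm_l2_finite:
  assumes "finite F" "\<And>k. k \<notin> F \<Longrightarrow> coord x k = 0"
  shows "(norm x)\<^sup>2 = (\<Sum>k\<in>F. (cmod (coord x k))\<^sup>2)"
proof -
  have "(\<Sum>\<^sub>\<infinity>k. (cmod (coord x k))\<^sup>2) = (\<Sum>\<^sub>\<infinity>k\<in>F. (cmod (coord x k))\<^sup>2)"
    by (rule infsum_cong_neutral) (use assms in auto)
  then show ?thesis using assms by (simp add: norm_l2_sq)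
qed

lemma summable_l2_inner: "(\<lambda>k. coord x k * cnj (coord y k)) summable_on UNIV"
proof (rule abs_summable_summable, rule summable_on_comparison_test)
  show "(\<lambda>k. (cmod (coord x k))\<^sup>2 + (cmod (coord y k))\<^sup>2) summable_on UNIV"
    by (intro summable_on_add summable_coord)
  fix k
  have "2 * (cmod (coord x k) * cmod (coord y k)) \<le> (cmod (coord x k))\<^sup>2 + (cmod (coord y k))\<^sup>2"
    using sum_squares_bound[of "cmod (coord x k)" "cmod (coord y k)"] by simp
  moreover have "0 \<le> cmod (coord x k) * cmod (coord y k)" by simp
  ultimately have "cmod (coord x k) * cmod (coord y k) \<le> (cmod (coord x k))\<^sup>2 + (cmod (coord y k))\<^sup>2"
    by linarith
  then show "norm (coord x k * cnj (coord y k)) \<le> (cmod (coord x k))\<^sup>2 + (cmod (coord y k))\<^sup>2"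
    by (simp add: norm_mult)
qed auto

lemma inner_add_left: "l2_inner (x + x') y = l2_inner x y + l2_inner x' y"
  unfolding l2_inner_def
  by (subst infsum_add[symmetric]) (auto simp: summable_l2_inner coord_simps ring_distribs)

lemma inner_cnj: "cnj (l2_inner x y) = l2_inner y x"
  unfolding l2_inner_def by (subst infsum_cnj[symmetric]) (simp add: mult.commute)

lemma inner_scale_left: "l2_inner (l2_scale c x) y = c * l2_inner x y"
  unfolding l2_inner_def by (subst infsum_cmult_right'[symmetric]) (simp add: coord_simps mult.assoc)

lemma inner_add_right: "l2_inner x (y + y') = l2_inner x y + l2_inner x y'"
  by (metis inner_add_left inner_cnj complex_cnj_add)

lemma inner_scale_right: "l2_inner x (l2_scale c y) = cnj c * l2_inner x y"
  by (metis inner_scale_left inner_cnj complex_cnj_mult)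

lemma scaleR_l2_scale: "r *\<^sub>R (x :: 'a l2) = l2_scale (complex_of_real r) x"
  by (rule l2_eqI) (simp add: coord_simps scaleR_conv_of_real)

lemma minus_l2_scale: "- (x :: 'a l2) = l2_scale (-1) x"
  by (rule l2_eqI) (simp add: coord_simps)

lemma inner_minus_left: "l2_inner (- x) y = - l2_inner x y"
  by (simp add: minus_l2_scale inner_scale_left)

lemma inner_minus_right: "l2_inner x (- y) = - l2_inner x y"
  by (simp add: minus_l2_scale inner_scale_right)

lemma inner_diff_left: "l2_inner (x - x') y = l2_inner x y - l2_inner x' y"
  using inner_add_left[of x "- x'" y] by (simp add: inner_minus_left)

lemma inner_diff_right: "l2_inner x (y - y') = l2_inner x y - l2_inner x y'"
  using inner_add_right[of x y "- y'"] by (simp add: inner_minus_right)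

lemma inner_scaleR_left: "l2_inner (r *\<^sub>R x) y = r *\<^sub>R l2_inner x y"
  by (simp add: scaleR_l2_scale inner_scale_left scaleR_conv_of_real)

lemma inner_scaleR_right: "l2_inner x (r *\<^sub>R y) = r *\<^sub>R l2_inner x y"
  by (simp add: scaleR_l2_scale inner_scale_right scaleR_conv_of_real)

lemma inner_zero [simp]: "l2_inner 0 y = 0" "l2_inner x 0 = 0"
  by (simp_all add: l2_inner_def coord_simps)

lemmas inner_simps = inner_add_left inner_add_right inner_scale_left inner_scale_right
  inner_minus_left inner_minus_right inner_diff_left inner_diff_right
  inner_scaleR_left inner_scaleR_right

lemma inner_self: "l2_inner x x = complex_of_real ((norm x)\<^sup>2)"
  unfolding l2_inner_def norm_l2_sq complex_norm_square[symmetric]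
  by (rule infsumI, rule has_sum_of_real, rule has_sum_infsum, rule summable_coord)

lemma inner_finite:
  assumes "finite F" "\<And>k. k \<notin> F \<Longrightarrow> coord x k = 0 \<or> coord y k = 0"
  shows "l2_inner x y = (\<Sum>k\<in>F. coord x k * cnj (coord y k))"
proof -
  have "l2_inner x y = (\<Sum>\<^sub>\<infinity>k\<in>F. coord x k * cnj (coord y k))"
    unfolding l2_inner_def by (rule infsum_cong_neutral) (use assms(2) in fastforce)+
  then show ?thesis using assms(1) by simp
qed

lemma inner_basis_right: "l2_inner x (l2_basis k) = coord x k"
  by (subst inner_finite[where F="{k}"]) (auto simp: coord_simps)

lemma inner_basis_left: "l2_inner (l2_basis k) x = cnj (coord x k)"
  by (metis inner_basis_right inner_cnj)

lemma entry_inner: "entry A i j = l2_inner (app A (l2_basis j)) (l2_basis i)"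
  by (simp add: entry_def inner_basis_right)

text \<open>A form with real diagonal is Hermitian: expand it at \<open>x + y\<close> and at \<open>x + \<i> y\<close>.\<close>

lemma positive_op_hermitian:
  assumes "positive_op S"
  shows "l2_inner (app S x) y = l2_inner x (app S y)"
proof -
  define q where "q z = l2_inner (app S z) z" for z
  have q: "Im (q z) = 0" for z
    using assms by (auto simp: positive_op_def q_def complex_is_Real_iff)
  define c where "c = l2_inner (app S x) y"
  define d where "d = l2_inner (app S y) x"
  have add: "q (x + l2_scale t y) = q x + cnj t * c + t * d + t * cnj t * q y" for t
    by (simp add: q_def c_def d_def app_simps inner_simps algebra_simps)
  have "Im (c + d) = 0" using q[of "x + l2_scale 1 y"] q[of x] q[of y]
    by (simp add: add[of 1, simplified])
  moreover have "Im (- (\<i> * c) + \<i> * d) = 0" using q[of "x + l2_scale \<i> y"] q[of x] q[of y]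
    by (simp add: add)
  ultimately have "c = cnj d" by (simp add: complex_eq_iff)
  then show ?thesis by (simp add: c_def d_def inner_cnj)
qed

text \<open>The form \<open>\<langle>S x, y\<rangle>\<close> is semidefinite, so the usual minimisation over multiples of \<open>y\<close>
  applies; \<open>S = I\<close> yields the inequality for the inner product.\<close>

lemma positive_op_Cauchy_Schwarz:
  assumes "positive_op S"
  shows "(cmod (l2_inner (app S x) y))\<^sup>2 \<le> Re (l2_inner (app S x) x) * Re (l2_inner (app S y) y)"
proof -
  define q where "q z = l2_inner (app S z) z" for z
  have q: "q z = of_real (Re (q z))" "0 \<le> Re (q z)" for z
    using assms by (auto simp: positive_op_def q_def complex_is_Real_iff complex_eq_iff)
  define c where "c = l2_inner (app S x) y"
  define d where "d = l2_inner (app S y) x"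
  have add: "q (x + l2_scale t y) = q x + cnj t * c + t * d + t * cnj t * q y" for t
    by (simp add: q_def c_def d_def app_simps inner_simps algebra_simps)
  have d: "d = cnj c" by (simp add: c_def d_def positive_op_hermitian[OF assms, of y] inner_cnj)
  (* evaluate the form at x - r c y; the best r is 1 / q y, and r is arbitrary if q y = 0 *)
  have key: "0 \<le> Re (q x) - 2 * r * (cmod c)\<^sup>2 + r\<^sup>2 * (cmod c)\<^sup>2 * Re (q y)" for r
  proof -
    have "q (x + l2_scale (- (of_real r * c)) y)
        = q x - 2 * of_real r * (c * cnj c) + of_real r * of_real r * (c * cnj c) * q y"
      by (subst add) (simp add: d algebra_simps)
    also have "\<dots> = of_real (Re (q x) - 2 * r * (cmod c)\<^sup>2 + r\<^sup>2 * (cmod c)\<^sup>2 * Re (q y))"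
      unfolding complex_norm_square[symmetric] by (subst q(1)[of x], subst q(1)[of y]) (simp add: power2_eq_square)
    finally show ?thesis using q(2) by (metis Re_complex_of_real)
  qed
  show ?thesis
  proof (cases "Re (q y) = 0")
    case True
    have "c = 0"
    proof (rule ccontr)
      assume "c \<noteq> 0"
      then have c: "(cmod c)\<^sup>2 > 0" by simp
      have "0 \<le> Re (q x) - 2 * ((Re (q x) + 1) / (cmod c)\<^sup>2) * (cmod c)\<^sup>2"
        using key[of "(Re (q x) + 1) / (cmod c)\<^sup>2"] True by simp
      then show False using c q(2)[of x] by simp
    qed
    then show ?thesis using q(2) by (simp add: c_def q_def)
  next
    case False
    then have p: "Re (q y) > 0" using q(2)[of y] by simp
    have "0 \<le> Re (q x) - (cmod c)\<^sup>2 / Re (q y)"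
      using key[of "1 / Re (q y)"] p by (simp add: power2_eq_square field_simps)
    then have "(cmod c)\<^sup>2 / Re (q y) \<le> Re (q x)" by simp
    then show ?thesis using p by (simp add: pos_divide_le_eq q_def c_def)
  qed
qed

lemma positive_op_one: "positive_op 1"
  by (simp add: positive_op_def inner_self)

lemma inner_Cauchy_Schwarz: "cmod (l2_inner x y) \<le> norm x * norm y"
proof -
  have "(cmod (l2_inner x y))\<^sup>2 \<le> (norm x * norm y)\<^sup>2"
    using positive_op_Cauchy_Schwarz[OF positive_op_one, of x y]
    by (simp add: inner_self power_mult_distrib)
  then show ?thesis by (rule power2_le_imp_le) simp
qed

lemma bounded_linear_inner_left: "bounded_linear (\<lambda>x. l2_inner x y)"
  by (rule bounded_linear_intro[where K="norm y"]) (auto simp: inner_simps inner_Cauchy_Schwarz)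

lemma tendsto_inner_left: "(x \<longlongrightarrow> x') F \<Longrightarrow> ((\<lambda>n. l2_inner (x n) y) \<longlongrightarrow> l2_inner x' y) F"
  by (rule bounded_linear.tendsto[OF bounded_linear_inner_left])

lemma inner_ext: "(\<And>x. l2_inner x y = l2_inner x z) \<Longrightarrow> y = z"
  by (rule l2_eqI) (metis inner_basis_left complex_cnj_cnj)

abbreviation Pn :: "nat \<Rightarrow> nat l2op" where "Pn N \<equiv> proj_op {..<N}"

lemma Pn_expand: "app (Pn N) x = (\<Sum>k<N. l2_scale (coord x k) (l2_basis k))"
  by (rule l2_eqI) (simp add: coord_proj_op coord_sum coord_simps if_distrib cong: if_cong)

lemma proj_op_pythagoras:
  "(norm x)\<^sup>2 = (norm (app (proj_op S) x))\<^sup>2 + (norm (app (1 - proj_op S) x))\<^sup>2"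
proof -
  have eq: "(cmod (coord x k))\<^sup>2 = (cmod (coord (app (proj_op S) x) k))\<^sup>2
      + (cmod (coord (app (1 - proj_op S) x) k))\<^sup>2" for k
    by (simp add: app_simps coord_simps coord_proj_op)
  show ?thesis
    unfolding norm_l2_sq unfolding eq by (rule infsum_add) (rule summable_coord)+
qed

lemma norm_app_proj_op_le: "norm (app (proj_op S) x) \<le> norm x"
  and norm_app_co_proj_op_le: "norm (app (1 - proj_op S) x) \<le> norm x"
  using proj_op_pythagoras[of x S] by - (rule power2_le_imp_le; simp)+

lemma norm_proj_op_le: "norm (proj_op S) \<le> 1"
  by (rule norm_l2op_le) (simp_all add: norm_app_proj_op_le)

lemma norm_co_proj_op_le: "norm (1 - proj_op S) \<le> 1"
  by (rule norm_l2op_le) (simp_all add: norm_app_co_proj_op_le)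

lemma norm_Pn_sq: "(norm (app (Pn N) x))\<^sup>2 = (\<Sum>k<N. (cmod (coord x k))\<^sup>2)"
  by (subst norm_l2_finite[where F="{..<N}"]) (auto simp: coord_proj_op)

lemma coord_sq_sums: "(\<lambda>k. (cmod (coord (x :: nat l2) k))\<^sup>2) sums (norm x)\<^sup>2"
  unfolding norm_l2_sq by (rule has_sum_imp_sums) (simp add: summable_coord)

lemma Pn_tendsto: "(\<lambda>N. app (Pn N) x) \<longlonglongrightarrow> x"
proof -
  have "(\<lambda>N. (norm x)\<^sup>2 - (norm (app (Pn N) x))\<^sup>2) \<longlonglongrightarrow> (norm x)\<^sup>2 - (norm x)\<^sup>2"
    unfolding norm_Pn_sq by (intro tendsto_intros coord_sq_sums[unfolded sums_def])
  moreover have "(norm x)\<^sup>2 - (norm (app (Pn N) x))\<^sup>2 = (norm (app (Pn N) x - x))\<^sup>2" for N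
    using proj_op_pythagoras[of x "{..<N}"] by (simp add: app_simps norm_minus_commute)
  ultimately have "(\<lambda>N. (norm (app (Pn N) x - x))\<^sup>2) \<longlonglongrightarrow> 0" by simp
  then have "(\<lambda>N. sqrt ((norm (app (Pn N) x - x))\<^sup>2)) \<longlonglongrightarrow> sqrt 0" by (intro tendsto_intros)
  then show ?thesis by (simp add: tendsto_norm_zero_iff LIM_zero_iff)
qed

text \<open>The representing vector has the conjugates of the values of \<open>\<phi>\<close> on the basis as coordinates;
  testing \<open>\<phi>\<close> on finite sums of these shows that it is square summable.\<close>

lemma Riesz:
  fixes \<phi> :: "nat l2 \<Rightarrow> complex"
  assumes bl: "bounded_linear \<phi>" and sc: "\<And>c x. \<phi> (l2_scale c x) = c * \<phi> x"
  shows "\<exists>z. \<forall>x. \<phi> x = l2_inner x z"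
proof -
  obtain K where K: "\<And>x. cmod (\<phi> x) \<le> norm x * K"
    using bounded_linear.bounded[OF bl] by auto
  define f where "f k = cnj (\<phi> (l2_basis k))" for k
  have L2: "L2_set (\<lambda>k. cmod (f k)) F \<le> \<bar>K\<bar>" if "finite F" for F
  proof -
    define x where "x = (\<Sum>k\<in>F. l2_scale (f k) (l2_basis k))"
    define s where "s = (\<Sum>k\<in>F. (cmod (f k))\<^sup>2)"
    have cx: "coord x k = (if k \<in> F then f k else 0)" for k
      using that by (simp add: x_def coord_sum coord_simps if_distrib cong: if_cong)
    have "(norm x)\<^sup>2 = s"
      using that by (subst norm_l2_finite[of F]) (auto simp: cx s_def)
    then have nx: "norm x = sqrt s" by (metis norm_ge_zero real_sqrt_unique)
    have s0: "s \<ge> 0" by (simp add: s_def sum_nonneg)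
    have "\<phi> x = (\<Sum>k\<in>F. f k * \<phi> (l2_basis k))"
      unfolding x_def by (simp add: linear_sum[OF bounded_linear.linear[OF bl]] sc)
    also have "\<dots> = of_real s"
      unfolding s_def of_real_sum
      by (intro sum.cong refl) (metis complex_cnj_cnj complex_norm_square f_def)
    finally have "s \<le> sqrt s * K" using K[of x] s0 by (simp add: nx)
    also have "\<dots> \<le> sqrt s * \<bar>K\<bar>" by (intro mult_left_mono) (auto simp: s0)
    finally have le: "s \<le> sqrt s * \<bar>K\<bar>" .
    have "sqrt s \<le> \<bar>K\<bar>"
    proof (cases "s = 0")
      case False
      then have pos: "sqrt s > 0" using s0 by simp
      have "sqrt s * sqrt s \<le> sqrt s * \<bar>K\<bar>" using le s0 by simp
      then show ?thesis using pos by (rule mult_left_le_imp_le)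
    qed auto
    then show ?thesis by (simp add: L2_set_def s_def)
  qed
  define z where "z = Abs_l2 f"
  have cz: "coord z = f"
    unfolding z_def using l2_memI(1)[OF L2] by (intro Abs_l2_inverse) auto
  have "\<phi> x = l2_inner x z" for x
  proof (rule LIMSEQ_unique)
    show "(\<lambda>N. \<phi> (app (Pn N) x)) \<longlonglongrightarrow> \<phi> x"
      by (rule bounded_linear.tendsto[OF bl Pn_tendsto])
    have "\<phi> (app (Pn N) x) = l2_inner (app (Pn N) x) z" for N
      unfolding Pn_expand linear_sum[OF bounded_linear.linear[OF bl]]
      by (subst inner_finite[where F="{..<N}"])
        (auto simp: coord_sum coord_simps sc cz f_def if_distrib cong: if_cong)
    then show "(\<lambda>N. \<phi> (app (Pn N) x)) \<longlonglongrightarrow> l2_inner x z"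
      by (simp add: tendsto_inner_left Pn_tendsto)
  qed
  then show ?thesis by blast
qed

lemma adjoint_exists: "\<exists>B. \<forall>x y. l2_inner (app (A :: nat l2op) x) y = l2_inner x (app B y)"
proof -
  have "\<exists>z. \<forall>x. l2_inner (app A x) y = l2_inner x z" for y
    by (rule Riesz)
      (auto intro: bounded_linear_compose[OF bounded_linear_inner_left bounded_linear_app]
        simp: app_simps inner_simps)
  then obtain g where g: "\<And>x y. l2_inner (app A x) y = l2_inner x (g y)" by metis
  have sc: "g (l2_scale c y) = l2_scale c (g y)" for c y
    by (rule inner_ext) (metis g inner_scale_right)
  have "norm (g y) \<le> norm y * norm A" for y
  proof (cases "g y = 0")
    case False
    have "of_real ((norm (g y))\<^sup>2) = l2_inner (app A (g y)) y" by (simp add: g inner_self)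
    then have "(norm (g y))\<^sup>2 \<le> norm (app A (g y)) * norm y"
      by (metis inner_Cauchy_Schwarz norm_of_real real_norm_def abs_of_nonneg zero_le_power2)
    also have "\<dots> \<le> norm A * norm (g y) * norm y" by (intro mult_right_mono norm_app) auto
    finally show ?thesis using False by (simp add: power2_eq_square field_simps)
  qed simp
  moreover have "g (y + z) = g y + g z" "g (r *\<^sub>R y) = r *\<^sub>R g y" for y z r
    by (rule inner_ext; metis g inner_add_right inner_scaleR_right)+
  ultimately have bl: "bounded_linear g"
    by (intro bounded_linear_intro[where K="norm A"])
  have "app (Abs_l2op (Blinfun g)) y = g y" for y
    by (simp add: app.rep_eq Abs_l2op_inverse bounded_linear_Blinfun_apply[OF bl] sc)
  then show ?thesis using g by metis
qed

lemma op_adj_eqI: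
  assumes "\<And>x y. l2_inner (app A x) y = l2_inner x (app B y)"
  shows "op_adj A = B"
  unfolding op_adj_def
proof (rule the_equality)
  show "\<forall>x y. l2_inner (app A x) y = l2_inner x (app B y)" using assms by blast
  fix C assume "\<forall>x y. l2_inner (app A x) y = l2_inner x (app C y)"
  then show "C = B" using assms by (intro op_eqI inner_ext) metis
qed

lemma op_adj: "l2_inner (app (A :: nat l2op) x) y = l2_inner x (app (op_adj A) y)"
  using adjoint_exists[of A] op_adj_eqI[of A] by metis

lemma op_adj': "l2_inner x (app (A :: nat l2op) y) = l2_inner (app (op_adj A) x) y"
  by (metis inner_cnj op_adj)

lemma adj_simps:
  "op_adj (op_adj (A :: nat l2op)) = A"
  "op_adj (A + B) = op_adj A + op_adj (B :: nat l2op)"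
  "op_adj (A - B) = op_adj A - op_adj (B :: nat l2op)"
  "op_adj (A * B) = op_adj B * op_adj (A :: nat l2op)"
  "op_adj (r *\<^sub>R (A :: nat l2op)) = r *\<^sub>R op_adj A"
  "op_adj (1 :: nat l2op) = 1"
  "op_adj (Pn N) = Pn N"
proof -
  show "op_adj (op_adj (A :: nat l2op)) = A" by (rule op_adj_eqI) (simp only: op_adj')
  show "op_adj (Pn N) = Pn N"
    by (rule op_adj_eqI) (auto simp: l2_inner_def coord_proj_op intro!: infsum_cong)
qed (rule op_adj_eqI, simp add: app_simps inner_simps op_adj)+

lemma entry_adj: "entry (op_adj (A :: nat l2op)) i j = cnj (entry A j i)"
  by (simp add: entry_inner op_adj' adj_simps inner_cnj)

lemma norm_adj: "norm (op_adj (A :: nat l2op)) = norm A"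
proof -
  have le: "norm (op_adj B) \<le> norm B" for B :: "nat l2op"
  proof (rule norm_l2op_le)
    fix y
    show "norm (app (op_adj B) y) \<le> norm B * norm y"
    proof (cases "app (op_adj B) y = 0")
      case False
      have "of_real ((norm (app (op_adj B) y))\<^sup>2) = l2_inner (app B (app (op_adj B) y)) y"
        by (simp add: op_adj inner_self)
      then have "(norm (app (op_adj B) y))\<^sup>2 \<le> norm (app B (app (op_adj B) y)) * norm y"
        by (metis inner_Cauchy_Schwarz norm_of_real real_norm_def abs_of_nonneg zero_le_power2)
      also have "\<dots> \<le> norm B * norm (app (op_adj B) y) * norm y"
        by (intro mult_right_mono norm_app) auto
      finally show ?thesis using False by (simp add: power2_eq_square field_simps)
    qed simp
  qed simp
  show ?thesis using le[of A] le[of "op_adj A"] by (simp add: adj_simps)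
qed

section \<open>Square roots of positive operators\<close>

lemma positive_op_adj: "positive_op (S :: nat l2op) \<Longrightarrow> op_adj S = S"
  by (rule op_adj_eqI) (rule positive_op_hermitian)

lemma positive_opI:
  assumes "op_adj (S :: nat l2op) = S" "\<And>x. 0 \<le> Re (l2_inner (app S x) x)"
  shows "positive_op S"
proof -
  have "cnj (l2_inner (app S x) x) = l2_inner (app S x) x" for x
    using op_adj[of S x x] assms(1) by (simp add: inner_cnj)
  then show ?thesis using assms(2) by (simp add: positive_op_def Reals_cnj_iff)
qed

lemma Re_inner_le: "Re (l2_inner x y) \<le> norm x * norm y"
  using order_trans[OF complex_Re_le_cmod inner_Cauchy_Schwarz] .

lemma Re_inner_app_le: "Re (l2_inner (app A x) x) \<le> norm A * (norm x)\<^sup>2"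
proof -
  have "Re (l2_inner (app A x) x) \<le> norm (app A x) * norm x" by (rule Re_inner_le)
  also have "\<dots> \<le> norm A * norm x * norm x" by (intro mult_right_mono norm_app) simp
  finally show ?thesis by (simp add: power2_eq_square)
qed

lemma positive_op_one_minus:
  assumes "op_adj (X :: nat l2op) = X" "norm X \<le> 1"
  shows "positive_op (1 - X)"
proof (rule positive_opI)
  show "0 \<le> Re (l2_inner (app (1 - X) x) x)" for x
  proof -
    have "Re (l2_inner (app X x) x) \<le> 1 * (norm x)\<^sup>2"
      by (rule order_trans[OF Re_inner_app_le]) (intro mult_right_mono assms(2), simp)
    then show ?thesis by (simp add: app_simps inner_simps inner_self)
  qed
qed (simp add: adj_simps assms)

text \<open>The Cauchy-Schwarz inequality for the form of \<open>T\<close>, applied to \<open>x\<close> and \<open>T x\<close>, bounds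
  \<open>\<parallel>T x\<parallel>\<^sup>4\<close> by \<open>\<langle>T x, x\<rangle> \<langle>T T x, T x\<rangle> \<le> \<parallel>x\<parallel>\<^sup>2 \<parallel>T x\<parallel>\<^sup>2\<close>.\<close>

lemma norm_le_one_of_positive:
  assumes T: "positive_op (T :: nat l2op)" and T': "positive_op (1 - T)"
  shows "norm T \<le> 1"
proof (rule norm_l2op_le)
  fix x
  let ?y = "app T x"
  have le: "Re (l2_inner (app T z) z) \<le> (norm z)\<^sup>2" for z
    using T' by (simp add: positive_op_def app_simps inner_simps inner_self)
  have pos: "0 \<le> Re (l2_inner (app T z) z)" for z using T by (simp add: positive_op_def)
  have "((norm ?y)\<^sup>2)\<^sup>2 = (cmod (l2_inner ?y ?y))\<^sup>2" by (simp add: inner_self norm_power)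
  also have "\<dots> \<le> Re (l2_inner ?y x) * Re (l2_inner (app T ?y) ?y)"
    by (rule positive_op_Cauchy_Schwarz[OF T])
  also have "\<dots> \<le> (norm x)\<^sup>2 * (norm ?y)\<^sup>2" by (intro mult_mono le pos) auto
  finally have *: "(norm ?y)\<^sup>2 * (norm ?y)\<^sup>2 \<le> (norm x)\<^sup>2 * (norm ?y)\<^sup>2"
    by (simp add: power2_eq_square)
  have "(norm ?y)\<^sup>2 \<le> (norm x)\<^sup>2"
  proof (cases "?y = 0")
    case False
    then show ?thesis by (intro mult_right_le_imp_le[OF *]) simp
  qed simp
  then show "norm ?y \<le> 1 * norm x" by (simp add: power2_le_iff_abs_le)
qed simp

text \<open>The coefficients of the binomial series of \<open>(1 - x)\<^bsup>1/2\<^esup>\<close>.\<close>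

definition sqrt_coeff :: "nat \<Rightarrow> real" where "sqrt_coeff k = (1/2 gchoose k) * (-1) ^ k"

lemma sqrt_coeff_0 [simp]: "sqrt_coeff 0 = 1"
  by (simp add: sqrt_coeff_def)

lemma sqrt_coeff_Suc_nonpos: "sqrt_coeff (Suc k) \<le> 0"
proof -
  have "sqrt_coeff (Suc k) = pochhammer (- (1/2)) (Suc k) / fact (Suc k)"
    by (simp add: sqrt_coeff_def gbinomial_pochhammer flip: power_add)
  also have "\<dots> = - (1/2) * pochhammer (1/2) k / fact (Suc k)"
    by (simp add: pochhammer_rec)
  also have "\<dots> \<le> 0"
    by (intro divide_nonpos_pos mult_nonpos_nonneg pochhammer_nonneg) auto
  finally show ?thesis .
qed

text \<open>The partial sums of all coefficients are \<open>(1/2) (3/2) \<cdots> (n - 1/2) / n!\<close>, hence nonnegative.\<close>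

lemma sqrt_coeff_sum_le: "(\<Sum>k<n. \<bar>sqrt_coeff (Suc k)\<bar>) \<le> 1"
proof -
  have "(\<Sum>k\<le>n. sqrt_coeff k) = (- 1) ^ n * (1/2 - 1 gchoose n)"
    unfolding sqrt_coeff_def by (rule gbinomial_sum_lower_neg)
  also have "\<dots> = pochhammer (1/2) n / fact n"
    by (simp add: gbinomial_pochhammer flip: power_add)
  also have "\<dots> \<ge> 0" by (intro divide_nonneg_pos pochhammer_nonneg) auto
  finally have "0 \<le> (\<Sum>k\<le>n. sqrt_coeff k)" .
  also have "(\<Sum>k\<le>n. sqrt_coeff k) = 1 + (\<Sum>k<n. sqrt_coeff (Suc k))"
    by (simp add: sum.atMost_shift)
  finally have "- (\<Sum>k<n. sqrt_coeff (Suc k)) \<le> 1" by simp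
  moreover have "(\<Sum>k<n. \<bar>sqrt_coeff (Suc k)\<bar>) = - (\<Sum>k<n. sqrt_coeff (Suc k))"
    unfolding sum_negf[symmetric] by (intro sum.cong refl) (simp add: sqrt_coeff_Suc_nonpos)
  ultimately show ?thesis by simp
qed

lemma sqrt_coeff_summable: "summable (\<lambda>k. \<bar>sqrt_coeff (Suc k)\<bar>)"
  by (rule bounded_imp_summable[where B=1])
    (use sqrt_coeff_sum_le[of "Suc _"] in \<open>auto simp: lessThan_Suc_atMost\<close>)

lemma sqrt_coeff_suminf_le: "(\<Sum>k. \<bar>sqrt_coeff (Suc k)\<bar>) \<le> 1"
  by (rule suminf_le_const[OF sqrt_coeff_summable sqrt_coeff_sum_le])

lemma sqrt_coeff_convolution:
  "(\<Sum>i\<le>k. sqrt_coeff i * sqrt_coeff (k - i)) = (if k = 0 then 1 else if k = 1 then - 1 else 0)"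
proof -
  have "(\<Sum>i\<le>k. sqrt_coeff i * sqrt_coeff (k - i))
      = (\<Sum>i\<le>k. (-1) ^ k * ((1/2 gchoose i) * (1/2 gchoose (k - i))))"
  proof (intro sum.cong refl)
    fix i assume "i \<in> {..k}"
    then have "(-1 :: real) ^ k = (-1) ^ i * (-1) ^ (k - i)" by (simp flip: power_add)
    then show "sqrt_coeff i * sqrt_coeff (k - i) = (-1) ^ k * ((1/2 gchoose i) * (1/2 gchoose (k - i)))"
      by (simp add: sqrt_coeff_def)
  qed
  also have "\<dots> = (-1) ^ k * (\<Sum>i=0..k. (1/2 gchoose i) * (1/2 gchoose (k - i)))"
    by (simp add: sum_distrib_left atMost_atLeast0)
  also have "\<dots> = (-1) ^ k * ((1 :: real) gchoose k)"
    by (subst gbinomial_Vandermonde) simp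
  also have "(1 :: real) gchoose k = of_nat (1 choose k)"
    by (simp add: binomial_gbinomial)
  finally show ?thesis
    by (cases k; cases "k - 1") (auto simp: binomial_eq_0)
qed

lemma bounded_linear_adj: "bounded_linear (op_adj :: nat l2op \<Rightarrow> nat l2op)"
  by (rule bounded_linear_intro[where K=1]) (auto simp: adj_simps norm_adj)

lemma adj_power: "op_adj ((X :: nat l2op) ^ k) = op_adj X ^ k"
  by (induction k) (auto simp: adj_simps power_commutes)

lemma norm_power_le_one: "norm (X :: 'a l2op) \<le> 1 \<Longrightarrow> norm (X ^ k) \<le> 1"
  by (rule order_trans[OF norm_power_ineq]) (simp add: power_le_one)

text \<open>For a self-adjoint contraction \<open>X\<close> the binomial series of \<open>(1 - X)\<^bsup>1/2\<^esup>\<close> converges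
  absolutely, because its coefficients are absolutely summable even at radius one; the coefficients
  after the first are at most zero and sum to at least \<open>-1\<close>, which makes the root positive.\<close>

lemma sqrt_one_minus:
  assumes adj: "op_adj (X :: nat l2op) = X" and le: "norm X \<le> 1"
  shows "\<exists>Y. positive_op Y \<and> Y * Y = 1 - X \<and> (\<forall>B. B * X = X * B \<longrightarrow> B * Y = Y * B)"
proof -
  define f where "f k = sqrt_coeff k *\<^sub>R X ^ k" for k
  have nf: "norm (f (Suc k)) \<le> \<bar>sqrt_coeff (Suc k)\<bar>" for k
    unfolding f_def using mult_left_mono[OF norm_power_le_one[OF le, of "Suc k"], of "\<bar>sqrt_coeff (Suc k)\<bar>"]
    by simp
  have sn': "summable (\<lambda>k. norm (f (Suc k)))"
    by (rule summable_comparison_test'[OF sqrt_coeff_summable]) (simp add: nf)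
  then have sn: "summable (\<lambda>k. norm (f k))" using summable_Suc_iff[of "\<lambda>k. norm (f k)"] by simp
  have sf: "summable f" using sn by (rule summable_norm_cancel)
  define Y where "Y = suminf f"
  define Z where "Z = - (\<Sum>k. f (Suc k))"
  have YZ: "Y = 1 - Z"
    using suminf_split_head[OF sf] by (simp add: Y_def Z_def f_def)
  have "norm Z \<le> (\<Sum>k. norm (f (Suc k)))"
    unfolding Z_def norm_minus_cancel by (rule summable_norm[OF sn'])
  also have "\<dots> \<le> (\<Sum>k. \<bar>sqrt_coeff (Suc k)\<bar>)"
    by (rule suminf_le[OF nf sn' sqrt_coeff_summable])
  finally have nZ: "norm Z \<le> 1" using sqrt_coeff_suminf_le by linarith
  have "op_adj Y = (\<Sum>k. op_adj (f k))"
    unfolding Y_def by (rule bounded_linear.suminf[OF bounded_linear_adj sf])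
  moreover have "op_adj (f k) = f k" for k by (simp add: f_def adj_simps adj_power adj)
  ultimately have "op_adj Y = Y" by (simp add: Y_def)
  then have "op_adj Z = Z" using YZ by (metis adj_simps(3,6) add_diff_cancel_left' diff_add_cancel)
  then have pos: "positive_op Y" unfolding YZ by (rule positive_op_one_minus[OF _ nZ])
  have "Y * Y = (\<Sum>k. \<Sum>i\<le>k. f i * f (k - i))"
    unfolding Y_def by (rule Cauchy_product[OF sn sn])
  also have "(\<lambda>k. \<Sum>i\<le>k. f i * f (k - i))
      = (\<lambda>k. (\<Sum>i\<le>k. sqrt_coeff i * sqrt_coeff (k - i)) *\<^sub>R X ^ k)"
    by (auto simp: f_def scaleR_sum_left fun_eq_iff simp flip: power_add intro!: sum.cong)
  also have "(\<Sum>k. (\<Sum>i\<le>k. sqrt_coeff i * sqrt_coeff (k - i)) *\<^sub>R X ^ k)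
      = (\<Sum>k\<in>{0, 1}. (\<Sum>i\<le>k. sqrt_coeff i * sqrt_coeff (k - i)) *\<^sub>R X ^ k)"
    by (rule suminf_finite) (auto simp: sqrt_coeff_convolution)
  also have "\<dots> = 1 - X" by (simp add: sqrt_coeff_convolution)
  finally have sq: "Y * Y = 1 - X" .
  have "B * Y = Y * B" if B: "B * X = X * B" for B
  proof -
    have "B * X ^ k = X ^ k * B" for k
      by (induction k) (auto simp: B mult.assoc[symmetric], auto simp: mult.assoc)
    then have "B * f k = f k * B" for k by (simp add: f_def)
    then show ?thesis
      unfolding Y_def by (metis (lifting) ext suminf_mult suminf_mult2 sf)
  qed
  then show ?thesis using pos sq by blast
qed

lemma positive_op_scaleR: "positive_op S \<Longrightarrow> 0 \<le> r \<Longrightarrow> positive_op (r *\<^sub>R S)"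
  by (auto simp: positive_op_def app_simps inner_simps scaleR_conv_of_real[where 'a=complex] intro!: Reals_mult)

text \<open>For \<open>S = 0\<close> the quotient is \<open>0\<close> by convention, and the statement still holds.\<close>

lemma positive_contraction:
  assumes S: "positive_op (S :: nat l2op)"
  shows "op_adj (1 - S /\<^sub>R norm S) = 1 - S /\<^sub>R norm S" "norm (1 - S /\<^sub>R norm S) \<le> 1"
proof -
  let ?T = "S /\<^sub>R norm S"
  have adj: "op_adj ?T = ?T" by (simp add: adj_simps positive_op_adj[OF S])
  then show "op_adj (1 - ?T) = 1 - ?T" by (simp add: adj_simps)
  have "norm ?T \<le> 1" by (cases "S = 0") auto
  then have "positive_op (1 - ?T)" by (rule positive_op_one_minus[OF adj])
  moreover have "positive_op (1 - (1 - ?T))" by (simp add: positive_op_scaleR S)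
  ultimately show "norm (1 - ?T) \<le> 1" by (rule norm_le_one_of_positive)
qed

lemma positive_op_sqrt:
  assumes S: "positive_op (S :: nat l2op)"
  shows "\<exists>R. positive_op R \<and> R * R = S \<and> (\<forall>B. B * S = S * B \<longrightarrow> B * R = R * B)"
proof (cases "S = 0")
  case False
  obtain Y where Y: "positive_op Y" "Y * Y = 1 - (1 - S /\<^sub>R norm S)"
    "\<And>B. B * (1 - S /\<^sub>R norm S) = (1 - S /\<^sub>R norm S) * B \<Longrightarrow> B * Y = Y * B"
    using sqrt_one_minus[OF positive_contraction[OF S]] by blast
  let ?R = "sqrt (norm S) *\<^sub>R Y"
  have "?R * ?R = S" using Y(2) False by (simp add: mult.assoc[symmetric])
  moreover have "B * ?R = ?R * B" if "B * S = S * B" for B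
    using Y(3)[of B] that by (simp add: algebra_simps)
  ultimately show ?thesis using positive_op_scaleR[OF Y(1), of "sqrt (norm S)"]
    by (intro exI[of _ ?R]) auto
qed (auto intro!: exI[of _ 0] simp: positive_op_def)

text \<open>If two positive operators have the same square and commute, then for their difference \<open>D\<close>
  the operators \<open>DQD\<close> and \<open>DRD\<close> are positive with sum \<open>0\<close>, so both vanish.\<close>

lemma positive_op_sqrt_unique:
  assumes Q: "positive_op (Q :: nat l2op)" and R: "positive_op R"
    and eq: "Q * Q = R * R" and comm: "Q * R = R * Q"
  shows "Q = R"
proof (rule op_eqI)
  fix x
  define D where "D = Q - R"
  have adjD: "op_adj D = D" by (simp add: D_def adj_simps positive_op_adj Q R)
  have "D * (Q + R) = 0" using eq comm by (simp add: D_def algebra_simps)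
  then have "app D (app (Q + R) (app D x)) = 0" by (metis app_times app_zero)
  then have "l2_inner (app (Q + R) (app D x)) (app D x) = 0"
    using op_adj[of D "app (Q + R) (app D x)" x] adjD by simp
  then have z: "Re (l2_inner (app Q (app D x)) (app D x)) = 0"
    "Re (l2_inner (app R (app D x)) (app D x)) = 0"
    using Q R by (auto simp: app_simps inner_simps positive_op_def dest!: spec[of _ "app D x"])
      (simp_all add: complex_eq_iff)
  have "app Q (app D x) = 0"
    using positive_op_Cauchy_Schwarz[OF Q, of "app D x" "app Q (app D x)"] z by (simp add: inner_self)
  moreover have "app R (app D x) = 0"
    using positive_op_Cauchy_Schwarz[OF R, of "app D x" "app R (app D x)"] z by (simp add: inner_self)
  ultimately have "app D (app D x) = 0" by (simp add: D_def app_simps)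
  then have "l2_inner (app D x) (app D x) = 0"
    using op_adj[of D "app D x" x] adjD by simp
  then have "app D x = 0" by (simp add: inner_self)
  then show "app Q x = app R x" by (simp add: D_def app_simps)
qed

lemma positive_op_adj_mult: "positive_op (op_adj A * (A :: nat l2op))"
  by (rule positive_opI) (simp_all add: adj_simps app_times op_adj'[symmetric] inner_self)

text \<open>Any positive root commutes with its square, hence with the root obtained from the series.
  So the two agree.\<close>

lemma op_abs:
  fixes A :: "nat l2op"
  shows "positive_op (op_abs A)" "op_abs A * op_abs A = op_adj A * A"
proof -
  obtain R where R: "positive_op R" "R * R = op_adj A * A"
    "\<And>B. B * (op_adj A * A) = (op_adj A * A) * B \<Longrightarrow> B * R = R * B"
    using positive_op_sqrt[OF positive_op_adj_mult, of A] by blast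
  have "positive_op (op_abs A) \<and> op_abs A * op_abs A = op_adj A * A"
    unfolding op_abs_def
  proof (rule theI)
    show "positive_op R \<and> R * R = op_adj A * A" using R by blast
    fix Q assume Q: "positive_op Q \<and> Q * Q = op_adj A * A"
    then have eq: "op_adj A * A = Q * Q" by simp
    have "Q * R = R * Q" by (rule R(3)) (simp only: eq mult.assoc)
    have "Q * Q = R * R" unfolding R(2) by (rule eq[symmetric])
    with Q R(1) \<open>Q * R = R * Q\<close> show "Q = R" using positive_op_sqrt_unique by blast
  qed
  then show "positive_op (op_abs A)" "op_abs A * op_abs A = op_adj A * A" by blast+
qed

lemma norm_eq_of_adj_mult_eq:
  assumes "op_adj A * A = op_adj B * (B :: nat l2op)"
  shows "norm (app A x) = norm (app B x)"
proof -
  have "l2_inner (app A x) (app A x) = l2_inner (app B x) (app B x)"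
    by (simp only: op_adj app_times[symmetric] assms)
  then have "complex_of_real ((norm (app A x))\<^sup>2) = of_real ((norm (app B x))\<^sup>2)" by (simp only: inner_self)
  then have "(norm (app A x))\<^sup>2 = (norm (app B x))\<^sup>2" by (simp only: of_real_eq_iff)
  then show ?thesis by (simp only: power2_eq_iff_nonneg norm_ge_zero)
qed

lemma norm_op_abs: "norm (app (op_abs A) x) = norm (app (A :: nat l2op) x)"
  by (rule norm_eq_of_adj_mult_eq) (simp add: op_abs positive_op_adj)

section \<open>Factoring through the square root of the absolute value\<close>

lemma Neumann_series:
  fixes X :: "'a l2op"
  assumes "norm X < 1"
  shows "\<exists>Z. Z * (1 - X) = 1 \<and> (1 - X) * Z = 1"
proof (intro exI conjI)
  let ?Z = "\<Sum>k. X ^ k"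
  have s: "summable (\<lambda>k. X ^ k)" by (rule complete_algebra_summable_geometric[OF assms])
  have head: "?Z = 1 + (\<Sum>k. X ^ Suc k)" using suminf_split_head[OF s] by simp
  have l: "(\<Sum>k. X ^ Suc k) = X * ?Z" using suminf_mult[OF s, of X] by simp
  have r: "(\<Sum>k. X ^ Suc k) = ?Z * X" using suminf_mult2[OF s, of X] by (simp add: power_commutes)
  show "?Z * (1 - X) = 1" using head r by (simp add: algebra_simps)
  show "(1 - X) * ?Z = 1" using head l by (simp add: algebra_simps)
qed

text \<open>Rescaled by \<open>c = \<parallel>S\<parallel> + e\<close>, the operator \<open>S + e I\<close> has distance at most \<open>\<parallel>S\<parallel> / c < 1\<close> from
  the identity.\<close>

lemma positive_op_resolvent:
  assumes S: "positive_op (S :: nat l2op)" and e: "e > 0"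
  shows "\<exists>Z. Z * (S + e *\<^sub>R 1) = 1 \<and> (S + e *\<^sub>R 1) * Z = 1"
proof -
  define c where "c = norm S + e"
  have c: "c > 0" using e by (simp add: c_def add_nonneg_pos)
  define X where "X = (norm S / c) *\<^sub>R (1 - S /\<^sub>R norm S)"
  have "norm X \<le> norm S / c"
    unfolding X_def using positive_contraction(2)[OF S] c
    by (simp add: mult_left_le divide_right_mono)
  also have "\<dots> < 1" using e c by (simp add: c_def)
  finally obtain Z where Z: "Z * (1 - X) = 1" "(1 - X) * Z = 1" using Neumann_series by blast
  have "1 - X = (1 / c) *\<^sub>R (S + e *\<^sub>R 1)"
  proof -
    have X: "X = (norm S / c) *\<^sub>R 1 - (1 / c) *\<^sub>R S"
      by (cases "S = 0") (auto simp: X_def scaleR_diff_right)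
    have one: "(1 :: nat l2op) = (norm S / c) *\<^sub>R 1 + (e / c) *\<^sub>R 1"
      using c by (simp add: c_def flip: scaleR_left.add add_divide_distrib)
    show ?thesis using arg_cong2[where f=minus, OF one X] by (simp add: scaleR_add_right)
  qed
  then show ?thesis using Z by (intro exI[of _ "(1 / c) *\<^sub>R Z"]) simp
qed

lemma resolvent_bounds:
  assumes S: "positive_op (S :: nat l2op)" and e: "e > 0"
  defines "y \<equiv> \<lambda>x. app (S + e *\<^sub>R 1) x"
  shows "norm (app S x) \<le> norm (y x)" "2 * e * Re (l2_inner (app S x) x) \<le> (norm (y x))\<^sup>2"
proof -
  have p: "0 \<le> Re (l2_inner (app S x) x)" using S by (simp add: positive_op_def)
  have "l2_inner (y x) (y x) = l2_inner (app S x) (app S x)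
      + of_real e * (l2_inner (app S x) x + cnj (l2_inner (app S x) x)) + of_real (e\<^sup>2) * l2_inner x x"
    by (simp add: y_def app_simps inner_simps inner_cnj power2_eq_square scaleR_conv_of_real[where 'a=complex] algebra_simps)
  then have "(norm (y x))\<^sup>2 = (norm (app S x))\<^sup>2 + 2 * e * Re (l2_inner (app S x) x) + e\<^sup>2 * (norm x)\<^sup>2"
    by (simp add: inner_self complex_add_cnj complex_eq_iff flip: of_real_power)
  moreover have "0 \<le> 2 * e * Re (l2_inner (app S x) x)" "0 \<le> e\<^sup>2 * (norm x)\<^sup>2"
    using p e by auto
  ultimately show "2 * e * Re (l2_inner (app S x) x) \<le> (norm (y x))\<^sup>2"
    "norm (app S x) \<le> norm (y x)"
    by (auto intro!: power2_le_imp_le[of "norm (app S x)"] simp: add_increasing)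
qed

text \<open>With \<open>R = |K|\<^bsup>1/2\<^esup>\<close> the operator \<open>K |K|\<^bsup>-1/2\<^esup>\<close> is obtained as the limit of
  \<open>K (|K| + \<epsilon>)\<^sup>-\<^sup>1 R\<close> as \<open>\<epsilon>\<close> tends to \<open>0\<close>. The convergence is in operator norm, because
  \<open>|K| (|K| + \<epsilon>)\<^sup>-\<^sup>1 R\<close> differs from \<open>R\<close> by at most \<open>(\<epsilon>/2)\<^bsup>1/2\<^esup>\<close>. The two factors of \<open>K\<close> obtained
  in this way have the Hilbert-Schmidt norm of \<open>R\<close>.\<close>

lemma abs_sqrt_factor:
  fixes K :: "nat l2op"
  assumes R: "positive_op R" "R * R = op_abs K"
    and comm: "\<And>B. B * op_abs K = op_abs K * B \<Longrightarrow> B * R = R * B"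
  shows "\<exists>A. K = A * R \<and> (\<forall>x. norm (app A x) = norm (app R x))"
proof -
  define S where "S = op_abs K"
  define e where "e n = inverse (real (Suc n))" for n
  have e: "e n > 0" for n by (simp add: e_def)
  have e0: "e \<longlonglongrightarrow> 0" unfolding e_def by (rule LIMSEQ_inverse_real_of_nat)
  have S: "positive_op S" by (simp add: S_def op_abs)
  obtain Z where Z: "\<And>n. Z n * (S + e n *\<^sub>R 1) = 1" "\<And>n. (S + e n *\<^sub>R 1) * Z n = 1"
    using positive_op_resolvent[OF S e] by metis
  have SZ: "S * Z n = 1 - e n *\<^sub>R Z n" and ZS: "Z n * S = 1 - e n *\<^sub>R Z n" for n
    using Z[of n] by (auto simp: algebra_simps)
  have "Z n * R = R * Z n" for n
    by (rule comm) (simp add: ZS SZ flip: S_def)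
  then have ZR: "app (Z n) (app R x) = app R (app (Z n) x)" for n x by (simp flip: app_times)
  have app_SZ: "app (S + e n *\<^sub>R 1) (app (Z n) x) = x" for n x using Z(2)[of n] by (simp flip: app_times)
  have SZ_le: "norm (app S (app (Z n) x)) \<le> norm x" for n x
    using resolvent_bounds(1)[OF S e[of n], where x="app (Z n) x"] by (simp only: app_SZ)
  define V where "V n = K * Z n * R" for n
  have K_S: "norm (app K x) = norm (app S x)" for x by (simp add: S_def norm_op_abs)
  have approx: "norm (app (S * Z n * R) x - app R x) \<le> sqrt (e n / 2) * norm x" for n x
  proof -
    let ?w = "app (Z n) x"
    have "l2_inner (app S ?w) ?w = of_real ((norm (app R ?w))\<^sup>2)"
      using positive_op_hermitian[OF R(1), of "app R ?w" ?w]
      by (simp add: S_def R(2)[symmetric] app_times inner_self)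
    then have "2 * e n * (norm (app R ?w))\<^sup>2 \<le> (norm x)\<^sup>2"
      using resolvent_bounds(2)[OF S e[of n], of ?w] by (simp only: app_SZ Re_complex_of_real)
    then have "e n * (e n * (norm (app R ?w))\<^sup>2) \<le> e n * ((norm x)\<^sup>2 / 2)"
      using e[of n] by (intro mult_left_mono) auto
    then have "(e n * norm (app R ?w))\<^sup>2 \<le> (sqrt (e n / 2) * norm x)\<^sup>2"
      using e[of n] by (simp add: power_mult_distrib power2_eq_square algebra_simps)
    then have "e n * norm (app R ?w) \<le> sqrt (e n / 2) * norm x"
      by (rule power2_le_imp_le) (use e[of n] in auto)
    moreover have "app (S * Z n * R) x - app R x = - (e n *\<^sub>R app R ?w)"
      by (simp add: SZ app_simps ZR)
    ultimately show ?thesis using e[of n] by simp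
  qed
  have V_diff: "norm (V n - V m) \<le> sqrt (e n / 2) + sqrt (e m / 2)" for n m
  proof (rule norm_l2op_le)
    fix x
    have "norm (app (V n - V m) x) = norm (app S (app (Z n - Z m) (app R x)))"
      unfolding V_def K_S[symmetric] by (simp add: app_simps)
    also have "app S (app (Z n - Z m) (app R x))
        = (app (S * Z n * R) x - app R x) - (app (S * Z m * R) x - app R x)"
      by (simp add: app_simps)
    also have "norm \<dots> \<le> sqrt (e n / 2) * norm x + sqrt (e m / 2) * norm x"
      by (rule order_trans[OF norm_triangle_ineq4 add_mono[OF approx approx]])
    finally show "norm (app (V n - V m) x) \<le> (sqrt (e n / 2) + sqrt (e m / 2)) * norm x"
      by (simp add: algebra_simps)
  qed (use e in \<open>auto intro!: add_nonneg_nonneg simp: less_imp_le\<close>)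
  have se0: "(\<lambda>n. sqrt (e n / 2)) \<longlonglongrightarrow> 0"
    using tendsto_real_sqrt[OF tendsto_divide[OF e0 tendsto_const, of 2]] by simp
  have "Cauchy V"
  proof (rule CauchyI)
    fix r :: real assume "r > 0"
    then obtain M where M: "\<And>n. n \<ge> M \<Longrightarrow> sqrt (e n / 2) < r / 2"
      using order_tendstoD(2)[OF se0, of "r/2"] by (auto simp: eventually_sequentially)
    have "norm (V m - V n) < r" if "m \<ge> M" "n \<ge> M" for m n
      using V_diff[of m n] M[OF that(1)] M[OF that(2)] by linarith
    then show "\<exists>M. \<forall>m\<ge>M. \<forall>n\<ge>M. norm (V m - V n) < r" by blast
  qed
  then obtain A where A: "V \<longlonglongrightarrow> A" by (auto simp: Cauchy_convergent_iff convergent_def)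
  have "norm (app A x) = norm (app R x)" for x
  proof (rule LIMSEQ_unique)
    show "(\<lambda>n. norm (app (V n) x)) \<longlonglongrightarrow> norm (app A x)" by (intro tendsto_norm tendsto_app A)
    have "(\<lambda>n. app (S * Z n * R) x - app R x) \<longlonglongrightarrow> 0"
      by (rule tendsto_norm_zero_cancel, rule tendsto_sandwich[OF _ _ tendsto_const tendsto_mult_left_zero[OF se0, of "norm x"]])
        (auto simp: approx)
    then have "(\<lambda>n. norm (app (S * Z n * R) x)) \<longlonglongrightarrow> norm (app R x)"
      by (intro tendsto_norm) (simp add: LIM_zero_iff)
    then show "(\<lambda>n. norm (app (V n) x)) \<longlonglongrightarrow> norm (app R x)"
      by (simp add: V_def app_times K_S)
  qed
  moreover have "K = A * R"
  proof (rule LIMSEQ_unique)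
    show "(\<lambda>n. V n * R) \<longlonglongrightarrow> A * R" by (intro tendsto_intros A)
    have eq: "V n * R = K - e n *\<^sub>R (K * Z n)" for n
      by (simp add: V_def mult.assoc R(2) flip: S_def) (simp add: ZS algebra_simps)
    have nKZ: "norm (K * Z n) \<le> 1" for n
      by (rule norm_l2op_le) (simp_all add: app_times K_S SZ_le)
    have "(\<lambda>n. e n *\<^sub>R (K * Z n)) \<longlonglongrightarrow> 0"
    proof (rule tendsto_norm_zero_cancel, rule tendsto_sandwich[OF _ _ tendsto_const e0])
      show "\<forall>\<^sub>F n in sequentially. norm (e n *\<^sub>R (K * Z n)) \<le> e n"
        using nKZ e by (simp add: mult_left_le less_imp_le)
    qed auto
    from tendsto_diff[OF tendsto_const this, of K]
    show "(\<lambda>n. V n * R) \<longlonglongrightarrow> K" by (simp add: eq)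
  qed
  ultimately show ?thesis by blast
qed

section \<open>Hilbert-Schmidt bounds and trace norm bounds\<close>

text \<open>The constant bounds the square of the Hilbert-Schmidt norm.\<close>

definition hs_bound :: "nat l2op \<Rightarrow> real \<Rightarrow> bool"
  where "hs_bound A c \<longleftrightarrow> (\<forall>N. (\<Sum>k<N. (norm (app A (l2_basis k)))\<^sup>2) \<le> c)"

lemma hs_bound_nonneg: "hs_bound A c \<Longrightarrow> 0 \<le> c"
  unfolding hs_bound_def by (drule spec[of _ 0]) simp

lemma hs_bound_mono: "hs_bound A c \<Longrightarrow> c \<le> d \<Longrightarrow> hs_bound A d"
  unfolding hs_bound_def by (blast intro: order_trans)

lemma hs_bound_adj:
  assumes "hs_bound A c"
  shows "hs_bound (op_adj A) c"
  unfolding hs_bound_def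
proof
  fix N
  have le: "(\<Sum>k<N. (norm (app (Pn M) (app (op_adj A) (l2_basis k))))\<^sup>2) \<le> c" for M
  proof -
    have "(\<Sum>k<N. (norm (app (Pn M) (app (op_adj A) (l2_basis k))))\<^sup>2)
        = (\<Sum>k<N. \<Sum>j<M. (cmod (entry A k j))\<^sup>2)"
      by (simp add: norm_Pn_sq entry_adj flip: entry_def)
    also have "\<dots> = (\<Sum>j<M. \<Sum>k<N. (cmod (coord (app A (l2_basis j)) k))\<^sup>2)"
      by (subst sum.swap) (simp add: entry_def)
    also have "\<dots> \<le> (\<Sum>j<M. (norm (app A (l2_basis j)))\<^sup>2)"
      by (intro sum_mono sum_coord_le) simp
    also have "\<dots> \<le> c" using assms by (simp add: hs_bound_def)
    finally show ?thesis .
  qed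
  show "(\<Sum>k<N. (norm (app (op_adj A) (l2_basis k)))\<^sup>2) \<le> c"
    by (rule LIMSEQ_le_const2[where X="\<lambda>M. \<Sum>k<N. (norm (app (Pn M) (app (op_adj A) (l2_basis k))))\<^sup>2"])
      (use le in \<open>auto intro!: tendsto_intros Pn_tendsto\<close>)
qed

lemma hs_bound_mult_left:
  assumes "hs_bound A c"
  shows "hs_bound (B * A) ((norm B)\<^sup>2 * c)"
  unfolding hs_bound_def
proof
  fix N
  have "(\<Sum>k<N. (norm (app (B * A) (l2_basis k)))\<^sup>2)
      \<le> (\<Sum>k<N. (norm B)\<^sup>2 * (norm (app A (l2_basis k)))\<^sup>2)"
    by (intro sum_mono) (simp add: app_times power_mono norm_app flip: power_mult_distrib)
  also have "\<dots> = (norm B)\<^sup>2 * (\<Sum>k<N. (norm (app A (l2_basis k)))\<^sup>2)" by (simp add: sum_distrib_left)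
  also have "\<dots> \<le> (norm B)\<^sup>2 * c" using assms by (simp add: hs_bound_def mult_left_mono)
  finally show "(\<Sum>k<N. (norm (app (B * A) (l2_basis k)))\<^sup>2) \<le> (norm B)\<^sup>2 * c" .
qed

lemma entry_Pn_mult: "entry (A * Pn N * B) i j = (\<Sum>k<N. entry A i k * entry B k j)"
  by (simp add: entry_def app_times Pn_expand app_sum_right app_simps coord_sum coord_simps mult.commute)

lemma entry_mult_tendsto: "(\<lambda>M. entry (A * Pn M * B) i j) \<longlonglongrightarrow> entry (A * B) i j"
  unfolding entry_def app_times
  by (intro tendsto_coord bounded_linear.tendsto[OF bounded_linear_app] Pn_tendsto)

lemma entry_Pn_left: "entry (Pn N * A) i j = (if i < N then entry A i j else 0)"
  by (simp add: entry_def app_times coord_proj_op)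

lemma Pn_basis: "app (Pn N) (l2_basis j) = (if j < N then l2_basis j else 0)"
  by (rule l2_eqI) (auto simp: coord_proj_op coord_simps)

lemma entry_Pn_right: "entry (A * Pn N) i j = (if j < N then entry A i j else 0)"
  by (simp add: entry_def app_times Pn_basis coord_simps)

lemma proj_op_idem [simp]: "proj_op S * proj_op S = proj_op S"
  by (rule op_eqI, rule l2_eqI) (simp add: app_times coord_proj_op)

lemma op_eq_entryI:
  fixes A B :: "nat l2op"
  assumes "\<And>i j. entry A i j = entry B i j"
  shows "A = B"
proof (rule op_eqI)
  fix x
  have b: "app A (l2_basis j) = app B (l2_basis j)" for j
    by (rule l2_eqI) (use assms in \<open>simp add: entry_def\<close>)
  have "app A (app (Pn N) x) = app B (app (Pn N) x)" for N
    by (simp add: Pn_expand app_sum_right app_scale b)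
  moreover have "(\<lambda>N. app A (app (Pn N) x)) \<longlonglongrightarrow> app A x" "(\<lambda>N. app B (app (Pn N) x)) \<longlonglongrightarrow> app B x"
    by (intro bounded_linear.tendsto[OF bounded_linear_app] Pn_tendsto)+
  ultimately show "app A x = app B x" by (simp add: LIMSEQ_unique)
qed

text \<open>The trace norm enters only through upper bounds, and these are taken in dual form:
  the trace of \<open>K\<close> against every contraction, truncated to a finite section, is at most \<open>C\<close>.
  In this form sums, adjoints and limits of matrix entries cause no difficulty.\<close>

definition trace_bound :: "nat l2op \<Rightarrow> real \<Rightarrow> bool"
  where "trace_bound K C \<longleftrightarrow> 0 \<le> C \<and>
    (\<forall>N F. norm F \<le> 1 \<longrightarrow> cmod (\<Sum>i<N. \<Sum>j<N. entry F i j * entry K j i) \<le> C)"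

lemma trace_bound_nonneg: "trace_bound K C \<Longrightarrow> 0 \<le> C"
  by (simp add: trace_bound_def)

lemma trace_bound_mono: "trace_bound K C \<Longrightarrow> C \<le> D \<Longrightarrow> trace_bound K D"
  unfolding trace_bound_def by (auto intro: order_trans)

lemma trace_bound_zero: "trace_bound 0 0"
  by (simp add: trace_bound_def entry_simps)

lemma trace_bound_add:
  assumes "trace_bound K C" "trace_bound L D"
  shows "trace_bound (K + L) (C + D)"
  unfolding trace_bound_def
proof (intro conjI allI impI)
  fix N F assume F: "norm (F :: nat l2op) \<le> 1"
  have "cmod (\<Sum>i<N. \<Sum>j<N. entry F i j * entry (K + L) j i)
      \<le> cmod (\<Sum>i<N. \<Sum>j<N. entry F i j * entry K j i) + cmod (\<Sum>i<N. \<Sum>j<N. entry F i j * entry L j i)"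
    by (simp add: entry_simps ring_distribs sum.distrib norm_triangle_ineq)
  also have "\<dots> \<le> C + D" using assms F by (intro add_mono) (auto simp: trace_bound_def)
  finally show "cmod (\<Sum>i<N. \<Sum>j<N. entry F i j * entry (K + L) j i) \<le> C + D" .
qed (use assms in \<open>simp add: trace_bound_def\<close>)

lemma trace_bound_scaleR:
  assumes "trace_bound K C"
  shows "trace_bound (r *\<^sub>R K) (\<bar>r\<bar> * C)"
  unfolding trace_bound_def
proof (intro conjI allI impI)
  fix N F assume F: "norm (F :: nat l2op) \<le> 1"
  have "(\<Sum>i<N. \<Sum>j<N. entry F i j * entry (r *\<^sub>R K) j i)
      = r *\<^sub>R (\<Sum>i<N. \<Sum>j<N. entry F i j * entry K j i)"
    by (simp add: entry_simps scaleR_sum_right)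
  then show "cmod (\<Sum>i<N. \<Sum>j<N. entry F i j * entry (r *\<^sub>R K) j i) \<le> \<bar>r\<bar> * C"
    using assms F by (simp add: trace_bound_def mult_left_mono)
qed (use assms in \<open>simp add: trace_bound_def\<close>)

lemma trace_bound_uminus: "trace_bound K C \<Longrightarrow> trace_bound (- K) C"
  using trace_bound_scaleR[of K C "-1"] by simp

lemma trace_bound_diff: "trace_bound K C \<Longrightarrow> trace_bound L D \<Longrightarrow> trace_bound (K - L) (C + D)"
  using trace_bound_add[OF _ trace_bound_uminus] by fastforce

lemma trace_bound_sum:
  assumes "\<And>k. k \<in> I \<Longrightarrow> trace_bound (K k) (C k)"
  shows "trace_bound (\<Sum>k\<in>I. K k) (\<Sum>k\<in>I. C k)"
  using assms by (induction I rule: infinite_finite_induct) (auto simp: trace_bound_zero intro!: trace_bound_add)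

lemma trace_boundD:
  assumes "trace_bound K C"
  shows "cmod (\<Sum>i<N. \<Sum>j<N. entry F i j * entry K j i) \<le> norm F * C"
proof (cases "F = 0")
  case False
  let ?G = "F /\<^sub>R norm F"
  have "(\<Sum>i<N. \<Sum>j<N. entry F i j * entry K j i)
      = norm F *\<^sub>R (\<Sum>i<N. \<Sum>j<N. entry ?G i j * entry K j i)"
    using False by (simp add: entry_simps scaleR_sum_right)
  moreover have "cmod (\<Sum>i<N. \<Sum>j<N. entry ?G i j * entry K j i) \<le> C"
    using assms False by (auto simp: trace_bound_def)
  ultimately show ?thesis by (simp add: mult_left_mono)
qed (simp add: entry_simps)

lemma trace_bound_limit:
  assumes "\<And>i j. (\<lambda>n. entry (K n) i j) \<longlonglongrightarrow> entry L i j" "\<And>n. trace_bound (K n) C"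
  shows "trace_bound L C"
  unfolding trace_bound_def
proof (intro conjI allI impI)
  fix N F assume F: "norm (F :: nat l2op) \<le> 1"
  show "cmod (\<Sum>i<N. \<Sum>j<N. entry F i j * entry L j i) \<le> C"
    by (rule LIMSEQ_le_const2[where X="\<lambda>n. cmod (\<Sum>i<N. \<Sum>j<N. entry F i j * entry (K n) j i)"])
      (use assms F in \<open>auto intro!: tendsto_intros simp: trace_bound_def\<close>)
qed (use assms(2) trace_bound_nonneg in blast)

lemma trace_bound_adj:
  assumes "trace_bound K C"
  shows "trace_bound (op_adj K) C"
  unfolding trace_bound_def
proof (intro conjI allI impI)
  fix N F assume F: "norm (F :: nat l2op) \<le> 1"
  have "cnj (\<Sum>i<N. \<Sum>j<N. entry F i j * entry (op_adj K) j i)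
      = (\<Sum>j<N. \<Sum>i<N. entry (op_adj F) j i * entry K i j)"
    by (subst sum.swap) (simp add: entry_adj)
  from arg_cong[where f=cmod, OF this, unfolded complex_mod_cnj]
  have "cmod (\<Sum>i<N. \<Sum>j<N. entry F i j * entry (op_adj K) j i)
      = cmod (\<Sum>j<N. \<Sum>i<N. entry (op_adj F) j i * entry K i j)"
    .
  also have "\<dots> \<le> norm (op_adj F) * C" by (rule trace_boundD[OF assms])
  also have "\<dots> \<le> 1 * C" by (intro mult_right_mono trace_bound_nonneg[OF assms]) (simp add: norm_adj F)
  finally show "cmod (\<Sum>i<N. \<Sum>j<N. entry F i j * entry (op_adj K) j i) \<le> C" by simp
qed (use assms in \<open>simp add: trace_bound_def\<close>)

text \<open>The factor \<open>A\<close> is moved to the test contraction. The product with it no longer has finitely many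
  columns, so \<open>A\<close> is truncated to \<open>A P\<^sub>M\<close> first and \<open>M\<close> tends to infinity.\<close>

lemma trace_bound_mult_left:
  assumes K: "trace_bound K C"
  shows "trace_bound (A * K) (norm A * C)"
  unfolding trace_bound_def
proof (intro conjI allI impI)
  fix N F assume F: "norm (F :: nat l2op) \<le> 1"
  have lim: "(\<lambda>M. \<Sum>i<N. \<Sum>j<N. entry F i j * entry (A * Pn M * K) j i)
      \<longlonglongrightarrow> (\<Sum>i<N. \<Sum>j<N. entry F i j * entry (A * K) j i)"
    by (intro tendsto_intros entry_mult_tendsto)
  have le: "cmod (\<Sum>i<N. \<Sum>j<N. entry F i j * entry (A * Pn M * K) j i) \<le> norm A * C" if M: "M \<ge> N" for M
  proof -
    let ?G = "Pn N * (F * Pn N * A)"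
    have "norm (F * Pn N * A) \<le> norm F * norm (Pn N) * norm A"
      by (rule order_trans[OF norm_mult_ineq]) (intro mult_right_mono norm_mult_ineq norm_ge_zero)
    also have "\<dots> \<le> 1 * 1 * norm A" by (intro mult_mono F norm_proj_op_le) auto
    finally have nG': "norm (F * Pn N * A) \<le> norm A" by simp
    have "norm ?G \<le> norm (Pn N) * norm (F * Pn N * A)" by (rule norm_mult_ineq)
    also have "\<dots> \<le> 1 * norm A" by (intro mult_mono nG' norm_proj_op_le) auto
    finally have nG: "norm ?G \<le> norm A" by simp
    have "(\<Sum>i<N. \<Sum>j<N. entry F i j * entry (A * Pn M * K) j i)
        = (\<Sum>i<N. \<Sum>j<N. \<Sum>k<M. entry F i j * entry A j k * entry K k i)"
      by (simp add: entry_Pn_mult sum_distrib_left mult.assoc[where 'a=complex])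
    also have "\<dots> = (\<Sum>i<N. \<Sum>k<M. entry ?G i k * entry K k i)"
      by (rule sum.cong[OF refl], subst sum.swap) (simp add: entry_Pn_left entry_Pn_mult sum_distrib_right)
    also have "\<dots> = (\<Sum>i<M. \<Sum>k<M. entry ?G i k * entry K k i)"
      using M by (intro sum.mono_neutral_left) (auto simp: entry_Pn_left)
    also have "cmod \<dots> \<le> norm ?G * C" by (rule trace_boundD[OF K])
    also have "\<dots> \<le> norm A * C" by (intro mult_right_mono nG trace_bound_nonneg[OF K])
    finally show ?thesis .
  qed
  show "cmod (\<Sum>i<N. \<Sum>j<N. entry F i j * entry (A * K) j i) \<le> norm A * C"
    by (rule LIMSEQ_le_const2[OF tendsto_norm[OF lim]]) (use le in blast)
qed (use assms in \<open>simp add: trace_bound_def\<close>)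

lemma trace_bound_mult_right:
  assumes "trace_bound K C"
  shows "trace_bound (K * A) (norm A * C)"
  using trace_bound_adj[OF trace_bound_mult_left[OF trace_bound_adj[OF assms], of "op_adj A"]] by (simp add: adj_simps norm_adj)

lemma trace_bound_trace:
  assumes "trace_bound K C"
  shows "cmod (\<Sum>i<N. entry K i i) \<le> C"
proof -
  have "(\<Sum>i<N. \<Sum>j<N. entry 1 i j * entry K j i) = (\<Sum>i<N. entry K i i)"
    by (intro sum.cong refl) (simp add: entry_one if_distrib[of "\<lambda>x. x * _"] cong: if_cong)
  with trace_boundD[OF assms, where N=N and F=1] show ?thesis by simp
qed

lemma cmod_sum_inner_le:
  assumes "(\<Sum>k<N. (norm (u k))\<^sup>2) \<le> a" "(\<Sum>k<N. (norm (v k))\<^sup>2) \<le> b"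
  shows "cmod (\<Sum>k<N. l2_inner (u k) (v k)) \<le> sqrt (a * b)"
proof -
  have "cmod (\<Sum>k<N. l2_inner (u k) (v k)) \<le> (\<Sum>k<N. \<bar>norm (u k)\<bar> * \<bar>norm (v k)\<bar>)"
    by (rule order_trans[OF norm_sum]) (intro sum_mono, simp add: inner_Cauchy_Schwarz)
  also have "\<dots> \<le> L2_set (\<lambda>k. norm (u k)) {..<N} * L2_set (\<lambda>k. norm (v k)) {..<N}"
    by (rule L2_set_mult_ineq)
  also have "\<dots> \<le> sqrt a * sqrt b"
    unfolding L2_set_def by (intro mult_mono real_sqrt_le_mono assms) (auto simp: sum_nonneg order_trans[OF _ assms(1)])
  finally show ?thesis by (simp add: real_sqrt_mult)
qed

text \<open>The trace of \<open>F A B\<close> is the Hilbert-Schmidt inner product of \<open>B\<close> and \<open>(F A)\<^sup>*\<close>.\<close>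

lemma hs_bound_trace_bound:
  assumes A: "hs_bound A a" and B: "hs_bound B b"
  shows "trace_bound (A * B) (sqrt (a * b))"
  unfolding trace_bound_def
proof (intro conjI allI impI)
  show "0 \<le> sqrt (a * b)" using hs_bound_nonneg[OF A] hs_bound_nonneg[OF B] by simp
  fix N F assume F: "norm (F :: nat l2op) \<le> 1"
  let ?G = "op_adj (F * Pn N * A)"
  have "norm (F * Pn N) \<le> 1 * 1"
    by (rule order_trans[OF norm_mult_ineq]) (intro mult_mono F norm_proj_op_le; simp)
  then have "(norm (F * Pn N))\<^sup>2 * a \<le> 1 * a"
    using hs_bound_nonneg[OF A] by (intro mult_right_mono) (auto simp: power_le_one)
  then have G: "hs_bound ?G a"
    using hs_bound_adj[OF hs_bound_mono[OF hs_bound_mult_left[OF A, of "F * Pn N"]], of a] by simp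
  have "(\<Sum>i<N. \<Sum>j<N. entry F i j * entry (A * B) j i) = (\<Sum>i<N. entry (F * Pn N * A * B) i i)"
    by (simp add: mult.assoc entry_Pn_mult[simplified mult.assoc])
  also have "\<dots> = (\<Sum>i<N. l2_inner (app B (l2_basis i)) (app ?G (l2_basis i)))"
    unfolding entry_inner app_times[of _ B] op_adj ..
  also have "cmod \<dots> \<le> sqrt (b * a)"
    using B G by (intro cmod_sum_inner_le) (auto simp: hs_bound_def)
  finally show "cmod (\<Sum>i<N. \<Sum>j<N. entry F i j * entry (A * B) j i) \<le> sqrt (a * b)"
    by (simp add: mult.commute)
qed

lemma entry_op_abs_nonneg: "0 \<le> Re (entry (op_abs (K :: nat l2op)) k k)"
  using op_abs(1)[of K] by (simp add: entry_inner positive_op_def)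

lemma trace_class_factor:
  assumes tc: "trace_class (K :: nat l2op)"
  shows "\<exists>A R. K = A * R \<and> hs_bound A (trace_norm K) \<and> hs_bound R (trace_norm K)"
proof -
  obtain R where R: "positive_op R" "R * R = op_abs K"
    "\<And>B. B * op_abs K = op_abs K * B \<Longrightarrow> B * R = R * B"
    using positive_op_sqrt[OF op_abs(1), of K] by blast
  obtain A where A: "K = A * R" "\<And>x. norm (app A x) = norm (app R x)"
    using abs_sqrt_factor[OF R] by blast
  have "(norm (app R (l2_basis k)))\<^sup>2 = Re (entry (op_abs K) k k)" for k
  proof -
    have "entry (op_abs K) k k = l2_inner (app R (l2_basis k)) (app R (l2_basis k))"
      unfolding entry_inner R(2)[symmetric] app_times positive_op_hermitian[OF R(1)] ..
    then show ?thesis by (simp add: inner_self)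
  qed
  moreover have "(\<Sum>k<N. Re (entry (op_abs K) k k)) \<le> trace_norm K" for N
    unfolding trace_norm_def
    by (rule finite_sum_le_infsum) (use tc in \<open>auto simp: trace_class_def entry_op_abs_nonneg\<close>)
  ultimately have "hs_bound R (trace_norm K)" by (simp add: hs_bound_def)
  moreover from this have "hs_bound A (trace_norm K)" by (simp add: hs_bound_def A(2))
  ultimately show ?thesis using A(1) by blast
qed

lemma trace_norm_nonneg: "0 \<le> trace_norm (K :: nat l2op)"
  unfolding trace_norm_def by (intro infsum_nonneg entry_op_abs_nonneg)

lemma trace_class_trace_bound:
  assumes "trace_class (K :: nat l2op)"
  shows "trace_bound K (trace_norm K)"
  using trace_class_factor[OF assms] hs_bound_trace_bound[of _ "trace_norm K" _ "trace_norm K"]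
  by (auto simp: trace_norm_nonneg)

text \<open>Conversely \<open>|K|\<close> is the limit of the products \<open>W K\<close> with the contractions
  \<open>W = (|K| + \<epsilon>)\<^sup>-\<^sup>1 K\<^sup>*\<close>, so the diagonal of \<open>|K|\<close> is controlled by the dual bound.\<close>

lemma trace_bound_op_abs_trace_le:
  assumes K: "trace_bound K C"
  shows "(\<Sum>k<N. Re (entry (op_abs K) k k)) \<le> C"
proof (rule field_le_epsilon)
  fix d :: real assume d: "d > 0"
  define e where "e = d / (real N + 1)"
  have e: "e > 0" using d by (simp add: e_def)
  define S where "S = op_abs K"
  have S: "positive_op S" "S * S = op_adj K * K" by (simp_all add: S_def op_abs)
  obtain Z where Z: "Z * (S + e *\<^sub>R 1) = 1" "(S + e *\<^sub>R 1) * Z = 1"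
    using positive_op_resolvent[OF S(1) e] by blast
  have adjS: "op_adj S = S" by (rule positive_op_adj[OF S(1)])
  have "op_adj (Z * (S + e *\<^sub>R 1)) = 1" by (simp only: Z adj_simps)
  then have "(S + e *\<^sub>R 1) * op_adj Z = 1" by (simp add: adj_simps adjS del: scaleR_conv_of_real)
  then have adjZ: "op_adj Z = Z" using Z(1) by (metis mult.assoc mult_1_left mult_1_right)
  have ZS: "Z * S = 1 - e *\<^sub>R Z" using Z(1) by (simp add: algebra_simps)
  have app_SZ: "app (S + e *\<^sub>R 1) (app Z x) = x" for x using Z(2) by (simp flip: app_times)
  have SZ_le: "norm (app S (app Z x)) \<le> norm x" for x
    using resolvent_bounds(1)[OF S(1) e, of "app Z x"] by (simp only: app_SZ)
  have "norm (K * Z) \<le> 1"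
    by (rule norm_l2op_le) (use SZ_le in \<open>simp_all add: app_times S_def norm_op_abs\<close>)
  then have nW: "norm (Z * op_adj K) \<le> 1" using norm_adj[of "K * Z"] by (simp add: adj_simps adjZ)
  have "norm (S * Z) \<le> 1" by (rule norm_l2op_le) (use SZ_le in \<open>simp_all add: app_times\<close>)
  then have nZS: "norm (Z * S) \<le> 1" using norm_adj[of "S * Z"] by (simp add: adj_simps adjZ adjS)
  have WK: "Z * op_adj K * K = S - e *\<^sub>R (Z * S)"
  proof -
    have "Z * op_adj K * K = (Z * S) * S" by (simp add: mult.assoc S(2))
    also have "\<dots> = S - e *\<^sub>R (Z * S)" by (subst ZS) (simp add: algebra_simps)
    finally show ?thesis .
  qed
  have "trace_bound (Z * op_adj K * K) (norm (Z * op_adj K) * C)" by (rule trace_bound_mult_left[OF K])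
  then have "trace_bound (Z * op_adj K * K) C"
    by (rule trace_bound_mono) (use nW trace_bound_nonneg[OF K] in \<open>simp add: mult_left_le_one_le\<close>)
  from trace_bound_trace[OF this, of N]
  have 1: "Re (\<Sum>k<N. entry (S - e *\<^sub>R (Z * S)) k k) \<le> C"
    unfolding WK by (rule order_trans[OF complex_Re_le_cmod])
  have "(\<Sum>k<N. Re (entry (Z * S) k k)) \<le> (\<Sum>k<N. 1)"
    by (intro sum_mono order_trans[OF complex_Re_le_cmod] order_trans[OF entry_le nZS])
  then have "e * (\<Sum>k<N. Re (entry (Z * S) k k)) \<le> e * real N" using e by (intro mult_left_mono) auto
  also have "\<dots> \<le> d" using d by (simp add: e_def field_simps)
  finally show "(\<Sum>k<N. Re (entry (op_abs K) k k)) \<le> C + d"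
    using 1 by (simp add: entry_simps sum_subtractf sum_distrib_left S_def)
qed

lemma trace_bound_trace_class:
  assumes K: "trace_bound K C"
  shows "trace_class K" "trace_norm K \<le> C"
proof -
  have b: "(\<Sum>k\<in>F. Re (entry (op_abs K) k k)) \<le> C" if "finite F" for F
  proof -
    obtain N where "F \<subseteq> {..<N}" using finite_nat_bounded[OF \<open>finite F\<close>] by (metis lessThan_def)
    then have "(\<Sum>k\<in>F. Re (entry (op_abs K) k k)) \<le> (\<Sum>k<N. Re (entry (op_abs K) k k))"
      by (intro sum_mono2) (auto simp: entry_op_abs_nonneg)
    then show ?thesis using trace_bound_op_abs_trace_le[OF K, of N] by linarith
  qed
  then show tc: "trace_class K"
    unfolding trace_class_def
    by (intro nonneg_bdd_above_summable_on bdd_aboveI2[where M=C]) (auto simp: entry_op_abs_nonneg)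
  show "trace_norm K \<le> C"
    unfolding trace_norm_def by (rule infsum_le_finite_sums) (use tc b in \<open>auto simp: trace_class_def\<close>)
qed

lemma trace_bound_factor:
  assumes K: "trace_bound K C"
  shows "\<exists>A R. K = A * R \<and> hs_bound A C \<and> hs_bound R C"
  using trace_class_factor[OF trace_bound_trace_class(1)[OF K]] hs_bound_mono[OF _ trace_bound_trace_class(2)[OF K]]
  by blast

text \<open>Domination by a product of two square summable sequences is what makes Fredholm's sums over
  index tuples absolutely convergent.\<close>

lemma trace_bound_entry_bound:
  assumes K: "trace_bound K C"
  shows "\<exists>\<alpha> \<beta>. (\<forall>i j. cmod (entry K i j) \<le> \<alpha> i * \<beta> j) \<and> (\<forall>i. 0 \<le> \<alpha> i) \<and> (\<forall>j. 0 \<le> \<beta> j) \<and>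
    (\<forall>N. (\<Sum>i<N. (\<alpha> i)\<^sup>2) \<le> C) \<and> (\<forall>N. (\<Sum>j<N. (\<beta> j)\<^sup>2) \<le> C)"
proof -
  obtain A R where AR: "K = A * R" "hs_bound A C" "hs_bound R C" using trace_bound_factor[OF K] by blast
  have "cmod (entry K i j) \<le> norm (app (op_adj A) (l2_basis i)) * norm (app R (l2_basis j))" for i j
    unfolding entry_inner AR(1) app_times op_adj[of A]
    by (subst mult.commute) (rule inner_Cauchy_Schwarz)
  then show ?thesis using AR(3) hs_bound_adj[OF AR(2)] unfolding hs_bound_def
    by (intro exI[of _ "\<lambda>i. norm (app (op_adj A) (l2_basis i))"] exI[of _ "\<lambda>j. norm (app R (l2_basis j))"]) auto
qed

text \<open>Truncating the right Hilbert-Schmidt factor leaves a tail of a convergent series.\<close>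

lemma trace_bound_tail_right:
  assumes K: "trace_bound K C" and e: "e > 0"
  shows "\<forall>\<^sub>F N in sequentially. trace_bound (K * (1 - Pn N)) e"
proof -
  obtain A R where AR: "K = A * R" "hs_bound A C" "hs_bound R C" using trace_bound_factor[OF K] by blast
  define s where "s k = (norm (app R (l2_basis k)))\<^sup>2" for k
  (* chosen such that C d is at most e squared, also for C = 0 *)
  define d where "d = e\<^sup>2 / (C + 1)"
  have C: "C \<ge> 0" by (rule trace_bound_nonneg[OF K])
  have d: "d > 0" using e C by (simp add: d_def)
  have "summable s"
    by (rule bounded_imp_summable[where B=C])
      (use AR(3)[unfolded hs_bound_def, rule_format, of "Suc _"]
        in \<open>auto simp: s_def lessThan_Suc_atMost\<close>)
  then obtain N0 where N0: "\<And>m n. m \<ge> N0 \<Longrightarrow> norm (sum s {m..<n}) < d"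
    using d unfolding summable_Cauchy by blast
  have "trace_bound (K * (1 - Pn N)) e" if N: "N \<ge> N0" for N
  proof -
    have "hs_bound (R * (1 - Pn N)) d"
      unfolding hs_bound_def
    proof
      fix M
      have "(\<Sum>k<M. (norm (app (R * (1 - Pn N)) (l2_basis k)))\<^sup>2) = (\<Sum>k<M. if k < N then 0 else s k)"
        by (intro sum.cong refl) (simp add: app_simps Pn_basis s_def)
      also have "\<dots> = sum s {N..<M}"
        by (rule sum.mono_neutral_cong_right) auto
      also have "\<dots> \<le> d" using N0[OF N, of M] by simp
      finally show "(\<Sum>k<M. (norm (app (R * (1 - Pn N)) (l2_basis k)))\<^sup>2) \<le> d" .
    qed
    from hs_bound_trace_bound[OF AR(2) this] have "trace_bound (K * (1 - Pn N)) (sqrt (C * d))"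
      by (simp add: AR(1) mult.assoc)
    moreover have "C * d \<le> e\<^sup>2" using C by (simp add: d_def field_simps)
    then have "sqrt (C * d) \<le> e" using e by (intro real_le_lsqrt) auto
    ultimately show ?thesis by (rule trace_bound_mono)
  qed
  then show ?thesis by (auto simp: eventually_sequentially)
qed

lemma trace_bound_tail_left:
  assumes K: "trace_bound K C" and e: "e > 0"
  shows "\<forall>\<^sub>F N in sequentially. trace_bound ((1 - Pn N) * K) e"
  using trace_bound_tail_right[OF trace_bound_adj[OF K] e]
proof eventually_elim
  case (elim N)
  then show ?case using trace_bound_adj[OF elim] by (simp add: adj_simps)
qed

lemma trace_bound_Pn: "trace_bound (Pn N) (real N)"
proof -
  have "hs_bound (Pn N) (real N)"
    unfolding hs_bound_def
  proof
    fix M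
    have "(\<Sum>k<M. (norm (app (Pn N) (l2_basis k)))\<^sup>2) = (\<Sum>k\<in>{..<M} \<inter> {..<N}. 1)"
      by (subst sum.inter_restrict) (auto simp: Pn_basis norm_l2_basis intro!: sum.cong)
    also have "\<dots> \<le> real N" by (simp add: card_mono[of "{..<N}", simplified])
    finally show "(\<Sum>k<M. (norm (app (Pn N) (l2_basis k)))\<^sup>2) \<le> real N" .
  qed
  from hs_bound_trace_bound[OF this this] show ?thesis
    by (simp add: proj_op_idem)
qed

text \<open>This is convergence in trace norm, as the dual bounds are the trace norm bounds.\<close>

definition trace_tendsto :: "(nat \<Rightarrow> nat l2op) \<Rightarrow> nat l2op \<Rightarrow> bool"
  where "trace_tendsto K L \<longleftrightarrow> (\<forall>e>0. \<forall>\<^sub>F n in sequentially. trace_bound (K n - L) e)"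

lemma trace_tendsto_add:
  assumes "trace_tendsto K L" "trace_tendsto K' L'"
  shows "trace_tendsto (\<lambda>n. K n + K' n) (L + L')"
  unfolding trace_tendsto_def
proof (intro allI impI)
  fix e :: real assume "e > 0"
  then have "\<forall>\<^sub>F n in sequentially. trace_bound (K n - L) (e / 2)" "\<forall>\<^sub>F n in sequentially. trace_bound (K' n - L') (e / 2)"
    using assms by (auto simp: trace_tendsto_def)
  then show "\<forall>\<^sub>F n in sequentially. trace_bound (K n + K' n - (L + L')) e"
  proof eventually_elim
    case (elim n)
    then show ?case using trace_bound_add[OF elim] by (simp add: algebra_simps)
  qed
qed

lemma trace_tendsto_zero: "trace_tendsto (\<lambda>n. 0) 0"
  unfolding trace_tendsto_def by (auto intro: trace_bound_mono[OF trace_bound_zero])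

lemma trace_tendsto_scaleR:
  assumes "trace_tendsto K L"
  shows "trace_tendsto (\<lambda>n. r *\<^sub>R K n) (r *\<^sub>R L)"
  unfolding trace_tendsto_def
proof (intro allI impI)
  fix e :: real assume e: "e > 0"
  define d where "d = e / (\<bar>r\<bar> + 1)"
  have d: "d > 0" using e by (simp add: d_def)
  have "\<bar>r\<bar> * d \<le> e" using e by (simp add: d_def field_simps)
  moreover have "\<forall>\<^sub>F n in sequentially. trace_bound (K n - L) d" using assms d by (simp add: trace_tendsto_def)
  ultimately show "\<forall>\<^sub>F n in sequentially. trace_bound (r *\<^sub>R K n - r *\<^sub>R L) e"
    by (elim eventually_mono) (metis scaleR_diff_right trace_bound_mono trace_bound_scaleR)
qed

lemma trace_tendsto_sum:
  assumes "\<And>k. k \<in> I \<Longrightarrow> trace_tendsto (K k) (L k)"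
  shows "trace_tendsto (\<lambda>n. \<Sum>k\<in>I. K k n) (\<Sum>k\<in>I. L k)"
  using assms by (induction I rule: infinite_finite_induct) (auto simp: trace_tendsto_zero intro!: trace_tendsto_add)

lemma trace_tendsto_mult_left:
  assumes K: "trace_tendsto K L" and L: "trace_bound L C" and Y: "Y \<longlonglongrightarrow> (Y' :: nat l2op)"
  shows "trace_tendsto (\<lambda>n. Y n * K n) (Y' * L)"
  unfolding trace_tendsto_def
proof (intro allI impI)
  fix e :: real assume e: "e > 0"
  define d where "d = e / (norm Y' + 1 + C)"
  have C: "C \<ge> 0" by (rule trace_bound_nonneg[OF L])
  have p: "norm Y' + 1 + C > 0" using C by (simp add: add_nonneg_pos add_pos_nonneg)
  have d: "d > 0" using e p by (simp add: d_def)
  have "(norm Y' + 1) * d + d * C = (norm Y' + 1 + C) * d" by (simp add: algebra_simps)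
  also have "\<dots> = e" using p by (simp add: d_def)
  finally have de: "(norm Y' + 1) * d + d * C = e" .
  have "\<forall>\<^sub>F n in sequentially. trace_bound (K n - L) d" using K d by (simp add: trace_tendsto_def)
  moreover have "\<forall>\<^sub>F n in sequentially. norm (Y n - Y') < min d 1"
    using tendsto_dist_iff[of Y Y'] Y d by (intro order_tendstoD) (auto simp: dist_norm)
  ultimately show "\<forall>\<^sub>F n in sequentially. trace_bound (Y n * K n - Y' * L) e"
  proof eventually_elim
    case (elim n)
    have "norm (Y n) \<le> norm Y' + 1"
      using norm_triangle_ineq[of Y' "Y n - Y'"] elim(2) by simp
    then have "norm (Y n) * d \<le> (norm Y' + 1) * d" using d by (simp add: mult_right_mono)
    moreover have "norm (Y n - Y') * C \<le> d * C" using elim(2) C by (intro mult_right_mono) auto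
    ultimately have "norm (Y n) * d + norm (Y n - Y') * C \<le> e" using de by linarith
    moreover have "trace_bound (Y n * (K n - L) + (Y n - Y') * L) (norm (Y n) * d + norm (Y n - Y') * C)"
      by (intro trace_bound_add trace_bound_mult_left elim L)
    moreover have "Y n * K n - Y' * L = Y n * (K n - L) + (Y n - Y') * L" by (simp add: algebra_simps)
    ultimately show ?case using trace_bound_mono by simp
  qed
qed

lemma trace_tendsto_adj: "trace_tendsto K L \<Longrightarrow> trace_tendsto (\<lambda>n. op_adj (K n)) (op_adj L)"
  unfolding trace_tendsto_def by (metis (mono_tags, lifting) adj_simps(3) eventually_mono trace_bound_adj)

lemma tendsto_adj: "(Y \<longlongrightarrow> (Y' :: nat l2op)) F \<Longrightarrow> ((\<lambda>n. op_adj (Y n)) \<longlongrightarrow> op_adj Y') F"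
  by (rule bounded_linear.tendsto[OF bounded_linear_adj])

lemma trace_tendsto_mult_right:
  assumes K: "trace_tendsto K L" and L: "trace_bound L C" and Y: "Y \<longlonglongrightarrow> (Y' :: nat l2op)"
  shows "trace_tendsto (\<lambda>n. K n * Y n) (L * Y')"
  using trace_tendsto_adj[OF trace_tendsto_mult_left[OF trace_tendsto_adj[OF K] trace_bound_adj[OF L] tendsto_adj[OF Y]]]
  by (simp add: adj_simps)

hide_const (open) Determinants.det Finite_Cartesian_Product.vec Finite_Cartesian_Product.row

section \<open>Determinants of finite sections\<close>

lemma permutes_below: "p permutes {0..<N} \<Longrightarrow> i < N \<Longrightarrow> p i < (N :: nat)"
  using permutes_in_image[of p "{0..<N}" i] by simp

lemma inner_eq_0_sym: "l2_inner x y = 0 \<Longrightarrow> l2_inner y x = 0"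
  using inner_cnj[of x y] by simp

lemma det_diag_fun:
  "det (mat N N (\<lambda>(i, j). if i = j then d i else (0 :: complex))) = (\<Prod>i<N. d i)"
proof -
  let ?A = "mat N N (\<lambda>(i, j). if i = j then d i else (0 :: complex))"
  have "det ?A = prod_list (diag_mat ?A)"
    by (rule Determinant.det_upper_triangular[of _ N]) auto
  also have "diag_mat ?A = map d [0..<N]" by (auto simp: diag_mat_def)
  also have "prod_list (map d [0..<N]) = (\<Prod>i<N. d i)"
    by (simp add: prod.list_conv_set_nth atLeast0LessThan)
  finally show ?thesis .
qed

lemma det_cnj_transpose:
  "det (mat N N (\<lambda>(i, j). cnj (m j i))) = cnj (det (mat N N (\<lambda>(i, j). m i j)))"
proof -
  have "det (mat N N (\<lambda>(i, j). cnj (m j i))) = det (mat N N (\<lambda>(i, j). cnj (m i j)))"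
    by (subst Determinant.det_transpose[of _ N, symmetric]) (auto intro!: arg_cong[where f=det] eq_matI)
  also have "\<dots> = cnj (det (mat N N (\<lambda>(i, j). m i j)))"
  proof -
    have "(\<Prod>i = 0..<N. cnj (m i (p i))) = cnj (\<Prod>i = 0..<N. m i (p i))" for p by simp
    then show ?thesis
      by (subst (1 2) det_def'[of _ N]) (auto simp: permutes_below intro!: sum.cong)
  qed
  finally show ?thesis .
qed

text \<open>Subtracting from column \<open>k\<close> its projection onto the previous orthogonal columns is
  multiplication by a unit upper triangular matrix, and by Pythagoras it does not increase the norm.\<close>

lemma Gram_Schmidt_step:
  fixes u :: "nat \<Rightarrow> nat l2"
  assumes k: "k < N"
    and orth: "\<And>i j. i < k \<Longrightarrow> j < k \<Longrightarrow> i \<noteq> j \<Longrightarrow> l2_inner (u i) (u j) = 0"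
  defines "a \<equiv> \<lambda>l. if u l = 0 then 0 else l2_inner (u k) (u l) / l2_inner (u l) (u l)"
  defines "p \<equiv> \<Sum>l<k. l2_scale (a l) (u l)"
  defines "v \<equiv> u(k := u k - p)"
  shows "det (mat N N (\<lambda>(i, j). coord (v j) i)) = det (mat N N (\<lambda>(i, j). coord (u j) i))"
    and "\<And>i. i < k \<Longrightarrow> l2_inner (v k) (v i) = 0"
    and "norm (v k) \<le> norm (u k)"
proof -
  let ?U = "mat N N (\<lambda>(i, j). if i = j then 1 else if j = k \<and> i < k then - a i else 0)"
  let ?M = "mat N N (\<lambda>(i, j). coord (u j) i)"
  have detU: "det ?U = 1"
  proof -
    have "det ?U = prod_list (diag_mat ?U)"
      by (rule Determinant.det_upper_triangular[of _ N], rule upper_triangularI) auto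
    also have "diag_mat ?U = map (\<lambda>_. 1) [0..<N]" by (auto simp: diag_mat_def)
    also have "prod_list (map (\<lambda>_. 1 :: complex) xs) = 1" for xs :: "nat list" by (induction xs) auto
    finally show ?thesis .
  qed
  have cv: "coord (v k) i = coord (u k) i - (\<Sum>l<k. a l * coord (u l) i)" for i
    by (simp add: v_def p_def coord_simps coord_sum)
  have "?M * ?U = mat N N (\<lambda>(i, j). coord (v j) i)"
  proof (rule eq_matI)
    fix i j assume "i < dim_row (mat N N (\<lambda>(i, j). coord (v j) i))" "j < dim_col (mat N N (\<lambda>(i, j). coord (v j) i))"
    then have ij: "i < N" "j < N" by auto
    have "(?M * ?U) $$ (i, j) = (\<Sum>l<N. coord (u l) i * (if l = j then 1 else if j = k \<and> l < k then - a l else 0))"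
      using ij by (simp add: scalar_prod_def atLeast0LessThan)
    also have "\<dots> = coord (v j) i"
    proof (cases "j = k")
      case True
      have "(\<Sum>l<N. coord (u l) i * (if l = j then 1 else if j = k \<and> l < k then - a l else 0))
          = (\<Sum>l<N. (if l = k then coord (u l) i else 0) + (if l < k then - (a l * coord (u l) i) else 0))"
        by (intro sum.cong refl) (auto simp: True)
      also have "\<dots> = coord (u k) i + (\<Sum>l\<in>{..<N} \<inter> {..<k}. - (a l * coord (u l) i))"
        using k by (simp add: sum.distrib sum.inter_restrict)
      also have "{..<N} \<inter> {..<k} = {..<k}" using k by auto
      finally show ?thesis by (simp add: True cv sum_negf)
    next
      case False
      have "(\<Sum>l<N. coord (u l) i * (if l = j then 1 else if j = k \<and> l < k then - a l else 0))
          = (\<Sum>l<N. if l = j then coord (u l) i else 0)"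
        by (intro sum.cong refl) (auto simp: False)
      then show ?thesis using ij False by (simp add: v_def)
    qed
    finally show "(?M * ?U) $$ (i, j) = mat N N (\<lambda>(i, j). coord (v j) i) $$ (i, j)" using ij by simp
  qed auto
  then show "det (mat N N (\<lambda>(i, j). coord (v j) i)) = det ?M"
    using det_mult[of ?M N ?U] by (simp add: detU)
  have inner_sum: "l2_inner (\<Sum>l\<in>I. f l) y = (\<Sum>l\<in>I. l2_inner (f l) y)" for I and f :: "nat \<Rightarrow> nat l2" and y
    by (induction I rule: infinite_finite_induct) (auto simp: inner_simps)
  have ip: "l2_inner (u k - p) (u i) = 0" if i: "i < k" for i
  proof -
    have "l2_inner p (u i) = (\<Sum>l<k. if l = i then a i * l2_inner (u i) (u i) else 0)"
      unfolding p_def inner_sum by (intro sum.cong refl) (auto simp: inner_simps orth i)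
    also have "\<dots> = l2_inner (u k) (u i)" using i by (simp add: a_def inner_self)
    finally show ?thesis by (simp add: inner_simps)
  qed
  then show "\<And>i. i < k \<Longrightarrow> l2_inner (v k) (v i) = 0" by (simp add: v_def)
  have z2: "l2_inner p (u k - p) = 0"
  proof -
    have "l2_inner (u i) (u k - p) = 0" if "i < k" for i by (rule inner_eq_0_sym[OF ip[OF that]])
    moreover have "l2_inner p y = (\<Sum>l<k. a l * l2_inner (u l) y)" for y
      unfolding p_def inner_sum inner_scale_left ..
    ultimately show ?thesis by simp
  qed
  note z = z2 inner_eq_0_sym[OF z2]
  have "l2_inner (u k) (u k) = l2_inner ((u k - p) + p) ((u k - p) + p)" by simp
  also have "\<dots> = l2_inner (u k - p) (u k - p) + l2_inner p p"
    unfolding inner_add_left inner_add_right z by simp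
  finally have "(norm (u k))\<^sup>2 = (norm (u k - p))\<^sup>2 + (norm p)\<^sup>2"
    unfolding inner_self of_real_add[symmetric] of_real_eq_iff .
  then show "norm (v k) \<le> norm (u k)" by - (rule power2_le_imp_le; simp add: v_def)
qed

lemma Gram_Schmidt:
  fixes u :: "nat \<Rightarrow> nat l2"
  assumes supp: "\<And>j i. i \<ge> N \<Longrightarrow> coord (u j) i = 0" and k: "k \<le> N"
  shows "\<exists>v. det (mat N N (\<lambda>(i, j). coord (v j) i)) = det (mat N N (\<lambda>(i, j). coord (u j) i)) \<and>
    (\<forall>j i. i \<ge> N \<longrightarrow> coord (v j) i = 0) \<and> (\<forall>j. norm (v j) \<le> norm (u j)) \<and>
    (\<forall>i<k. \<forall>j<k. i \<noteq> j \<longrightarrow> l2_inner (v i) (v j) = 0)"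
  using k
proof (induction k)
  case 0
  then show ?case using supp by (intro exI[of _ u]) auto
next
  case (Suc k)
  then obtain v where v: "det (mat N N (\<lambda>(i, j). coord (v j) i)) = det (mat N N (\<lambda>(i, j). coord (u j) i))"
    "\<And>j i. i \<ge> N \<Longrightarrow> coord (v j) i = 0" "\<And>j. norm (v j) \<le> norm (u j)"
    "\<And>i j. i < k \<Longrightarrow> j < k \<Longrightarrow> i \<noteq> j \<Longrightarrow> l2_inner (v i) (v j) = 0"
    by auto
  define w where "w = v(k := v k -
    (\<Sum>l<k. l2_scale (if v l = 0 then 0 else l2_inner (v k) (v l) / l2_inner (v l) (v l)) (v l)))"
  have k: "k < N" using Suc.prems by simp
  note step = Gram_Schmidt_step[of k N v, OF k v(4), folded w_def]
  have "l2_inner (w i) (w j) = 0" if "i < Suc k" "j < Suc k" "i \<noteq> j" for i j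
  proof -
    consider "i = k" "j < k" | "j = k" "i < k" | "i < k" "j < k" using \<open>i < Suc k\<close> \<open>j < Suc k\<close> \<open>i \<noteq> j\<close> by linarith
    then show ?thesis
    proof cases
      case 2
      then show ?thesis using inner_eq_0_sym[OF step(2)[of i]] by simp
    qed (use step(2) v(4) that in \<open>auto simp: w_def\<close>)
  qed
  moreover have "coord (w j) i = 0" if "i \<ge> N" for j i
    using v(2)[OF that] by (simp add: w_def coord_simps coord_sum)
  moreover have "norm (w j) \<le> norm (u j)" for j
    using step(3) v(3)[of j] by (cases "j = k") (auto simp: w_def)
  ultimately show ?case using step(1) v(1) by (intro exI[of _ w]) auto
qed

text \<open>After orthogonalisation the Gram matrix is diagonal, and its determinant is the squared modulus
  of the determinant in question.\<close>

lemma Hadamard: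
  fixes u :: "nat \<Rightarrow> nat l2"
  assumes supp: "\<And>j i. i \<ge> N \<Longrightarrow> coord (u j) i = 0"
  shows "cmod (det (mat N N (\<lambda>(i, j). coord (u j) i))) \<le> (\<Prod>j<N. norm (u j))"
proof -
  obtain v where v: "det (mat N N (\<lambda>(i, j). coord (v j) i)) = det (mat N N (\<lambda>(i, j). coord (u j) i))"
    "\<And>j i. i \<ge> N \<Longrightarrow> coord (v j) i = 0" "\<And>j. norm (v j) \<le> norm (u j)"
    "\<And>i j. i < N \<Longrightarrow> j < N \<Longrightarrow> i \<noteq> j \<Longrightarrow> l2_inner (v i) (v j) = 0"
    using Gram_Schmidt[of N u N, OF supp] by auto
  let ?M = "mat N N (\<lambda>(i, j). coord (v j) i)"
  let ?H = "mat N N (\<lambda>(i, j). cnj (coord (v i) j))"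
  have "?H * ?M = mat N N (\<lambda>(i, j). if i = j then of_real ((norm (v i))\<^sup>2) else 0)"
  proof (rule eq_matI)
    fix i j assume "i < dim_row (mat N N (\<lambda>(i, j). if i = j then complex_of_real ((norm (v i))\<^sup>2) else 0))"
      "j < dim_col (mat N N (\<lambda>(i, j). if i = j then complex_of_real ((norm (v i))\<^sup>2) else 0))"
    then have ij: "i < N" "j < N" by auto
    have "(?H * ?M) $$ (i, j) = (\<Sum>l<N. coord (v j) l * cnj (coord (v i) l))"
      using ij by (simp add: scalar_prod_def atLeast0LessThan mult.commute)
    also have "\<dots> = l2_inner (v j) (v i)"
      by (rule inner_finite[symmetric]) (use v(2) in auto)
    finally show "(?H * ?M) $$ (i, j)
        = mat N N (\<lambda>(i, j). if i = j then of_real ((norm (v i))\<^sup>2) else 0) $$ (i, j)"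
      using ij v(4) by (auto simp: inner_self)
  qed auto
  then have "det ?H * det ?M = (\<Prod>i<N. of_real ((norm (v i))\<^sup>2))"
    using det_mult[of ?H N ?M] by (simp add: det_diag_fun)
  also have "det ?H = cnj (det ?M)" by (rule det_cnj_transpose)
  finally have "of_real ((cmod (det ?M))\<^sup>2) = complex_of_real (\<Prod>i<N. (norm (v i))\<^sup>2)"
    unfolding complex_norm_square by (simp add: mult.commute)
  then have "(cmod (det ?M))\<^sup>2 = (\<Prod>i<N. norm (v i))\<^sup>2"
    unfolding of_real_eq_iff by (simp add: prod_power_distrib)
  then have "cmod (det ?M) = (\<Prod>i<N. norm (v i))"
    by (rule power2_eq_imp_eq) (auto intro: prod_nonneg)
  also have "\<dots> \<le> (\<Prod>j<N. norm (u j))" by (intro prod_mono) (auto simp: v(3))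
  finally show ?thesis by (simp only: v(1))
qed

definition sdet :: "nat \<Rightarrow> nat l2op \<Rightarrow> complex"
  where "sdet N X = det (mat N N (\<lambda>(i, j). entry X i j))"

lemma sdet_cong:
  "(\<And>i j. i < N \<Longrightarrow> j < N \<Longrightarrow> entry X i j = entry Y i j) \<Longrightarrow> sdet N X = sdet N Y"
  unfolding sdet_def by (intro arg_cong[where f=det] eq_matI) auto

lemma sdet_mult: "sdet N (X * Pn N * Y) = sdet N X * sdet N Y"
proof -
  have "mat N N (\<lambda>(i, j). entry (X * Pn N * Y) i j)
      = mat N N (\<lambda>(i, j). entry X i j) * mat N N (\<lambda>(i, j). entry Y i j)"
    by (intro eq_matI) (auto simp: entry_Pn_mult scalar_prod_def atLeast0LessThan)
  then show ?thesis unfolding sdet_def by (simp add: det_mult[of _ N])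
qed

lemma trace_bound_hs_section:
  assumes X: "trace_bound X C"
  shows "(\<Sum>j<N. \<Sum>i<N. (cmod (entry X i j))\<^sup>2) \<le> C\<^sup>2"
proof -
  obtain \<alpha> \<beta> where b: "\<And>i j. cmod (entry X i j) \<le> \<alpha> i * \<beta> j" "\<And>i. 0 \<le> \<alpha> i" "\<And>j. 0 \<le> \<beta> j"
    "\<And>N. (\<Sum>i<N. (\<alpha> i)\<^sup>2) \<le> C" "\<And>N. (\<Sum>j<N. (\<beta> j)\<^sup>2) \<le> C"
    using trace_bound_entry_bound[OF X] by blast
  have "(\<Sum>j<N. \<Sum>i<N. (cmod (entry X i j))\<^sup>2) \<le> (\<Sum>j<N. \<Sum>i<N. (\<beta> j)\<^sup>2 * (\<alpha> i)\<^sup>2)"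
    by (intro sum_mono) (metis b(1) mult.commute norm_ge_zero power_mono power_mult_distrib)
  also have "\<dots> = (\<Sum>j<N. (\<beta> j)\<^sup>2) * (\<Sum>i<N. (\<alpha> i)\<^sup>2)" by (simp add: sum_product)
  also have "\<dots> \<le> C * C" by (intro mult_mono b trace_bound_nonneg[OF X] sum_nonneg) auto
  finally show ?thesis by (simp add: power2_eq_square)
qed

text \<open>Applied to the columns of \<open>I + X\<close>, Hadamard's inequality bounds the determinant by the trace
  and the Hilbert-Schmidt norm, independently of the size of the section.\<close>

lemma sdet_bound:
  assumes X: "trace_bound X C"
  shows "cmod (sdet N (1 + X)) \<le> exp (C + C\<^sup>2 / 2)"
proof -
  define u where "u j = app (Pn N) (app (1 + X) (l2_basis j))" for j
  have ent: "coord (u j) i = (if i < N then entry (1 + X) i j else 0)" for i j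
    by (simp add: u_def coord_proj_op entry_def)
  have "sdet N (1 + X) = det (mat N N (\<lambda>(i, j). coord (u j) i))"
    unfolding sdet_def by (intro arg_cong[where f=det] eq_matI) (auto simp: ent)
  then have "cmod (sdet N (1 + X)) \<le> (\<Prod>j<N. norm (u j))"
    using Hadamard[of N u] by (simp add: ent)
  then have "(cmod (sdet N (1 + X)))\<^sup>2 \<le> (\<Prod>j<N. norm (u j))\<^sup>2" by (rule power_mono) simp
  also have "\<dots> = (\<Prod>j<N. (norm (u j))\<^sup>2)" by (simp add: prod_power_distrib)
  also have "\<dots> \<le> (\<Prod>j<N. exp (2 * Re (entry X j j) + (\<Sum>i<N. (cmod (entry X i j))\<^sup>2)))"
  proof (intro prod_mono conjI)
    fix j assume j: "j \<in> {..<N}"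
    have "(norm (u j))\<^sup>2 = (\<Sum>i<N. (cmod (entry (1 + X) i j))\<^sup>2)"
      by (subst norm_l2_finite[of "{..<N}"]) (auto simp: ent)
    also have "\<dots> = (\<Sum>i<N. (if i = j then 1 + 2 * Re (entry X j j) else 0) + (cmod (entry X i j))\<^sup>2)"
      by (intro sum.cong refl) (auto simp: entry_simps entry_one cmod_power2 power2_sum)
    also have "\<dots> = 1 + (2 * Re (entry X j j) + (\<Sum>i<N. (cmod (entry X i j))\<^sup>2))"
      using j by (simp add: sum.distrib)
    also have "\<dots> \<le> exp (2 * Re (entry X j j) + (\<Sum>i<N. (cmod (entry X i j))\<^sup>2))"
      by (rule exp_ge_add_one_self)
    finally show "(norm (u j))\<^sup>2 \<le> exp (2 * Re (entry X j j) + (\<Sum>i<N. (cmod (entry X i j))\<^sup>2))" .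
  qed simp
  also have "\<dots> = exp (2 * Re (\<Sum>j<N. entry X j j) + (\<Sum>j<N. \<Sum>i<N. (cmod (entry X i j))\<^sup>2))"
    by (simp add: exp_sum[symmetric] sum.distrib sum_distrib_left)
  also have "\<dots> \<le> exp (2 * C + C\<^sup>2)"
    using order_trans[OF complex_Re_le_cmod trace_bound_trace[OF X, of N]] trace_bound_hs_section[OF X, of N] by simp
  also have "\<dots> = (exp (C + C\<^sup>2 / 2))\<^sup>2" by (simp add: exp_double[symmetric] algebra_simps flip: exp_double)
  finally show ?thesis by (rule power2_le_imp_le) simp
qed

section \<open>Expansion into principal minors\<close>

definition minor :: "(nat \<Rightarrow> nat \<Rightarrow> complex) \<Rightarrow> nat list \<Rightarrow> complex"
  where "minor k is = det (mat (length is) (length is) (\<lambda>(a, b). k (is ! a) (is ! b)))"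

definition set_minor :: "(nat \<Rightarrow> nat \<Rightarrow> complex) \<Rightarrow> nat set \<Rightarrow> complex"
  where "set_minor k S = (\<Sum>p | p permutes S. of_int (sign p) * (\<Prod>i\<in>S. k i (p i)))"

text \<open>In Leibniz' formula, multiply out the factors \<open>\<delta> + z k\<close>. The factors \<open>\<delta>\<close> outside \<open>S\<close> select
  the permutations that move only elements of \<open>S\<close>.\<close>

lemma det_one_plus_set_minors:
  "det (mat N N (\<lambda>(i, j). (if i = j then 1 else 0) + z * k i j))
    = (\<Sum>S\<in>Pow {..<N}. z ^ card S * set_minor k S)"
proof -
  let ?I = "{0..<N}"
  have perm: "{p. p permutes ?I \<and> (\<forall>i\<in>?I - S. i = p i)} = {p. p permutes S}" if "S \<subseteq> ?I" for S
  proof safe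
    fix p assume "p permutes ?I" "\<forall>i\<in>?I - S. i = p i"
    then show "p permutes S" by (intro permutes_superset[of p ?I S]) auto
  next
    fix p i assume "p permutes S" "i \<in> ?I" "i \<notin> S"
    then show "i = p i" by (simp add: permutes_not_in)
  qed (use that in \<open>auto intro: permutes_subset\<close>)
  have "det (mat N N (\<lambda>(i, j). (if i = j then 1 else 0) + z * k i j))
      = (\<Sum>p | p permutes ?I. of_int (sign p) * (\<Prod>i\<in>?I. z * k i (p i) + (if i = p i then 1 else 0)))"
    by (subst det_def'[of _ N]) (auto simp: permutes_below add.commute intro!: sum.cong prod.cong)
  also have "\<dots> = (\<Sum>p | p permutes ?I. \<Sum>S\<in>Pow ?I. of_int (sign p) *
      ((\<Prod>i\<in>S. z * k i (p i)) * (\<Prod>i\<in>?I - S. if i = p i then 1 else 0)))"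
    by (simp add: prod_add sum_distrib_left)
  also have "\<dots> = (\<Sum>S\<in>Pow ?I. \<Sum>p | p permutes ?I. of_int (sign p) *
      ((\<Prod>i\<in>S. z * k i (p i)) * (\<Prod>i\<in>?I - S. if i = p i then 1 else 0)))"
    by (rule sum.swap)
  also have "\<dots> = (\<Sum>S\<in>Pow ?I. z ^ card S * set_minor k S)"
  proof (rule sum.cong[OF refl])
    fix S assume S: "S \<in> Pow ?I"
    have ind: "(\<Prod>i\<in>?I - S. if i = p i then 1 else 0) = (if \<forall>i\<in>?I - S. i = p i then 1 else 0 :: complex)" for p
      by (cases "\<forall>i\<in>?I - S. i = p i") (auto intro!: prod_zero)
    have "(\<Sum>p | p permutes ?I. of_int (sign p) *
          ((\<Prod>i\<in>S. z * k i (p i)) * (\<Prod>i\<in>?I - S. if i = p i then 1 else 0)))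
        = (\<Sum>p | p permutes ?I. if \<forall>i\<in>?I - S. i = p i
            then z ^ card S * (of_int (sign p) * (\<Prod>i\<in>S. k i (p i))) else 0)"
      by (intro sum.cong refl) (auto simp: ind prod.distrib)
    also have "\<dots> = (\<Sum>p\<in>{p\<in>{p. p permutes ?I}. \<forall>i\<in>?I - S. i = p i}.
        z ^ card S * (of_int (sign p) * (\<Prod>i\<in>S. k i (p i))))"
      by (rule sum.inter_filter[symmetric]) (simp add: finite_permutations)
    also have "{p\<in>{p. p permutes ?I}. \<forall>i\<in>?I - S. i = p i} = {p. p permutes S}"
      using perm[of S] S by auto
    finally show "(\<Sum>p | p permutes ?I. of_int (sign p) *
          ((\<Prod>i\<in>S. z * k i (p i)) * (\<Prod>i\<in>?I - S. if i = p i then 1 else 0)))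
        = z ^ card S * set_minor k S"
      by (simp add: set_minor_def sum_distrib_left)
  qed
  finally show ?thesis by (simp add: atLeast0LessThan)
qed

text \<open>Enumeration by the list carries permutations of positions to permutations of the set and
  preserves their sign.\<close>

lemma minor_distinct:
  assumes "distinct is"
  shows "minor k is = set_minor k (set is)"
proof -
  let ?m = "length is" and ?f = "\<lambda>a. is ! a"
  have inj: "inj_on ?f {0..<?m}" using assms by (auto simp: inj_on_def nth_eq_iff_index_eq)
  have im: "?f ` {0..<?m} = set is" by (auto simp: set_conv_nth)
  have bij: "bij_betw ?f {0..<?m} (set is)" using inj im by (simp add: bij_betw_def)
  have bijp: "bij_betw (map_permutation {0..<?m} ?f) {p. p permutes {0..<?m}} {p. p permutes set is}"
  proof -
    have "bij_betw (\<lambda>\<pi> x. if x \<in> set is then ?f (\<pi> (inv_into {0..<?m} ?f x)) else x)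
        {p. p permutes {0..<?m}} {p. p permutes set is}"
      by (rule bij_betw_permutations[OF bij])
    moreover have "(\<lambda>\<pi> x. if x \<in> set is then ?f (\<pi> (inv_into {0..<?m} ?f x)) else x)
        = map_permutation {0..<?m} ?f"
      by (auto simp: fun_eq_iff map_permutation_def im restrict_id_def)
    ultimately show ?thesis by simp
  qed
  have "set_minor k (set is) = (\<Sum>p | p permutes {0..<?m}.
      of_int (sign (map_permutation {0..<?m} ?f p)) * (\<Prod>i\<in>set is. k i (map_permutation {0..<?m} ?f p i)))"
    unfolding set_minor_def by (rule sum.reindex_bij_betw[OF bijp, symmetric])
  also have "\<dots> = (\<Sum>p | p permutes {0..<?m}. of_int (sign p) * (\<Prod>a = 0..<?m. k (is ! a) (is ! p a)))"
  proof (intro sum.cong refl arg_cong2[where f="(*)"])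
    fix p assume p: "p \<in> {p. p permutes {0..<?m}}"
    show "of_int (sign (map_permutation {0..<?m} ?f p)) = (of_int (sign p) :: complex)"
      using sign_map_permutation[OF inj, of p] p by simp
    have "(\<Prod>i\<in>set is. k i (map_permutation {0..<?m} ?f p i))
        = (\<Prod>a = 0..<?m. k (?f a) (map_permutation {0..<?m} ?f p (?f a)))"
      by (rule prod.reindex_bij_betw[OF bij, symmetric])
    also have "\<dots> = (\<Prod>a = 0..<?m. k (is ! a) (is ! p a))"
      by (intro prod.cong refl arg_cong2[where f=k] map_permutation_apply[OF inj]) auto
    finally show "(\<Prod>i\<in>set is. k i (map_permutation {0..<?m} ?f p i))
        = (\<Prod>a = 0..<?m. k (is ! a) (is ! p a))" .
  qed
  also have "\<dots> = minor k is"
    unfolding minor_def by (subst det_def'[of _ ?m]) (auto simp: permutes_below intro!: sum.cong prod.cong)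
  finally show ?thesis ..
qed

lemma minor_not_distinct:
  assumes "\<not> distinct is"
  shows "minor k is = 0"
proof -
  obtain a b where ab: "a \<noteq> b" "a < length is" "b < length is" "is ! a = is ! b"
    using assms by (auto simp: distinct_conv_nth)
  show ?thesis
    unfolding minor_def
    by (rule Determinant.det_identical_rows[OF _ ab(1-3)]) (use ab in \<open>auto intro!: eq_vecI\<close>)
qed

abbreviation lists_below :: "nat \<Rightarrow> nat \<Rightarrow> nat list set"
  where "lists_below N m \<equiv> {is. set is \<subseteq> {..<N} \<and> length is = m}"

lemma finite_lists_below: "finite (lists_below N m)"
  by (rule finite_lists_length_eq) simp

text \<open>Lists with a repetition contribute zero, and each set of size \<open>m\<close> is enumerated by \<open>m!\<close> lists.\<close>

lemma sum_minors:
  "(\<Sum>is\<in>lists_below N m. minor k is) = fact m * (\<Sum>S | S \<subseteq> {..<N} \<and> card S = m. set_minor k S)"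
proof -
  let ?\<S> = "{S. S \<subseteq> {..<N} \<and> card S = m}"
  have fin: "finite ?\<S>" by (rule finite_subset[of _ "Pow {..<N}"]) auto
  have finS: "finite S" if "S \<in> ?\<S>" for S using that by (auto intro: finite_subset)
  have "(\<Sum>is\<in>lists_below N m. minor k is) = (\<Sum>is\<in>(\<Union>S\<in>?\<S>. permutations_of_set S). minor k is)"
    by (rule sum.mono_neutral_right[OF finite_lists_below])
      (auto simp: permutations_of_set_def distinct_card intro!: minor_not_distinct dest: card_distinct)
  also have "\<dots> = (\<Sum>S\<in>?\<S>. \<Sum>is\<in>permutations_of_set S. minor k is)"
    by (rule sum.UNION_disjoint[OF fin]) (auto dest: permutations_of_setD)
  also have "\<dots> = (\<Sum>S\<in>?\<S>. fact m * set_minor k S)"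
  proof (rule sum.cong[OF refl])
    fix S assume S: "S \<in> ?\<S>"
    have "(\<Sum>is\<in>permutations_of_set S. minor k is) = (\<Sum>is\<in>permutations_of_set S. set_minor k S)"
      by (intro sum.cong refl) (auto simp: permutations_of_set_def minor_distinct)
    also have "\<dots> = fact m * set_minor k S"
      using S by (simp add: card_permutations_of_set[OF finS[OF S]])
    finally show "(\<Sum>is\<in>permutations_of_set S. minor k is) = fact m * set_minor k S" .
  qed
  finally show ?thesis by (simp add: sum_distrib_left)
qed

text \<open>The coefficient of \<open>z\<^sup>m\<close> in the determinant of the section of \<open>I + z K\<close>, in the form of the terms of
  Fredholm's series.\<close>

definition det_coeff :: "nat l2op \<Rightarrow> nat \<Rightarrow> nat \<Rightarrow> complex"
  where "det_coeff K N m = (\<Sum>is\<in>lists_below N m. minor (entry K) is) / fact m"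

lemma det_coeff_eq_0: "m > N \<Longrightarrow> det_coeff K N m = 0"
proof -
  assume m: "m > N"
  have "{S. S \<subseteq> {..<N} \<and> card S = m} = {}"
    using m by (auto dest: card_mono[OF finite_lessThan])
  then show ?thesis unfolding det_coeff_def sum_minors by (simp only: sum.empty) simp
qed

lemma det_coeff_0: "det_coeff K N 0 = 1"
proof -
  have "lists_below N 0 = {[]}" by auto
  then show ?thesis by (simp add: det_coeff_def minor_def)
qed

lemma det_coeff_1: "det_coeff K N 1 = (\<Sum>i<N. entry K i i)"
proof -
  have "lists_below N 1 = (\<lambda>i. [i]) ` {..<N}" by (auto simp: length_Suc_conv)
  then have "det_coeff K N 1 = (\<Sum>i<N. minor (entry K) [i])"
    by (simp add: det_coeff_def sum.reindex inj_on_def)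
  then show ?thesis by (simp add: minor_def det_single)
qed

lemma entry_one_plus_scale:
  "entry (1 + op_scale z K) i j = (if i = j then 1 else 0) + z * entry K i j"
  by (simp add: entry_simps entry_one)

lemma sdet_expansion: "sdet N (1 + op_scale z K) = (\<Sum>m\<le>N. det_coeff K N m * z ^ m)"
proof -
  have "sdet N (1 + op_scale z K) = (\<Sum>S\<in>Pow {..<N}. z ^ card S * set_minor (entry K) S)"
    unfolding sdet_def entry_one_plus_scale by (rule det_one_plus_set_minors)
  also have "\<dots> = (\<Sum>m\<le>N. \<Sum>S | S \<in> Pow {..<N} \<and> card S = m. z ^ card S * set_minor (entry K) S)"
    by (rule sum.group[symmetric]) (auto dest: card_mono[OF finite_lessThan])
  also have "\<dots> = (\<Sum>m\<le>N. det_coeff K N m * z ^ m)"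
  proof (rule sum.cong[OF refl])
    fix m
    have "(\<Sum>S | S \<in> Pow {..<N} \<and> card S = m. z ^ card S * set_minor (entry K) S)
        = z ^ m * (\<Sum>S | S \<subseteq> {..<N} \<and> card S = m. set_minor (entry K) S)"
      by (simp add: sum_distrib_left)
    then show "(\<Sum>S | S \<in> Pow {..<N} \<and> card S = m. z ^ card S * set_minor (entry K) S)
        = det_coeff K N m * z ^ m"
      by (simp add: det_coeff_def sum_minors)
  qed
  finally show ?thesis .
qed

lemma op_scale_one: "op_scale 1 A = A"
  by (rule op_eqI, rule l2_eqI) (simp add: app_op_scale coord_simps)

lemma op_scale_zero: "op_scale 0 A = 0"
  by (rule op_eqI, rule l2_eqI) (simp add: app_op_scale coord_simps)

lemma trace_bound_op_scale:
  assumes "trace_bound K C"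
  shows "trace_bound (op_scale z K) (cmod z * C)"
  unfolding trace_bound_def
proof (intro conjI allI impI)
  fix N F assume F: "norm (F :: nat l2op) \<le> 1"
  have "(\<Sum>i<N. \<Sum>j<N. entry F i j * entry (op_scale z K) j i)
      = z * (\<Sum>i<N. \<Sum>j<N. entry F i j * entry K j i)"
    by (simp add: entry_simps sum_distrib_left mult.left_commute)
  then show "cmod (\<Sum>i<N. \<Sum>j<N. entry F i j * entry (op_scale z K) j i) \<le> cmod z * C"
    using assms F by (simp add: trace_bound_def mult_left_mono norm_mult)
qed (use assms in \<open>simp add: trace_bound_def\<close>)

lemma Cauchy_coeff_bound:
  assumes r: "r > 0" and B: "\<And>z. cmod z = r \<Longrightarrow> cmod (\<Sum>m\<le>M. d m * z ^ m) \<le> B" and n: "n \<le> M"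
  shows "cmod (d n) \<le> B / r ^ n"
proof -
  define p where "p = (\<Sum>m\<le>M. Polynomial.monom (d m) m)"
  have poly: "poly p z = (\<Sum>m\<le>M. d m * z ^ m)" for z by (simp add: p_def poly_sum poly_monom)
  have coeff: "poly.coeff p n = d n" using n by (simp add: p_def coeff_sum)
  have deriv: "(deriv ^^ k) (poly p) = poly ((pderiv ^^ k) p)" for k
    by (induction k) (auto intro!: ext DERIV_imp_deriv poly_DERIV)
  have "(deriv ^^ n) (poly p) 0 = fact n * d n"
    by (simp add: deriv poly_0_coeff_0 coeff_higher_pderiv pochhammer_fact[symmetric] coeff)
  moreover have "norm ((deriv ^^ n) (poly p) 0) \<le> fact n * B / r ^ n"
    by (rule Cauchy_inequality[OF _ _ r])
      (auto intro!: holomorphic_intros continuous_intros simp: poly B)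
  ultimately have "fact n * cmod (d n) \<le> fact n * (B / r ^ n)" by (simp add: norm_mult)
  then show ?thesis by (rule mult_left_le_imp_le) simp
qed

text \<open>The bound on the circle of radius \<open>r\<close> does not depend on the size \<open>N\<close> of the section.\<close>

lemma det_coeff_bound:
  assumes K: "trace_bound K C" and r: "r > 0"
  shows "cmod (det_coeff K N m) \<le> exp (r * C + (r * C)\<^sup>2 / 2) / r ^ m"
proof (cases "m \<le> N")
  case True
  show ?thesis
  proof (rule Cauchy_coeff_bound[OF r _ True])
    fix z :: complex assume z: "cmod z = r"
    show "cmod (\<Sum>m\<le>N. det_coeff K N m * z ^ m) \<le> exp (r * C + (r * C)\<^sup>2 / 2)"
      unfolding sdet_expansion[symmetric] using sdet_bound[OF trace_bound_op_scale[OF K, of z]] z by simp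
  qed
qed (use r in \<open>simp add: det_coeff_eq_0\<close>)

text \<open>The radius \<open>1/C\<close> in Cauchy's estimate makes the coefficients decay like \<open>C\<^sup>m\<close>,
  so that the terms of order at least two contribute \<open>O(C\<^sup>2)\<close>.\<close>

lemma sdet_second_order:
  assumes K: "trace_bound K C" and C: "0 < C" "C \<le> 1/2"
  shows "cmod (sdet N (1 + K) - 1 - (\<Sum>i<N. entry K i i)) \<le> 2 * exp 2 * C\<^sup>2"
proof -
  have bnd: "cmod (det_coeff K N m) \<le> exp 2 * C ^ m" for m
  proof -
    have "cmod (det_coeff K N m) \<le> exp (1 + 1 / 2) / (1 / C) ^ m"
      using det_coeff_bound[OF K, of "1 / C" N m] C by simp
    also have "\<dots> = exp (3/2) * C ^ m" using C by (simp add: power_divide)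
    also have "\<dots> \<le> exp 2 * C ^ m" using C by (intro mult_right_mono) auto
    finally show ?thesis .
  qed
  have "summable (\<lambda>m. C ^ m)" using C by (intro summable_geometric) auto
  have "sdet N (1 + K) = (\<Sum>m\<le>N + 1. det_coeff K N m)"
    using sdet_expansion[of N 1 K] by (simp add: op_scale_one det_coeff_eq_0)
  also have "\<dots> = 1 + (\<Sum>i<N. entry K i i) + (\<Sum>m\<in>{2..N + 1}. det_coeff K N m)"
  proof -
    have "{..N + 1} = {0, 1} \<union> {2..N + 1}" by auto
    then have "(\<Sum>m\<le>N + 1. det_coeff K N m) = (\<Sum>m\<in>{0, 1}. det_coeff K N m) + (\<Sum>m\<in>{2..N + 1}. det_coeff K N m)"
      by (simp add: sum.union_disjoint)
    then show ?thesis using det_coeff_1[of K N] by (simp add: det_coeff_0)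
  qed
  finally have "cmod (sdet N (1 + K) - 1 - (\<Sum>i<N. entry K i i)) = cmod (\<Sum>m\<in>{2..N + 1}. det_coeff K N m)"
    by simp
  also have "\<dots> \<le> (\<Sum>m\<in>{2..N + 1}. exp 2 * C ^ m)"
    by (rule order_trans[OF norm_sum]) (intro sum_mono bnd)
  also have "\<dots> = (\<Sum>m<N. exp 2 * C ^ (m + 2))"
  proof -
    have "{2..N + 1} = {0 + 2..<N + 2}" by auto
    then show ?thesis by (simp only: sum.shift_bounds_nat_ivl atLeast0LessThan)
  qed
  also have "\<dots> = exp 2 * C\<^sup>2 * (\<Sum>m<N. C ^ m)"
    by (simp add: sum_distrib_left power2_eq_square algebra_simps)
  also have "\<dots> \<le> exp 2 * C\<^sup>2 * 2"
  proof (rule mult_left_mono)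
    have "(\<Sum>m<N. C ^ m) \<le> (\<Sum>m. C ^ m)"
      by (rule sum_le_suminf[OF \<open>summable _\<close>]) (use C in auto)
    also have "\<dots> \<le> 2" using C by (subst suminf_geometric) (auto simp: field_simps)
    finally show "(\<Sum>m<N. C ^ m) \<le> 2" .
  qed simp
  finally show ?thesis by (simp add: algebra_simps)
qed

text \<open>Schwarz's lemma on the disc of radius \<open>1/d\<close> turns the uniform bound into a Lipschitz estimate.\<close>

lemma sdet_Lipschitz:
  assumes X: "trace_bound X c" and D: "trace_bound D d" and d: "0 < d" "d < 1"
  shows "cmod (sdet N (1 + X + D) - sdet N (1 + X)) \<le> d * (2 * exp ((c + 1) + (c + 1)\<^sup>2 / 2) + 1)"
proof -
  define B where "B = exp ((c + 1) + (c + 1)\<^sup>2 / 2)"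
  define f where "f z = sdet N (1 + X + op_scale z D)" for z
  have c: "c \<ge> 0" by (rule trace_bound_nonneg[OF X])
  have bnd: "cmod (f z) \<le> B" if "cmod z \<le> 1 / d" for z
  proof -
    have "cmod z * d \<le> 1" using that d by (simp add: field_simps)
    then have "trace_bound (X + op_scale z D) (c + 1)"
      by (intro trace_bound_mono[OF trace_bound_add[OF X trace_bound_op_scale[OF D]]]) simp
    from sdet_bound[OF this, of N] show ?thesis by (simp add: f_def B_def add.assoc)
  qed
  have B: "B > 0" by (simp add: B_def)
  have hol: "f holomorphic_on S" for S
  proof -
    have "f = (\<lambda>z. \<Sum>p | p permutes {0..<N}. of_int (sign p) *
        (\<Prod>i = 0..<N. entry (1 + X) i (p i) + z * entry D i (p i)))"
      unfolding f_def sdet_def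
      by (rule ext, subst det_def'[of _ N]) (auto simp: permutes_below entry_simps intro!: sum.cong prod.cong)
    then show ?thesis by (auto intro!: holomorphic_intros)
  qed
  define b where "b = 2 * B + 1"
  have b: "b > 0" "2 * B < b" using B by (auto simp: b_def)
  define g where "g w = (f (w / of_real d) - f 0) / of_real b" for w :: complex
  have "cmod (g (of_real d)) \<le> cmod (of_real d)"
  proof (rule Schwarz_Lemma(1))
    show "g holomorphic_on ball 0 1"
    proof -
      have "(f \<circ> (\<lambda>w. w / of_real d)) holomorphic_on ball 0 1"
        using d by (intro holomorphic_on_compose hol holomorphic_intros) auto
      then show ?thesis using b unfolding g_def o_def
        by (intro holomorphic_intros) auto
    qed
    show "g 0 = 0" by (simp add: g_def)
    show "cmod (of_real d) < 1" using d by simp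
    fix z :: complex assume z: "cmod z < 1"
    have "cmod (f (z / d) - f 0) \<le> B + B"
      using z d by (intro order_trans[OF norm_triangle_ineq4] add_mono bnd) (auto simp: norm_divide divide_right_mono)
    then show "cmod (g z) < 1" using b by (simp add: g_def norm_divide)
  qed
  then have "cmod (f 1 - f 0) \<le> d * b"
    using d b by (simp add: g_def norm_divide field_simps)
  then show ?thesis by (simp add: f_def op_scale_one op_scale_zero b_def B_def)
qed

section \<open>The Fredholm determinant as a limit of finite sections\<close>

lemma sum_lists_below_prod:
  fixes g :: "nat \<Rightarrow> real"
  shows "(\<Sum>is\<in>lists_below N m. \<Prod>a<m. g (is ! a)) = (\<Sum>i<N. g i) ^ m"
proof (induction m)
  case 0
  have "lists_below N 0 = {[]}" by auto
  then show ?case by simp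
next
  case (Suc m)
  have "lists_below N (Suc m) = (\<lambda>(x, xs). x # xs) ` ({..<N} \<times> lists_below N m)"
    by (auto simp: length_Suc_conv image_iff)
  moreover have "inj_on (\<lambda>(x, xs). x # xs) ({..<N} \<times> lists_below N m)" by (auto simp: inj_on_def)
  ultimately have "(\<Sum>is\<in>lists_below N (Suc m). \<Prod>a<Suc m. g (is ! a))
      = (\<Sum>(x, xs)\<in>{..<N} \<times> lists_below N m. \<Prod>a<Suc m. g ((x # xs) ! a))"
    by (simp add: sum.reindex case_prod_unfold)
  also have "\<dots> = (\<Sum>(x, xs)\<in>{..<N} \<times> lists_below N m. g x * (\<Prod>a<m. g (xs ! a)))"
    by (intro sum.cong refl) (auto simp: prod.lessThan_Suc_shift simp del: prod.lessThan_Suc)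
  also have "\<dots> = (\<Sum>i<N. g i) * (\<Sum>is\<in>lists_below N m. \<Prod>a<m. g (is ! a))"
    by (simp add: sum_product sum.cartesian_product)
  finally show ?case using Suc by simp
qed

lemma minor_le:
  assumes b: "\<And>i j. cmod (k i j) \<le> \<alpha> i * \<beta> j" "\<And>i. 0 \<le> \<alpha> i" "\<And>j. 0 \<le> (\<beta> j :: real)"
    and len: "length is = m"
  shows "cmod (minor k is) \<le> fact m * (\<Prod>a<m. \<alpha> (is ! a) * \<beta> (is ! a))"
proof -
  have "minor k is = (\<Sum>p | p permutes {0..<m}. of_int (sign p) * (\<Prod>a = 0..<m. k (is ! a) (is ! p a)))"
    unfolding minor_def len by (subst det_def'[of _ m]) (auto simp: permutes_below intro!: sum.cong prod.cong)
  also have "cmod \<dots> \<le> (\<Sum>p | p permutes {0..<m}. \<Prod>a<m. \<alpha> (is ! a) * \<beta> (is ! a))"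
  proof (rule order_trans[OF norm_sum], rule sum_mono)
    fix p assume "p \<in> {p. p permutes {0..<m}}"
    then have p: "p permutes {0..<m}" by simp
    have "cmod (of_int (sign p) * (\<Prod>a = 0..<m. k (is ! a) (is ! p a)))
        = (\<Prod>a = 0..<m. cmod (k (is ! a) (is ! p a)))"
      by (auto simp: norm_mult prod_norm sign_def)
    also have "\<dots> \<le> (\<Prod>a = 0..<m. \<alpha> (is ! a) * \<beta> (is ! p a))"
      by (intro prod_mono) (auto simp: b)
    also have "\<dots> = (\<Prod>a = 0..<m. \<alpha> (is ! a)) * (\<Prod>a = 0..<m. \<beta> (is ! p a))" by (rule prod.distrib)
    also have "(\<Prod>a = 0..<m. \<beta> (is ! p a)) = (\<Prod>a = 0..<m. \<beta> (is ! a))"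
      using prod.permute[OF p, of "\<lambda>a. \<beta> (is ! a)"] by (simp add: o_def)
    finally show "cmod (of_int (sign p) * (\<Prod>a = 0..<m. k (is ! a) (is ! p a)))
        \<le> (\<Prod>a<m. \<alpha> (is ! a) * \<beta> (is ! a))"
      by (simp add: prod.distrib atLeast0LessThan)
  qed
  also have "\<dots> = fact m * (\<Prod>a<m. \<alpha> (is ! a) * \<beta> (is ! a))"
    by (simp add: card_permutations[of _ m])
  finally show ?thesis .
qed

text \<open>For each fixed order \<open>m\<close> the minors are absolutely summable, although this crude argument
  loses a factor \<open>m!\<close>; the summation over \<open>m\<close> relies on the sharper coefficient bound.\<close>

lemma minors_summable:
  assumes K: "trace_bound K C"
  shows "minor (entry K) summable_on {is. length is = m}"
proof -
  obtain \<alpha> \<beta> where b: "\<And>i j. cmod (entry K i j) \<le> \<alpha> i * \<beta> j" "\<And>i. 0 \<le> \<alpha> i" "\<And>j. 0 \<le> \<beta> j"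
    "\<And>N. (\<Sum>i<N. (\<alpha> i)\<^sup>2) \<le> C" "\<And>N. (\<Sum>j<N. (\<beta> j)\<^sup>2) \<le> C"
    using trace_bound_entry_bound[OF K] by blast
  have le: "(\<Sum>i<N. \<alpha> i * \<beta> i) \<le> C" for N
  proof -
    have "(\<Sum>i<N. \<alpha> i * \<beta> i) \<le> (\<Sum>i<N. ((\<alpha> i)\<^sup>2 + (\<beta> i)\<^sup>2) / 2)"
    proof (rule sum_mono)
      fix i
      show "\<alpha> i * \<beta> i \<le> ((\<alpha> i)\<^sup>2 + (\<beta> i)\<^sup>2) / 2" using sum_squares_bound[of "\<alpha> i" "\<beta> i"] by simp
    qed
    also have "\<dots> = ((\<Sum>i<N. (\<alpha> i)\<^sup>2) + (\<Sum>i<N. (\<beta> i)\<^sup>2)) / 2"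
      by (simp add: sum.distrib sum_divide_distrib[symmetric])
    also have "\<dots> \<le> C" using b(4)[of N] b(5)[of N] by simp
    finally show ?thesis .
  qed
  have fin: "(\<Sum>is\<in>F. cmod (minor (entry K) is)) \<le> fact m * C ^ m"
    if F: "finite F" "F \<subseteq> {is. length is = m}" for F
  proof -
    have "finite (\<Union>is\<in>F. set is)" using F by auto
    then obtain N where "(\<Union>is\<in>F. set is) \<subseteq> {..<N}" using finite_nat_bounded by (metis lessThan_def)
    then have "F \<subseteq> lists_below N m" using F by auto
    then have "(\<Sum>is\<in>F. cmod (minor (entry K) is)) \<le> (\<Sum>is\<in>lists_below N m. cmod (minor (entry K) is))"
      by (intro sum_mono2 finite_lists_below) auto
    also have "\<dots> \<le> (\<Sum>is\<in>lists_below N m. fact m * (\<Prod>a<m. \<alpha> (is ! a) * \<beta> (is ! a)))"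
      by (intro sum_mono minor_le b) auto
    also have "\<dots> = fact m * (\<Sum>i<N. \<alpha> i * \<beta> i) ^ m"
      by (simp add: sum_distrib_left[symmetric] sum_lists_below_prod[of "\<lambda>i. \<alpha> i * \<beta> i"])
    also have "\<dots> \<le> fact m * C ^ m"
      by (intro mult_left_mono power_mono le sum_nonneg mult_nonneg_nonneg b) auto
    finally show ?thesis .
  qed
  have "(\<lambda>is. cmod (minor (entry K) is)) summable_on {is. length is = m}"
    by (rule nonneg_bdd_above_summable_on) (auto intro!: bdd_aboveI2[where M="fact m * C ^ m"] fin)
  then show ?thesis by (rule abs_summable_summable)
qed

lemma det_coeff_tendsto:
  assumes K: "trace_bound K C"
  shows "(\<lambda>N. det_coeff K N m) \<longlonglongrightarrow> (\<Sum>\<^sub>\<infinity>is\<in>{is. length is = m}. minor (entry K) is) / fact m"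
proof -
  have "filterlim (\<lambda>N. lists_below N m) (finite_subsets_at_top {is. length is = m}) sequentially"
    unfolding filterlim_finite_subsets_at_top
  proof (intro allI impI)
    fix X :: "nat list set" assume X: "finite X \<and> X \<subseteq> {is. length is = m}"
    then have "finite (\<Union>is\<in>X. set is)" by auto
    then obtain N0 where "(\<Union>is\<in>X. set is) \<subseteq> {..<N0}" using finite_nat_bounded by (metis lessThan_def)
    then have "finite (lists_below N m) \<and> X \<subseteq> lists_below N m \<and> lists_below N m \<subseteq> {is. length is = m}"
      if "N \<ge> N0" for N
      using X that finite_lists_below[of N m] by fastforce
    then show "\<forall>\<^sub>F N in sequentially. finite (lists_below N m) \<and> X \<subseteq> lists_below N m \<and>
        lists_below N m \<subseteq> {is. length is = m}"
      by (auto simp: eventually_sequentially)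
  qed
  moreover have "(sum (minor (entry K)) \<longlongrightarrow> (\<Sum>\<^sub>\<infinity>is\<in>{is. length is = m}. minor (entry K) is))
      (finite_subsets_at_top {is. length is = m})"
    using has_sum_infsum[OF minors_summable[OF K, of m]] by (simp add: has_sum_def)
  ultimately have "(\<lambda>N. \<Sum>is\<in>lists_below N m. minor (entry K) is)
      \<longlonglongrightarrow> (\<Sum>\<^sub>\<infinity>is\<in>{is. length is = m}. minor (entry K) is)"
    by (rule filterlim_compose[rotated])
  then show ?thesis unfolding det_coeff_def by (intro tendsto_divide) auto
qed

lemma sdet_sum: "sdet N (1 + K) = (\<Sum>m\<le>N. det_coeff K N m)"
  using sdet_expansion[of N 1 K] by (simp add: op_scale_one)

text \<open>Cauchy's estimate with radius \<open>2\<close> supplies a geometric majorant that is uniform in \<open>N\<close>, so the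
  series may be summed after passing to the limit in each term.\<close>

theorem sdet_tendsto_fredholm_det:
  assumes K: "trace_bound K C"
  shows "(\<lambda>N. sdet N (1 + K)) \<longlonglongrightarrow> fredholm_det (1 + K)"
proof -
  define B where "B = exp (2 * C + (2 * C)\<^sup>2 / 2)"
  define b where "b m = (\<Sum>\<^sub>\<infinity>is\<in>{is. length is = m}. minor (entry K) is) / fact m" for m
  have "(\<lambda>N. suminf (\<lambda>m. det_coeff K N m)) \<longlonglongrightarrow> suminf b"
  proof (rule tannerys_theorem[THEN conjunct2, THEN conjunct2])
    show "(\<lambda>N. det_coeff K N m) \<longlonglongrightarrow> b m" for m
      unfolding b_def by (rule det_coeff_tendsto[OF K])
    show "\<forall>\<^sub>F (m, N) in at_top \<times>\<^sub>F sequentially. norm (det_coeff K N m) \<le> B * (1 / 2) ^ m"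
      using det_coeff_bound[OF K, of 2]
      by (intro always_eventually) (auto simp: B_def power_divide)
    show "summable (\<lambda>m. B * (1 / 2) ^ m)" by (intro summable_mult summable_geometric) auto
  qed simp
  moreover have "suminf (\<lambda>m. det_coeff K N m) = sdet N (1 + K)" for N
    unfolding sdet_sum by (rule suminf_finite) (auto intro: det_coeff_eq_0)
  moreover have "suminf b = fredholm_det (1 + K)"
    unfolding fredholm_det_def b_def by (intro suminf_cong arg_cong2[where f="(/)"] infsum_cong refl) (auto simp: minor_def)
  ultimately show ?thesis by simp
qed

lemma fredholm_det_eqI:
  assumes K: "trace_bound K C" and "\<And>N. N \<ge> M \<Longrightarrow> sdet N (1 + K) = d"
  shows "fredholm_det (1 + K) = d"
proof (rule LIMSEQ_unique[OF sdet_tendsto_fredholm_det[OF K]])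
  show "(\<lambda>N. sdet N (1 + K)) \<longlonglongrightarrow> d"
    by (rule tendsto_eventually) (use assms(2) in \<open>auto simp: eventually_sequentially\<close>)
qed

lemma sdet_uniformly_continuous:
  assumes e: "e > 0"
  shows "\<exists>d>0. \<forall>X D N. trace_bound X c \<longrightarrow> trace_bound D d \<longrightarrow> cmod (sdet N (1 + X + D) - sdet N (1 + X)) \<le> e"
proof -
  define B where "B = 2 * exp ((c + 1) + (c + 1)\<^sup>2 / 2) + 1"
  have B: "B > 0" by (simp add: B_def add_pos_pos)
  define d where "d = min (1/2) (e / B)"
  have d: "0 < d" "d < 1" using e B by (auto simp: d_def)
  have "d * B \<le> e / B * B" using B by (intro mult_right_mono) (auto simp: d_def)
  then have dB: "d * B \<le> e" using B by simp
  show ?thesis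
  proof (intro exI[of _ d] conjI allI impI)
    fix X D N assume X: "trace_bound X c" and D: "trace_bound D d"
    have "cmod (sdet N (1 + X + D) - sdet N (1 + X)) \<le> d * B"
      using sdet_Lipschitz[OF X D d, of N] by (simp only: B_def)
    then show "cmod (sdet N (1 + X + D) - sdet N (1 + X)) \<le> e" using dB by linarith
  qed (rule d)
qed

lemma fredholm_det_diff_tendsto:
  assumes X: "\<forall>\<^sub>F n in sequentially. trace_bound (X n) c" and D: "trace_tendsto D 0"
  shows "(\<lambda>n. fredholm_det (1 + X n + D n) - fredholm_det (1 + X n)) \<longlonglongrightarrow> 0"
proof (rule LIMSEQ_I)
  fix e :: real assume e: "e > 0"
  then obtain d where d: "d > 0" "\<And>X D N. trace_bound X c \<Longrightarrow> trace_bound D d \<Longrightarrow>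
      cmod (sdet N (1 + X + D) - sdet N (1 + X)) \<le> e / 2"
    using sdet_uniformly_continuous[of "e / 2" c] by auto
  have "\<forall>\<^sub>F n in sequentially. trace_bound (D n) d" using D d by (simp add: trace_tendsto_def)
  with X have "\<forall>\<^sub>F n in sequentially. norm (fredholm_det (1 + X n + D n) - fredholm_det (1 + X n)) < e"
  proof eventually_elim
    case (elim n)
    have "(\<lambda>N. sdet N (1 + X n + D n) - sdet N (1 + X n))
        \<longlonglongrightarrow> fredholm_det (1 + X n + D n) - fredholm_det (1 + X n)"
      using sdet_tendsto_fredholm_det[OF trace_bound_add[OF elim]] sdet_tendsto_fredholm_det[OF elim(1)]
      by (intro tendsto_diff) (simp_all add: add.assoc)
    then have "norm (fredholm_det (1 + X n + D n) - fredholm_det (1 + X n)) \<le> e / 2"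
      by (rule LIMSEQ_le_const2[OF tendsto_norm]) (intro exI allI impI d(2)[OF elim])
    then show ?case using e by simp
  qed
  then show "\<exists>M. \<forall>n\<ge>M. norm (fredholm_det (1 + X n + D n) - fredholm_det (1 + X n) - 0) < e"
    by (simp add: eventually_sequentially)
qed

lemma fredholm_det_trace_tendsto:
  assumes K: "trace_tendsto K L" and L: "trace_bound L C"
  shows "(\<lambda>n. fredholm_det (1 + K n)) \<longlonglongrightarrow> fredholm_det (1 + L)"
proof -
  have "trace_tendsto (\<lambda>n. K n - L) 0" using K by (simp add: trace_tendsto_def)
  then have "(\<lambda>n. fredholm_det (1 + L + (K n - L)) - fredholm_det (1 + L)) \<longlonglongrightarrow> 0"
    by (intro fredholm_det_diff_tendsto[where X="\<lambda>_. L"]) (use L in auto)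
  then show ?thesis by (simp add: LIM_zero_iff)
qed

lemma entry_Pn: "entry (Pn N) i j = (if i = j \<and> i < N then 1 else 0)"
  using entry_Pn_left[of N 1 i j] by (simp add: entry_one)

text \<open>The section of a product differs from the product of the sections by a term containing
  \<open>(I - P\<^sub>N) Y\<close>, which tends to zero in trace norm.\<close>

theorem fredholm_det_mult:
  assumes X: "trace_bound X c" and Y: "trace_bound Y d"
  shows "fredholm_det ((1 + X) * (1 + Y)) = fredholm_det (1 + X) * fredholm_det (1 + Y)"
proof -
  let ?Z = "\<lambda>N. X + Y + X * Pn N * Y"
  have eq: "(1 + X) * (1 + Y) = 1 + (X + Y + X * Y)" by (simp add: algebra_simps)
  have XY: "trace_bound (X + Y + X * Y) (c + d + norm X * d)" by (intro trace_bound_add X Y trace_bound_mult_left)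
  have Z: "trace_bound (?Z N) (c + d + norm X * d)" for N
  proof (intro trace_bound_add X Y)
    have "norm (X * Pn N) \<le> norm X * norm (Pn N)" by (rule norm_mult_ineq)
    also have "\<dots> \<le> norm X" by (intro mult_left_le norm_proj_op_le) simp
    finally show "trace_bound (X * Pn N * Y) (norm X * d)"
      by (intro trace_bound_mono[OF trace_bound_mult_left[OF Y]] mult_right_mono trace_bound_nonneg[OF Y])
  qed
  have "trace_tendsto (\<lambda>N. X * ((1 - Pn N) * Y)) (X * 0)"
    by (rule trace_tendsto_mult_left[where Y="\<lambda>_. X" and C=0])
      (use trace_bound_tail_left[OF Y] in \<open>auto simp: trace_tendsto_def trace_bound_zero\<close>)
  then have D: "trace_tendsto (\<lambda>N. X * ((1 - Pn N) * Y)) 0" by simp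
  have sd: "(\<lambda>N. sdet N ((1 + X) * (1 + Y))) \<longlonglongrightarrow> fredholm_det ((1 + X) * (1 + Y))"
    unfolding eq by (rule sdet_tendsto_fredholm_det[OF XY])
  have prod: "sdet N (1 + ?Z N) = sdet N (1 + X) * sdet N (1 + Y)" for N
    unfolding sdet_mult[symmetric]
    by (rule sdet_cong) (simp add: algebra_simps entry_simps entry_Pn_left entry_Pn_right entry_Pn entry_one)
  have "(\<lambda>N. sdet N ((1 + X) * (1 + Y)) - sdet N (1 + ?Z N)) \<longlonglongrightarrow> 0"
  proof (rule LIMSEQ_I)
    fix e :: real assume e: "e > 0"
    then obtain r where r: "r > 0" "\<And>K D N. trace_bound K (c + d + norm X * d) \<Longrightarrow> trace_bound D r \<Longrightarrow>
        cmod (sdet N (1 + K + D) - sdet N (1 + K)) \<le> e / 2"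
      using sdet_uniformly_continuous[of "e / 2" "c + d + norm X * d"] by auto
    have "\<forall>\<^sub>F N in sequentially. trace_bound (X * ((1 - Pn N) * Y)) r" using D r by (simp add: trace_tendsto_def)
    then have "\<forall>\<^sub>F N in sequentially. norm (sdet N ((1 + X) * (1 + Y)) - sdet N (1 + ?Z N)) < e"
    proof eventually_elim
      case (elim N)
      have "(1 + X) * (1 + Y) = 1 + ?Z N + X * ((1 - Pn N) * Y)" by (simp add: algebra_simps)
      then have "norm (sdet N ((1 + X) * (1 + Y)) - sdet N (1 + ?Z N)) \<le> e / 2"
        using r(2)[OF Z elim, of N] by metis
      then show ?case using e by simp
    qed
    then show "\<exists>M. \<forall>N\<ge>M. norm (sdet N ((1 + X) * (1 + Y)) - sdet N (1 + ?Z N) - 0) < e"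
      by (simp add: eventually_sequentially)
  qed
  from tendsto_diff[OF sd this] have "(\<lambda>N. sdet N (1 + X) * sdet N (1 + Y)) \<longlonglongrightarrow> fredholm_det ((1 + X) * (1 + Y))"
    by (simp add: prod)
  moreover have "(\<lambda>N. sdet N (1 + X) * sdet N (1 + Y)) \<longlonglongrightarrow> fredholm_det (1 + X) * fredholm_det (1 + Y)"
    by (intro tendsto_mult sdet_tendsto_fredholm_det[OF X] sdet_tendsto_fredholm_det[OF Y])
  ultimately show ?thesis by (rule LIMSEQ_unique)
qed

lemma minor_zero_index:
  assumes z: "(\<forall>j. k i j = 0) \<or> (\<forall>j. k j i = 0)" and i: "i \<in> set is"
  shows "minor k is = 0"
proof -
  let ?m = "length is"
  obtain a where a: "a < ?m" "is ! a = i" using i by (auto simp: in_set_conv_nth)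
  have "(\<Prod>b = 0..<?m. k (is ! b) (is ! p b)) = 0" if p: "p permutes {0..<?m}" for p
  proof -
    obtain b where b: "b < ?m" "p b = a"
      using permutes_image[OF p] a(1) by (metis (no_types, lifting) atLeast0LessThan imageE lessThan_iff)
    then show ?thesis using z a b by (auto intro: bexI[of _ a] bexI[of _ b])
  qed
  then show ?thesis unfolding minor_def
    by (subst det_def'[of _ ?m]) (auto simp: permutes_below intro!: sum.neutral)
qed

text \<open>A minor that uses a vanishing row or column is zero, so Fredholm's series reduces to indices below
  \<open>M\<close>.\<close>

lemma fredholm_det_section:
  assumes K: "trace_bound K C" and z: "Pn M * K = K \<or> K * Pn M = K"
  shows "fredholm_det (1 + K) = sdet M (1 + K)"
proof (rule fredholm_det_eqI[OF K])
  fix N assume N: "N \<ge> M"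
  have zero: "(\<forall>j. entry K i j = 0) \<or> (\<forall>j. entry K j i = 0)" if "i \<ge> M" for i
    using z that by (metis entry_Pn_left entry_Pn_right not_less)
  have "det_coeff K N m = det_coeff K M m" for m
    unfolding det_coeff_def
  proof (intro arg_cong2[where f="(/)"] refl sum.mono_neutral_right finite_lists_below ballI)
    fix "is" assume "is \<in> lists_below N m - lists_below M m"
    then obtain i where "i \<in> set is" "i \<ge> M" by (auto simp: subset_iff not_less)
    then show "minor (entry K) is = 0" using minor_zero_index[of "entry K" i "is"] zero[of i] by blast
  qed (use N in auto)
  then have "sdet N (1 + K) = (\<Sum>m\<le>N. det_coeff K M m)" by (simp add: sdet_sum)
  also have "\<dots> = (\<Sum>m\<le>M. det_coeff K M m)"
    by (rule sum.mono_neutral_right) (use N det_coeff_eq_0 in auto)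
  finally show "sdet N (1 + K) = sdet M (1 + K)" by (simp add: sdet_sum)
qed

text \<open>Both sides are the determinant of the block matrix with rows \<open>(1, -A)\<close> and \<open>(B, 1)\<close>.\<close>

lemma det_one_plus_commute:
  fixes A B :: "complex mat"
  assumes A: "A \<in> carrier_mat n n" and B: "B \<in> carrier_mat n n"
  shows "det (1\<^sub>m n + A * B) = det (1\<^sub>m n + B * A)"
proof -
  let ?M = "four_block_mat (1\<^sub>m n) (- A) B (1\<^sub>m n)"
  let ?U = "four_block_mat (1\<^sub>m n) A (0\<^sub>m n n) (1\<^sub>m n)"
  have "det ?M = det (1\<^sub>m n * 1\<^sub>m n - (- A) * B)"
    by (rule det_four_block_mat) (use A B in auto)
  also have "1\<^sub>m n * 1\<^sub>m n - (- A) * B = 1\<^sub>m n + A * B"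
    using A B by (intro eq_matI) auto
  finally have 1: "det ?M = det (1\<^sub>m n + A * B)" .
  have "?M * ?U = four_block_mat (1\<^sub>m n) (0\<^sub>m n n) B (1\<^sub>m n + B * A)"
    by (subst mult_four_block_mat[of _ n n _ n _ n]) (use A B in \<open>auto intro!: arg_cong2[where f="four_block_mat _ _"] eq_matI simp: comm_add_mat[of _ n n]\<close>)
  then have "det (?M * ?U) = det (1\<^sub>m n) * det (1\<^sub>m n + B * A)"
    using det_four_block_mat_upper_right_zero[of "1\<^sub>m n" n "0\<^sub>m n n" n B "1\<^sub>m n + B * A"] A B by auto
  moreover have "det (?M * ?U) = det ?M * det ?U"
    by (rule det_mult[of _ "n + n"]) (use A B in auto)
  moreover have "det ?U = 1"
    using det_four_block_mat_lower_left_zero[of "1\<^sub>m n" n A n "0\<^sub>m n n" "1\<^sub>m n"] A by auto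
  ultimately show ?thesis using 1 by simp
qed

lemma sdet_one_plus_commute: "sdet N (1 + X * Pn N * Y) = sdet N (1 + Y * Pn N * X)"
proof -
  let ?A = "\<lambda>X. mat N N (\<lambda>(i, j). entry X i j)"
  have "mat N N (\<lambda>(i, j). entry (1 + X * Pn N * Y) i j) = 1\<^sub>m N + ?A X * ?A Y" for X Y
    by (intro eq_matI) (auto simp: entry_simps entry_one entry_Pn_mult scalar_prod_def atLeast0LessThan)
  then show ?thesis unfolding sdet_def by (simp add: det_one_plus_commute)
qed

lemma trace_tendsto_sections:
  assumes Z: "trace_bound Z C"
  shows "trace_tendsto (\<lambda>M. Pn M * Z * Pn M) Z"
  unfolding trace_tendsto_def
proof (intro allI impI)
  fix e :: real assume "e > 0"
  then have "\<forall>\<^sub>F M in sequentially. trace_bound ((1 - Pn M) * Z) (e / 2)" "\<forall>\<^sub>F M in sequentially. trace_bound (Z * (1 - Pn M)) (e / 2)"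
    using trace_bound_tail_left[OF Z, of "e / 2"] trace_bound_tail_right[OF Z, of "e / 2"] by auto
  then show "\<forall>\<^sub>F M in sequentially. trace_bound (Pn M * Z * Pn M - Z) e"
  proof eventually_elim
    case (elim M)
    have "trace_bound (Pn M * (Z * (1 - Pn M))) (norm (Pn M) * (e / 2))" by (rule trace_bound_mult_left[OF elim(2)])
    then have "trace_bound (Pn M * (Z * (1 - Pn M))) (1 * (e / 2))"
      by (rule trace_bound_mono) (intro mult_right_mono norm_proj_op_le trace_bound_nonneg[OF elim(1)])
    from trace_bound_uminus[OF trace_bound_add[OF elim(1) this]] show ?case by (simp add: algebra_simps)
  qed
qed

text \<open>For a finite section \<open>Z\<close> both sides are determinants of the same size, since \<open>Z W\<close> has
  finitely many nonzero rows and \<open>W Z\<close> finitely many nonzero columns. The general case follows by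
  continuity.\<close>

theorem fredholm_det_commute:
  assumes Z: "trace_bound Z C"
  shows "fredholm_det (1 + Z * W) = fredholm_det (1 + W * Z)"
proof -
  define Y where "Y M = Pn M * Z * Pn M" for M
  have lim: "trace_tendsto Y Z" unfolding Y_def by (rule trace_tendsto_sections[OF Z])
  have Y: "\<exists>c. trace_bound (Y M) c" for M unfolding Y_def using trace_bound_mult_right[OF trace_bound_mult_left[OF Z]] by blast
  have PP: "Pn M * (Pn M * A) = Pn M * A" for M A by (simp flip: mult.assoc)
  have eq: "fredholm_det (1 + Y M * W) = fredholm_det (1 + W * Y M)" for M
  proof -
    obtain c where c: "trace_bound (Y M) c" using Y by blast
    have "fredholm_det (1 + Y M * W) = sdet M (1 + Y M * W)"
      by (rule fredholm_det_section[OF trace_bound_mult_right[OF c]]) (simp add: Y_def mult.assoc PP)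
    also have "\<dots> = sdet M (1 + Y M * Pn M * W)" by (simp add: Y_def mult.assoc PP)
    also have "\<dots> = sdet M (1 + W * Pn M * Y M)" by (rule sdet_one_plus_commute)
    also have "\<dots> = sdet M (1 + W * Y M)" by (simp add: Y_def mult.assoc PP)
    also have "\<dots> = fredholm_det (1 + W * Y M)"
      by (rule fredholm_det_section[OF trace_bound_mult_left[OF c], symmetric]) (simp add: Y_def mult.assoc PP)
    finally show ?thesis .
  qed
  have "(\<lambda>M. fredholm_det (1 + Y M * W)) \<longlonglongrightarrow> fredholm_det (1 + Z * W)"
    by (rule fredholm_det_trace_tendsto[OF trace_tendsto_mult_right[OF lim Z tendsto_const] trace_bound_mult_right[OF Z]])
  moreover have "(\<lambda>M. fredholm_det (1 + W * Y M)) \<longlonglongrightarrow> fredholm_det (1 + W * Z)"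
    by (rule fredholm_det_trace_tendsto[OF trace_tendsto_mult_left[OF lim Z tendsto_const] trace_bound_mult_left[OF Z]])
  ultimately show ?thesis unfolding eq by (rule LIMSEQ_unique)
qed

lemma fredholm_det_similar:
  assumes "trace_bound K C" and "V' * V = 1"
  shows "fredholm_det (1 + V * K * V') = fredholm_det (1 + K)"
  using fredholm_det_commute[OF trace_bound_mult_left[OF assms(1), of V], of V'] assms(2)
  by (simp flip: mult.assoc)

section \<open>Determinants of products of exponentials\<close>

lemma trace_bound_suminf:
  assumes f: "summable f" and b: "summable b" and fb: "\<And>k. trace_bound (f k) (b k)"
  shows "trace_bound (suminf f) (suminf b)"
proof (rule trace_bound_limit)
  show "(\<lambda>n. entry (\<Sum>k<n. f k) i j) \<longlonglongrightarrow> entry (suminf f) i j" for i j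
    by (intro tendsto_entry summable_LIMSEQ f)
  show "trace_bound (\<Sum>k<n. f k) (suminf b)" for n
    by (rule trace_bound_mono[OF trace_bound_sum sum_le_suminf[OF b]]) (use fb trace_bound_nonneg in auto)
qed

lemma trace_bound_power_diff:
  assumes Y: "trace_bound (X - D) c" and a: "norm X \<le> a" "norm D \<le> a"
  shows "trace_bound (X ^ Suc k - D ^ Suc k) (real (Suc k) * a ^ k * c)"
proof (induction k)
  case (Suc k)
  have a0: "a \<ge> 0" using a(1) norm_ge_zero order_trans by blast
  have "X ^ Suc (Suc k) - D ^ Suc (Suc k) = X * (X ^ Suc k - D ^ Suc k) + (X - D) * D ^ Suc k"
    by (simp add: algebra_simps)
  moreover have "trace_bound \<dots> (norm X * (real (Suc k) * a ^ k * c) + norm (D ^ Suc k) * c)"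
    by (intro trace_bound_add trace_bound_mult_left[OF Suc] trace_bound_mult_right[OF Y])
  moreover have "norm (D ^ Suc k) * c \<le> a ^ Suc k * c"
    by (intro mult_right_mono trace_bound_nonneg[OF Y] order_trans[OF norm_power_ineq] power_mono a) simp
  moreover have "norm X * (real (Suc k) * a ^ k * c) \<le> a * (real (Suc k) * a ^ k * c)"
    using a0 trace_bound_nonneg[OF Y] by (intro mult_right_mono a) auto
  ultimately show ?case by (auto elim!: trace_bound_mono simp: algebra_simps)
qed (use Y in simp)

text \<open>The terms of order at least two in the exponential series; they carry the factor \<open>t\<^sup>2\<close>.\<close>

lemma trace_bound_exp_diff:
  fixes X D :: "nat l2op"
  assumes Y: "trace_bound (X - D) c" and a: "norm X \<le> a" "norm D \<le> a" and t: "\<bar>t\<bar> \<le> 1"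
  shows "trace_bound (exp (t *\<^sub>R X) - exp (t *\<^sub>R D) - t *\<^sub>R (X - D)) (t\<^sup>2 * (a * c * exp a))"
proof -
  have a0: "a \<ge> 0" using a(1) norm_ge_zero order_trans by blast
  have c0: "c \<ge> 0" by (rule trace_bound_nonneg[OF Y])
  define f where "f k = (t *\<^sub>R X) ^ k /\<^sub>R fact k - (t *\<^sub>R D) ^ k /\<^sub>R fact k" for k
  have "f sums (exp (t *\<^sub>R X) - exp (t *\<^sub>R D))"
    unfolding f_def by (intro sums_diff exp_converges)
  then have sf: "summable f" "suminf f = exp (t *\<^sub>R X) - exp (t *\<^sub>R D)"
    by (auto simp: sums_iff)
  have f0: "f 0 = 0" and f1: "f (Suc 0) = t *\<^sub>R (X - D)" by (simp_all add: f_def algebra_simps)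
  have sf2: "summable (\<lambda>k. f (Suc (Suc k)))" using sf(1) summable_Suc_iff[of f] summable_Suc_iff[of "\<lambda>k. f (Suc k)"] by simp
  have "suminf f = f 0 + (f (Suc 0) + (\<Sum>k. f (Suc (Suc k))))"
    using suminf_split_head[OF sf(1)] suminf_split_head[of "\<lambda>k. f (Suc k)"] sf(1) summable_Suc_iff[of f] by simp
  then have eq: "exp (t *\<^sub>R X) - exp (t *\<^sub>R D) - t *\<^sub>R (X - D) = (\<Sum>k. f (Suc (Suc k)))"
    by (simp add: sf f0 f1)
  have bnd: "trace_bound (f (Suc (Suc k))) (t\<^sup>2 * a * c * (a ^ k /\<^sub>R fact k))" for k
  proof -
    have "f (Suc (Suc k)) = (t ^ Suc (Suc k) / fact (Suc (Suc k))) *\<^sub>R (X ^ Suc (Suc k) - D ^ Suc (Suc k))"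
      unfolding f_def scaleR_power scaleR_scaleR by (simp add: scaleR_diff_right divide_inverse mult.commute)
    moreover have "trace_bound \<dots> (\<bar>t ^ Suc (Suc k) / fact (Suc (Suc k))\<bar> * (real (Suc (Suc k)) * a ^ Suc k * c))"
      by (intro trace_bound_scaleR trace_bound_power_diff Y a)
    moreover have "\<bar>t ^ Suc (Suc k) / fact (Suc (Suc k))\<bar> * (real (Suc (Suc k)) * a ^ Suc k * c)
        \<le> t\<^sup>2 * a * c * (a ^ k /\<^sub>R fact k)"
    proof -
      have "\<bar>t ^ Suc (Suc k) / fact (Suc (Suc k))\<bar> * (real (Suc (Suc k)) * a ^ Suc k * c)
          = \<bar>t\<bar> ^ k * t\<^sup>2 * (a ^ Suc k * c) / fact (Suc k)"
        by (simp add: abs_mult power_abs power2_eq_square fact_Suc[of "Suc k"] del: fact_Suc)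
      also have "\<dots> \<le> 1 * t\<^sup>2 * (a ^ Suc k * c) / fact (Suc k)"
        using a0 c0 t by (intro divide_right_mono mult_right_mono) (auto simp: power_le_one)
      also have "\<dots> \<le> 1 * t\<^sup>2 * (a ^ Suc k * c) / fact k"
        using a0 c0 by (intro divide_left_mono) (auto simp: fact_mono)
      finally show ?thesis by (simp add: divide_inverse algebra_simps)
    qed
    ultimately show ?thesis by (auto elim: trace_bound_mono)
  qed
  have "(\<lambda>k. t\<^sup>2 * a * c * (a ^ k /\<^sub>R fact k)) sums (t\<^sup>2 * a * c * exp a)"
    by (intro sums_mult exp_converges)
  then show ?thesis
    unfolding eq using trace_bound_suminf[OF sf2 _ bnd] by (auto simp: sums_iff mult.assoc)
qed

text \<open>The function \<open>F(t) = det (exp (tX) exp (-tD))\<close> is multiplicative in \<open>t\<close> by invariance under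
  similarity, and its derivative at \<open>0\<close> is the trace of \<open>X - D\<close>; hence it is an exponential.
  While \<open>X - D\<close> is of trace class, \<open>X\<close> and \<open>D\<close> are merely bounded operators.\<close>

lemma fredholm_det_exp_exp:
  fixes X D :: "nat l2op"
  assumes Y: "trace_bound (X - D) c" and tr: "(\<lambda>N. \<Sum>i<N. entry (X - D) i i) \<longlonglongrightarrow> \<tau>"
  shows "\<exists>C. trace_bound (exp X * exp (- D) - 1) C" and "fredholm_det (exp X * exp (- D)) = exp \<tau>"
proof -
  define a where "a = max (norm X) (norm D)"
  have a: "norm X \<le> a" "norm D \<le> a" by (auto simp: a_def)
  have c0: "c \<ge> 0" by (rule trace_bound_nonneg[OF Y])
  define V where "V t = exp (- (t *\<^sub>R D))" for t
  define F where "F t = fredholm_det (exp (t *\<^sub>R X) * V t)" for t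
  define W where "W t = exp (t *\<^sub>R X) * V t - 1" for t
  define E where "E t = exp (t *\<^sub>R X) - exp (t *\<^sub>R D) - t *\<^sub>R (X - D)" for t
  define Rm where "Rm t = t *\<^sub>R ((X - D) * (V t - 1)) + E t * V t" for t
  define r where "r t = norm (V t - 1) * c + norm (V t) * (\<bar>t\<bar> * (a * c * exp a))" for t
  have FW: "F t = fredholm_det (1 + W t)" for t by (simp add: F_def W_def)
  have expV: "exp (t *\<^sub>R D) * V t = 1" for t unfolding V_def by (rule exp_minus_inverse)
  have "W t = (exp (t *\<^sub>R X) - exp (t *\<^sub>R D)) * V t" for t
    by (simp add: W_def left_diff_distrib expV)
  then have WR: "W t = t *\<^sub>R (X - D) + Rm t" for t
    by (simp add: Rm_def E_def algebra_simps)
  have Rm_small: "trace_bound (Rm t) (\<bar>t\<bar> * r t)" if t: "\<bar>t\<bar> \<le> 1" for t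
  proof -
    have "trace_bound (Rm t) (\<bar>t\<bar> * (norm (V t - 1) * c) + norm (V t) * (t\<^sup>2 * (a * c * exp a)))"
      unfolding Rm_def E_def by (intro trace_bound_add trace_bound_scaleR trace_bound_mult_right Y trace_bound_exp_diff a t)
    moreover have "\<bar>t\<bar> * (norm (V t - 1) * c) + norm (V t) * (t\<^sup>2 * (a * c * exp a)) = \<bar>t\<bar> * r t"
      by (simp add: r_def algebra_simps power2_eq_square[of "t"] abs_mult_self_eq[symmetric, of t] del: abs_mult_self_eq)
    ultimately show ?thesis by simp
  qed
  have Wsmall: "trace_bound (W t) (\<bar>t\<bar> * (c + r t))" if "\<bar>t\<bar> \<le> 1" for t
    unfolding WR distrib_left by (intro trace_bound_add trace_bound_scaleR Y Rm_small that)
  have trW: "\<exists>C. trace_bound (W t) C" for t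
  proof -
    (* write t X = s (n X) with small s, to apply the estimate for parameters at most one *)
    obtain m :: nat where m: "\<bar>t\<bar> \<le> real m" using real_arch_simple by blast
    define n where "n = Suc m"
    have n: "\<bar>t\<bar> \<le> real n" "n > 0" using m by (auto simp: n_def)
    let ?X = "real n *\<^sub>R X" and ?D = "real n *\<^sub>R D" and ?s = "t / real n"
    have s: "\<bar>?s\<bar> \<le> 1" using n by simp
    have Y': "trace_bound (?X - ?D) (\<bar>real n\<bar> * c)" using trace_bound_scaleR[OF Y, of "real n"] by (simp add: scaleR_diff_right)
    have aa: "norm ?X \<le> real n * a" "norm ?D \<le> real n * a" using a by (auto intro: mult_left_mono)
    have e: "t *\<^sub>R A = ?s *\<^sub>R (real n *\<^sub>R A)" for A :: "nat l2op" using n by simp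
    have "\<exists>C. trace_bound (exp (t *\<^sub>R X) - exp (t *\<^sub>R D)) C"
      using trace_bound_add[OF trace_bound_exp_diff[OF Y' aa s] trace_bound_scaleR[OF Y', of ?s]] unfolding e[symmetric] by auto
    then obtain C where "trace_bound (exp (t *\<^sub>R X) - exp (t *\<^sub>R D)) C" by blast
    from trace_bound_mult_right[OF this, of "V t"] show ?thesis
      by (auto simp: W_def left_diff_distrib expV)
  qed
  have Fadd: "F (s + t) = F s * F t" for s t
  proof -
    obtain C C' where C: "trace_bound (W s) C" "trace_bound (W t) C'" using trW by blast
    have inv: "exp (- (s *\<^sub>R X)) * exp (s *\<^sub>R X) = 1"
      using exp_minus_inverse[of "- (s *\<^sub>R X)"] by simp
    have "exp ((s + t) *\<^sub>R X) = exp (s *\<^sub>R X) * exp (t *\<^sub>R X)"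
      unfolding scaleR_add_left by (rule exp_add_commuting) simp
    moreover have "V (s + t) = V t * V s"
      unfolding V_def scaleR_add_left minus_add_distrib
      by (subst add.commute) (rule exp_add_commuting, simp)
    ultimately have "exp ((s + t) *\<^sub>R X) * V (s + t) = exp (s *\<^sub>R X) * (1 + W t) * V s"
      by (simp add: W_def mult.assoc)
    also have "\<dots> = (exp (s *\<^sub>R X) * (1 + W t) * exp (- (s *\<^sub>R X))) * (exp (s *\<^sub>R X) * V s)"
      by (simp add: mult.assoc) (simp add: mult.assoc[symmetric] inv)
    also have "exp (s *\<^sub>R X) * V s = 1 + W s" by (simp add: W_def)
    also have "exp (s *\<^sub>R X) * (1 + W t) * exp (- (s *\<^sub>R X)) = 1 + exp (s *\<^sub>R X) * W t * exp (- (s *\<^sub>R X))"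
      by (simp add: distrib_left distrib_right exp_minus_inverse)
    finally have "F (s + t) = fredholm_det ((1 + exp (s *\<^sub>R X) * W t * exp (- (s *\<^sub>R X))) * (1 + W s))"
      by (simp add: F_def)
    also have "\<dots> = fredholm_det (1 + exp (s *\<^sub>R X) * W t * exp (- (s *\<^sub>R X))) * fredholm_det (1 + W s)"
      by (rule fredholm_det_mult[OF trace_bound_mult_right[OF trace_bound_mult_left[OF C(2)]] C(1)])
    also have "fredholm_det (1 + exp (s *\<^sub>R X) * W t * exp (- (s *\<^sub>R X))) = fredholm_det (1 + W t)"
      by (rule fredholm_det_similar[OF C(2) inv])
    finally show ?thesis by (simp add: FW)
  qed
  have F0: "F 0 = 1"
  proof -
    have "F 0 = fredholm_det (1 + (0 :: nat l2op))" by (simp add: F_def V_def)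
    also have "\<dots> = sdet 0 (1 + 0)" by (rule fredholm_det_section[OF trace_bound_zero]) simp
    finally show ?thesis by (simp add: sdet_def)
  qed
  have first: "cmod (F t - 1 - t *\<^sub>R \<tau>) \<le> \<bar>t\<bar> * (2 * exp 2 * \<bar>t\<bar> * (c + r t + 1)\<^sup>2 + r t)"
    if t: "t \<noteq> 0" "\<bar>t\<bar> \<le> 1" "\<bar>t\<bar> * (c + r t + 1) \<le> 1/2" for t
  proof -
    have r0: "r t \<ge> 0" using c0 a(1) norm_ge_zero order_trans unfolding r_def
      by (smt (verit) abs_ge_zero exp_ge_zero mult_nonneg_nonneg norm_ge_zero)
    let ?C = "\<bar>t\<bar> * (c + r t + 1)"
    have C: "trace_bound (W t) ?C" "0 < ?C" "?C \<le> 1/2"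
      using t c0 r0 by (auto intro!: trace_bound_mono[OF Wsmall] mult_left_mono mult_pos_pos add_nonneg_pos)
    have "cmod (sdet N (1 + W t) - 1 - t *\<^sub>R (\<Sum>i<N. entry (X - D) i i)) \<le> 2 * exp 2 * ?C\<^sup>2 + \<bar>t\<bar> * r t" for N
    proof -
      have "(\<Sum>i<N. entry (W t) i i) - t *\<^sub>R (\<Sum>i<N. entry (X - D) i i) = (\<Sum>i<N. entry (Rm t) i i)"
        by (simp add: WR entry_simps sum.distrib scaleR_sum_right)
      then have "cmod ((\<Sum>i<N. entry (W t) i i) - t *\<^sub>R (\<Sum>i<N. entry (X - D) i i)) \<le> \<bar>t\<bar> * r t"
        using trace_bound_trace[OF Rm_small[OF t(2)], of N] by simp
      from norm_triangle_le[OF add_mono[OF sdet_second_order[OF C, of N] this]]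
      show ?thesis by (simp add: algebra_simps)
    qed
    moreover have "(\<lambda>N. cmod (sdet N (1 + W t) - 1 - t *\<^sub>R (\<Sum>i<N. entry (X - D) i i)))
        \<longlonglongrightarrow> cmod (F t - 1 - t *\<^sub>R \<tau>)"
      unfolding FW by (intro tendsto_intros sdet_tendsto_fredholm_det[OF C(1)] tr)
    ultimately have "cmod (F t - 1 - t *\<^sub>R \<tau>) \<le> 2 * exp 2 * ?C\<^sup>2 + \<bar>t\<bar> * r t"
      by (intro LIMSEQ_le_const2) auto
    moreover have "2 * exp 2 * (s * x)\<^sup>2 + s * y = s * (2 * exp 2 * s * x\<^sup>2 + y)" for s x y :: real
      by (simp add: power2_eq_square algebra_simps)
    ultimately show ?thesis by (simp only:)
  qed
  have Vlim: "(V \<longlongrightarrow> 1) (at 0)"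
  proof -
    have "((\<lambda>t. exp (t *\<^sub>R (- D))) has_vector_derivative (exp (0 *\<^sub>R (- D)) * (- D))) (at 0)"
      by (rule exp_scaleR_has_vector_derivative_right)
    from has_vector_derivative_continuous[OF this] have "isCont V 0" by (simp add: V_def[abs_def])
    then show ?thesis by (simp add: isCont_def V_def)
  qed
  have r0: "(r \<longlongrightarrow> 0) (at 0)"
  proof -
    have "(r \<longlongrightarrow> norm (1 - 1 :: nat l2op) * c + norm (1 :: nat l2op) * (\<bar>0\<bar> * (a * c * exp a))) (at 0)"
      unfolding r_def by (intro tendsto_intros Vlim)
    then show ?thesis by simp
  qed
  have lim: "((\<lambda>t. cmod (F t - 1 - t *\<^sub>R \<tau>) / \<bar>t\<bar>) \<longlongrightarrow> 0) (at 0)"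
  proof (rule tendsto_sandwich[OF _ _ tendsto_const])
    have "((\<lambda>t. 2 * exp 2 * \<bar>t\<bar> * (c + r t + 1)\<^sup>2 + r t) \<longlongrightarrow> 2 * exp 2 * \<bar>0\<bar> * (c + 0 + 1)\<^sup>2 + 0) (at (0::real))"
      by (intro tendsto_intros r0)
    then show "((\<lambda>t. 2 * exp 2 * \<bar>t\<bar> * (c + r t + 1)\<^sup>2 + r t) \<longlongrightarrow> 0) (at (0::real))" by simp
    have "((\<lambda>t. \<bar>t\<bar> * (c + r t + 1)) \<longlongrightarrow> \<bar>0\<bar> * (c + 0 + 1)) (at (0::real))" by (intro tendsto_intros r0)
    then have "\<forall>\<^sub>F t in at (0::real). \<bar>t\<bar> * (c + r t + 1) < 1/2" by (intro order_tendstoD) auto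
    moreover have "\<forall>\<^sub>F t in at (0::real). \<bar>t\<bar> < 1"
    proof -
      have "((\<lambda>t. \<bar>t\<bar>) \<longlongrightarrow> \<bar>0\<bar>) (at (0::real))" by (intro tendsto_intros)
      then show ?thesis by (intro order_tendstoD) auto
    qed
    moreover have "\<forall>\<^sub>F t in at (0::real). t \<noteq> 0" by (rule eventually_neq_at_within)
    ultimately show "\<forall>\<^sub>F t in at 0. cmod (F t - 1 - t *\<^sub>R \<tau>) / \<bar>t\<bar> \<le> 2 * exp 2 * \<bar>t\<bar> * (c + r t + 1)\<^sup>2 + r t"
    proof eventually_elim
      case (elim t)
      then show ?case using first[of t] by (simp add: pos_divide_le_eq mult.commute)
    qed
  qed simp
  have deriv: "(F has_vector_derivative (F t * \<tau>)) (at t)" for t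
    unfolding has_vector_derivative_def has_derivative_at
  proof
    show "bounded_linear (\<lambda>x. x *\<^sub>R (F t * \<tau>))" by (rule bounded_linear_scaleR_left)
    have "norm (F (t + h) - F t - h *\<^sub>R (F t * \<tau>)) / norm h = cmod (F t) * (cmod (F h - 1 - h *\<^sub>R \<tau>) / \<bar>h\<bar>)" for h
    proof -
      have "F (t + h) - F t - h *\<^sub>R (F t * \<tau>) = F t * (F h - 1 - h *\<^sub>R \<tau>)"
        by (simp add: Fadd algebra_simps)
      then show ?thesis by (simp add: norm_mult)
    qed
    then show "(\<lambda>h. norm (F (t + h) - F t - h *\<^sub>R (F t * \<tau>)) / norm h) \<midarrow>0\<rightarrow> 0"
      using tendsto_mult_right_zero[OF lim, of "cmod (F t)"] by (simp only:)
  qed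
  define G where "G t = F t * exp (- (t *\<^sub>R \<tau>))" for t
  have "(G has_vector_derivative 0) (at t)" for t
  proof -
    have "((\<lambda>t. exp (t *\<^sub>R (- \<tau>))) has_vector_derivative (exp (t *\<^sub>R (- \<tau>)) * (- \<tau>))) (at t)"
      by (rule exp_scaleR_has_vector_derivative_right)
    from has_vector_derivative_mult[OF deriv[of t] this] show ?thesis
      by (simp add: G_def[abs_def] algebra_simps)
  qed
  then obtain k where "\<And>t. t \<in> UNIV \<Longrightarrow> G t = k"
    using has_vector_derivative_zero_constant[of UNIV G] by auto
  then have "G 1 = G 0" by simp
  then have "F 1 = exp \<tau>" by (simp add: G_def F0 exp_minus field_simps)
  then show "fredholm_det (exp X * exp (- D)) = exp \<tau>" by (simp add: F_def V_def)
  show "\<exists>C. trace_bound (exp X * exp (- D) - 1) C" using trW[of 1] by (simp add: W_def V_def)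
qed

text \<open>Conjugation by the outer exponential peels off one pair of factors at a time.\<close>

lemma fredholm_det_prod_exp:
  fixes X D :: "'b \<Rightarrow> nat l2op"
  assumes "\<And>a. a \<in> set xs \<Longrightarrow> \<exists>c. trace_bound (X a - D a) c"
    and "\<And>a. a \<in> set xs \<Longrightarrow> (\<lambda>N. \<Sum>i<N. entry (X a - D a) i i) \<longlonglongrightarrow> \<tau> a"
  defines "G \<equiv> \<lambda>xs. prod_list (map (\<lambda>a. exp (X a)) xs) * prod_list (map (\<lambda>a. exp (- D a)) (rev xs))"
  shows "(\<exists>C. trace_bound (G xs - 1) C) \<and> fredholm_det (G xs) = exp (\<Sum>a\<leftarrow>xs. \<tau> a)"
  using assms(1,2)
proof (induction xs)
  case Nil
  have "fredholm_det (1 + (0 :: nat l2op)) = sdet 0 (1 + 0)" by (rule fredholm_det_section[OF trace_bound_zero]) simp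
  then show ?case by (auto simp: G_def sdet_def intro: trace_bound_zero)
next
  case (Cons a xs)
  obtain C where C: "trace_bound (G xs - 1) C" and dt: "fredholm_det (G xs) = exp (\<Sum>a\<leftarrow>xs. \<tau> a)"
    using Cons by auto
  obtain c where c: "trace_bound (X a - D a) c" using Cons.prems(1)[of a] by auto
  note ee = fredholm_det_exp_exp[OF c Cons.prems(2)[of a]]
  obtain C' where C': "trace_bound (exp (X a) * exp (- D a) - 1) C'" using ee(1) by auto
  have inv: "exp (- X a) * exp (X a) = 1" using exp_minus_inverse[of "- X a"] by simp
  define S where "S = exp (X a) * (G xs - 1) * exp (- X a)"
  have S: "trace_bound S (norm (exp (- X a)) * (norm (exp (X a)) * C))"
    unfolding S_def by (intro trace_bound_mult_right trace_bound_mult_left C)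
  have "G (a # xs) = exp (X a) * G xs * exp (- D a)" by (simp add: G_def mult.assoc)
  also have "\<dots> = (exp (X a) * G xs * exp (- X a)) * (exp (X a) * exp (- D a))"
    by (simp add: mult.assoc) (simp add: mult.assoc[symmetric] inv)
  also have "exp (X a) * G xs * exp (- X a) = 1 + S"
    by (simp add: S_def algebra_simps exp_minus_inverse)
  finally have eq: "G (a # xs) = (1 + S) * (1 + (exp (X a) * exp (- D a) - 1))" by simp
  have "fredholm_det (G (a # xs)) = fredholm_det (1 + S) * fredholm_det (1 + (exp (X a) * exp (- D a) - 1))"
    unfolding eq by (rule fredholm_det_mult[OF S C'])
  also have "fredholm_det (1 + S) = fredholm_det (1 + (G xs - 1))"
    unfolding S_def by (rule fredholm_det_similar[OF C inv])
  finally have "fredholm_det (G (a # xs)) = exp (\<Sum>a\<leftarrow>a # xs. \<tau> a)"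
    using dt ee(2) by (simp add: exp_add mult.commute)
  moreover have "G (a # xs) - 1 = S + (1 + S) * (exp (X a) * exp (- D a) - 1)"
    unfolding eq by (simp add: algebra_simps)
  then have "\<exists>C. trace_bound (G (a # xs) - 1) C" using trace_bound_add[OF S trace_bound_mult_left[OF C']] by metis
  ultimately show ?case by blast
qed

section \<open>Ordered products of exponentials\<close>

abbreviation exp_prod :: "('b \<Rightarrow> 'a l2op) \<Rightarrow> 'b list \<Rightarrow> 'a l2op"
  where "exp_prod X xs \<equiv> prod_list (map (\<lambda>a. exp (X a)) xs)"

abbreviation exp_prod_inv :: "('b \<Rightarrow> 'a l2op) \<Rightarrow> 'b list \<Rightarrow> 'a l2op"
  where "exp_prod_inv X xs \<equiv> prod_list (map (\<lambda>a. exp (- X a)) (rev xs))"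

lemma exp_prod_inverse: "exp_prod X xs * exp_prod_inv X xs = 1"
proof (induction xs)
  case (Cons a xs)
  have "exp_prod X (a # xs) * exp_prod_inv X (a # xs)
      = exp (X a) * (exp_prod X xs * exp_prod_inv X xs) * exp (- X a)"
    by (simp add: mult.assoc)
  then show ?case by (simp only: Cons exp_minus_inverse mult_1_right)
qed simp

lemma exp_prod_inverse': "exp_prod_inv X xs * exp_prod X xs = 1"
proof (induction xs)
  case (Cons a xs)
  have "exp (- X a) * exp (X a) = 1" using exp_minus_inverse[of "- X a"] by simp
  then have "exp_prod_inv X (a # xs) * exp_prod X (a # xs) = exp_prod_inv X xs * exp_prod X xs"
    by (simp add: mult.assoc) (simp add: mult.assoc[symmetric])
  then show ?case by (simp only: Cons)
qed simp

lemma exp_intertwine: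
  fixes A :: "'a l2op"
  assumes "A * S = S * B"
  shows "exp A * S = S * exp B"
proof (rule sums_unique2)
  have pow: "A ^ k * S = S * B ^ k" for k
  proof (induction k)
    case (Suc k)
    have "A ^ Suc k * S = A * (A ^ k * S)" by (simp add: mult.assoc)
    also have "\<dots> = (A * S) * B ^ k" by (simp only: Suc mult.assoc)
    finally show ?case by (simp add: assms mult.assoc)
  qed simp
  have "(\<lambda>k. (A ^ k /\<^sub>R fact k) * S) sums (exp A * S)"
    by (rule sums_mult2[OF exp_converges])
  then show "(\<lambda>k. S * (B ^ k /\<^sub>R fact k)) sums (exp A * S)" by (simp add: pow)
  show "(\<lambda>k. S * (B ^ k /\<^sub>R fact k)) sums (S * exp B)"
    by (rule sums_mult[OF exp_converges])
qed

lemma exp_prod_intertwine: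
  assumes "\<And>a. a \<in> set xs \<Longrightarrow> X a * S = S * Y a"
  shows "exp_prod X xs * S = S * exp_prod Y xs"
  using assms
proof (induction xs)
  case (Cons a xs)
  have "exp_prod X (a # xs) * S = exp (X a) * (exp_prod X xs * S)" by (simp add: mult.assoc)
  also have "\<dots> = (exp (X a) * S) * exp_prod Y xs" using Cons by (simp add: mult.assoc)
  also have "\<dots> = S * exp_prod Y (a # xs)"
    using exp_intertwine[of "X a" S "Y a"] Cons.prems by (simp add: mult.assoc)
  finally show ?case .
qed simp

lemma exp_prod_inv_intertwine:
  assumes "\<And>a. a \<in> set xs \<Longrightarrow> X a * S = S * Y a"
  shows "exp_prod_inv X xs * S = S * exp_prod_inv Y xs"
  by (rule exp_prod_intertwine) (use assms in simp)

lemma norm_exp_prod_le: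
  fixes X :: "'b \<Rightarrow> 'a l2op"
  shows "norm (exp_prod X xs) \<le> exp (\<Sum>a\<leftarrow>xs. norm (X a))"
proof (induction xs)
  case (Cons a xs)
  have "norm (exp_prod X (a # xs)) \<le> norm (exp (X a)) * norm (exp_prod X xs)"
    by (simp add: norm_mult_ineq)
  also have "\<dots> \<le> exp (norm (X a)) * exp (\<Sum>a\<leftarrow>xs. norm (X a))"
    by (intro mult_mono norm_exp Cons) auto
  finally show ?case by (simp add: exp_add)
qed simp

lemma tendsto_exp_l2op:
  fixes X :: "nat \<Rightarrow> 'a l2op"
  assumes X: "X \<longlonglongrightarrow> L"
  shows "(\<lambda>n. exp (X n)) \<longlonglongrightarrow> exp L"
proof -
  obtain a where a: "\<And>n. norm (X n) \<le> a"
    using convergent_imp_Bseq[OF convergentI[OF X]] by (auto simp: Bseq_def)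
  define b where "b = max a (norm L)"
  have b: "norm (X n) \<le> b" "norm L \<le> b" for n using a[of n] by (auto simp: b_def)
  have b0: "b \<ge> 0" using b(2) norm_ge_zero order_trans by blast
  have "(\<lambda>n. suminf (\<lambda>k. X n ^ k /\<^sub>R fact k)) \<longlonglongrightarrow> suminf (\<lambda>k. L ^ k /\<^sub>R fact k)"
  proof (rule tannerys_theorem[THEN conjunct2, THEN conjunct2])
    show "(\<lambda>n. X n ^ k /\<^sub>R fact k) \<longlonglongrightarrow> L ^ k /\<^sub>R fact k" for k
      by (intro tendsto_intros X)
    show "summable (\<lambda>k. b ^ k /\<^sub>R fact k)" using exp_converges[of b] by (auto simp: sums_iff)
    have "norm (X n ^ k /\<^sub>R fact k) \<le> b ^ k /\<^sub>R fact k" for n k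
      using order_trans[OF norm_power_ineq power_mono[OF b(1)], of n k]
      by (simp add: mult_left_mono)
    then show "\<forall>\<^sub>F (k, n) in at_top \<times>\<^sub>F sequentially. norm (X n ^ k /\<^sub>R fact k) \<le> b ^ k /\<^sub>R fact k"
      by (intro always_eventually) auto
  qed simp
  then show ?thesis by (simp add: exp_def)
qed

lemma tendsto_exp_prod:
  fixes X :: "nat \<Rightarrow> 'b \<Rightarrow> 'a l2op"
  assumes "\<And>a. a \<in> set xs \<Longrightarrow> (\<lambda>n. X n a) \<longlonglongrightarrow> L a"
  shows "(\<lambda>n. exp_prod (X n) xs) \<longlonglongrightarrow> exp_prod L xs"
  using assms by (induction xs) (auto intro!: tendsto_intros tendsto_exp_l2op)

section \<open>An exact identity for finite section determinants\<close>

lemma norm_Pn_mult_le: "norm (Pn N * X) \<le> norm X" "norm (X * Pn N) \<le> norm X"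
  "norm ((1 - Pn N) * X) \<le> norm X" "norm (X * (1 - Pn N)) \<le> norm X"
proof -
  have *: "norm (A * X) \<le> norm X" "norm (X * A) \<le> norm X" if "norm A \<le> 1" for A :: "nat l2op"
  proof -
    have "norm A * norm X \<le> norm X" "norm X * norm A \<le> norm X"
      using that by (simp_all add: mult_left_le mult_left_le_one_le)
    then show "norm (A * X) \<le> norm X" "norm (X * A) \<le> norm X"
      using norm_mult_ineq[of A X] norm_mult_ineq[of X A] by linarith+
  qed
  show "norm (Pn N * X) \<le> norm X" "norm (X * Pn N) \<le> norm X"
    "norm ((1 - Pn N) * X) \<le> norm X" "norm (X * (1 - Pn N)) \<le> norm X"
    by (simp_all add: * norm_proj_op_le norm_co_proj_op_le)
qed

lemma sdet_one: "sdet N 1 = 1"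
proof -
  have "mat N N (\<lambda>(i, j). entry (1 :: nat l2op) i j) = 1\<^sub>m N" by (intro eq_matI) (auto simp: entry_one)
  then show ?thesis by (simp add: sdet_def)
qed

text \<open>The operators \<open>X a\<close> play the role of Toeplitz operators \<open>T(A\<^sub>a)\<close>, \<open>Tm\<close> and \<open>Tm'\<close> those of
  \<open>T(A)\<close> and \<open>T(A\<^sup>-\<^sup>1)\<close>, and \<open>S\<close>, \<open>S'\<close> those of the forward and backward shift by \<open>N\<close>.
  Replacing every \<open>X a\<close> by its block diagonal part \<open>D a\<close> changes the ordered product of
  exponentials by a factor of determinant one, because the difference has finite rank and zero diagonal.
  The resulting operator \<open>G\<close> has the wanted section \<open>P G P\<close>, while the complementary corner of its
  approximate inverse \<open>G'\<close> is, up to the shift, the second limit operator.\<close>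

locale section_identity =
  fixes N :: nat and X :: "'b \<Rightarrow> nat l2op" and xs :: "'b list" and Tm Tm' S S' :: "nat l2op"
  assumes tc1: "\<exists>c. trace_bound (Tm * exp_prod_inv X xs - 1) c"
    and tc2: "\<exists>c. trace_bound (exp_prod X xs * Tm' - 1) c"
    and tcM: "\<exists>c. trace_bound (1 - Tm * Tm') c"
    and shift: "S' * S = 1" "S * S' = 1 - Pn N"
begin

abbreviation P where "P \<equiv> Pn N"
abbreviation Q where "Q \<equiv> 1 - Pn N"

definition D where "D a = P * X a * P + Q * X a * Q"
definition G where "G = Tm * exp_prod_inv D xs"
definition G' where "G' = exp_prod D xs * Tm'"
definition M where "M = 1 - Tm * Tm'"

lemma PP [simp]: "P * P = P" "P * (P * A) = P * A" "Q * Q = Q" "Q * (Q * A) = Q * A"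
  "P * Q = 0" "P * (Q * A) = 0" "Q * P = 0" "Q * (P * A) = 0"
proof -
  show 1: "P * P = P" "P * Q = 0" "Q * P = 0" "Q * Q = Q" by (simp_all add: algebra_simps)
  show "P * (P * A) = P * A" "Q * (Q * A) = Q * A" "P * (Q * A) = 0" "Q * (P * A) = 0"
    by (simp_all only: mult.assoc[symmetric] 1 mult_zero_left)
qed

lemma D_comm: "D a * P = P * D a" "D a * Q = Q * D a"
  by (simp_all add: D_def distrib_left distrib_right mult.assoc del: mult_1_left mult_1_right)

lemma exp_prod_D_comm: "exp_prod D xs * P = P * exp_prod D xs" "exp_prod_inv D xs * P = P * exp_prod_inv D xs"
  by (intro exp_prod_intertwine exp_prod_inv_intertwine D_comm)+

lemma trace_bound_off_diagonal: "\<exists>c. trace_bound (X a - D a) c"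
proof -
  have eq: "X a - D a = P * (X a * Q) + Q * X a * P" by (simp add: D_def algebra_simps)
  show ?thesis unfolding eq
    using trace_bound_add[OF trace_bound_mult_right[OF trace_bound_Pn] trace_bound_mult_left[OF trace_bound_Pn]] by blast
qed

lemma off_diagonal_entry: "entry (X a - D a) i i = 0"
proof -
  have eq: "X a - D a = P * X a - (P * X a) * P + (X a * P - P * (X a * P))"
    by (simp add: D_def algebra_simps)
  show ?thesis unfolding eq by (simp add: entry_simps entry_Pn_left entry_Pn_right)
qed

lemma trace_bound_exp_prods: "\<exists>c. trace_bound (exp_prod X xs * exp_prod_inv D xs - 1) c"
    "\<exists>c. trace_bound (exp_prod D xs * exp_prod_inv X xs - 1) c"
  and fredholm_det_exp_prods: "fredholm_det (exp_prod X xs * exp_prod_inv D xs) = 1"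
proof -
  have neg: "\<exists>c. trace_bound (D a - X a) c" for a
    using trace_bound_off_diagonal[of a] trace_bound_uminus by fastforce
  have "entry (D a - X a) i i = 0" for a i using off_diagonal_entry[of a i] by (simp add: entry_simps)
  then have 2: "(\<lambda>N. \<Sum>i<N. entry (X a - D a) i i) \<longlonglongrightarrow> 0" "(\<lambda>N. \<Sum>i<N. entry (D a - X a) i i) \<longlonglongrightarrow> 0" for a
    by (simp_all add: off_diagonal_entry)
  have z: "(\<Sum>a\<leftarrow>xs. 0 :: complex) = 0" by (induction xs) auto
  show "\<exists>c. trace_bound (exp_prod X xs * exp_prod_inv D xs - 1) c"
    "fredholm_det (exp_prod X xs * exp_prod_inv D xs) = 1"
    using fredholm_det_prod_exp[of xs X D "\<lambda>_. 0"] trace_bound_off_diagonal 2 by (auto simp: z)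
  show "\<exists>c. trace_bound (exp_prod D xs * exp_prod_inv X xs - 1) c"
    using fredholm_det_prod_exp[of xs D X "\<lambda>_. 0"] neg 2 by auto
qed

lemma trace_bound_mult_one_plus:
  assumes "\<exists>c. trace_bound (A - 1) c" "\<exists>c. trace_bound (B - 1) c"
  shows "\<exists>c. trace_bound (A * B - 1) c" "fredholm_det (A * B) = fredholm_det A * fredholm_det B"
proof -
  obtain a b where ab: "trace_bound (A - 1) a" "trace_bound (B - 1) b" using assms by blast
  have "A * B - 1 = (A - 1) + A * (B - 1)" by (simp add: algebra_simps)
  then show "\<exists>c. trace_bound (A * B - 1) c" using trace_bound_add[OF ab(1) trace_bound_mult_left[OF ab(2)]] by metis
  show "fredholm_det (A * B) = fredholm_det A * fredholm_det B" using fredholm_det_mult[OF ab] by simp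
qed

lemma G_det: "\<exists>c. trace_bound (G - 1) c" "fredholm_det G = fredholm_det (Tm * exp_prod_inv X xs)"
proof -
  have eq: "G = (Tm * exp_prod_inv X xs) * (exp_prod X xs * exp_prod_inv D xs)"
    by (simp add: G_def mult.assoc) (simp add: mult.assoc[symmetric] exp_prod_inverse')
  note m = trace_bound_mult_one_plus[OF tc1 trace_bound_exp_prods(1), folded eq]
  show "\<exists>c. trace_bound (G - 1) c" by (rule m)
  show "fredholm_det G = fredholm_det (Tm * exp_prod_inv X xs)"
    by (simp add: m(2) fredholm_det_exp_prods)
qed

lemma G'_trace_bound: "\<exists>c. trace_bound (G' - 1) c"
proof -
  have eq: "G' = (exp_prod D xs * exp_prod_inv X xs) * (exp_prod X xs * Tm')"
    by (simp add: G'_def mult.assoc) (simp add: mult.assoc[symmetric] exp_prod_inverse')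
  show ?thesis unfolding eq by (rule trace_bound_mult_one_plus[OF trace_bound_exp_prods(2) tc2])
qed

lemma GG': "G * G' = 1 - M"
  by (simp add: G_def G'_def M_def mult.assoc) (simp add: mult.assoc[symmetric] exp_prod_inverse')

lemma S_proj: "S' * P = 0" "S' * Q = S'"
proof -
  have "S' * (S * S') = S'" using shift(1) by (simp flip: mult.assoc)
  then show "S' * Q = S'" by (simp only: shift)
  then show "S' * P = 0" by (simp add: algebra_simps)
qed

text \<open>The block \<open>P G' Q\<close> splits off as a unipotent factor, and \<open>S\<close>, \<open>S'\<close> identify the range of \<open>Q\<close>
  with the whole space.\<close>

lemma corner_det:
  "fredholm_det (P + G' * Q) = fredholm_det (exp_prod (\<lambda>a. S' * X a * S) xs * (S' * Tm' * S))"
  and corner_trace_bound: "\<exists>c. trace_bound (P + G' * Q - 1) c"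
proof -
  obtain c where c: "trace_bound (G' - 1) c" using G'_trace_bound by blast
  define B where "B = S' * G' * S"
  have SD: "(S' * X a * S) * S' = S' * D a" for a
  proof -
    have "S' * D a = (S' * P) * X a * P + (S' * Q) * X a * Q" by (simp add: D_def distrib_left mult.assoc)
    then show ?thesis by (simp only: S_proj shift mult_zero_left add_0_left mult.assoc)
  qed
  have "exp_prod (\<lambda>a. S' * X a * S) xs * S' = S' * exp_prod D xs"
    by (rule exp_prod_intertwine) (rule SD)
  then have B: "B = exp_prod (\<lambda>a. S' * X a * S) xs * (S' * Tm' * S)"
    by (simp add: B_def G'_def mult.assoc[symmetric])
  have tB: "trace_bound (B - 1) (norm S * (norm S' * c))"
  proof -
    have "B - 1 = S' * (G' - 1) * S" by (simp add: B_def right_diff_distrib left_diff_distrib shift)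
    then show ?thesis using trace_bound_mult_right[OF trace_bound_mult_left[OF c, of S'], of S] by simp
  qed
  have S1: "P + Q * G' * Q = 1 + S * (B - 1) * S'"
    by (simp add: B_def right_diff_distrib left_diff_distrib mult.assoc shift)
      (simp add: mult.assoc[symmetric] shift, simp add: mult.assoc shift algebra_simps)
  have dS: "fredholm_det (P + Q * G' * Q) = fredholm_det B"
    using fredholm_det_similar[OF tB shift(1)] by (simp add: S1)
  have tS: "\<exists>c. trace_bound (P + Q * G' * Q - 1) c"
    unfolding S1 using trace_bound_mult_right[OF trace_bound_mult_left[OF tB]] by fastforce
  define Z where "Z = P * G' * Q"
  have Z: "trace_bound Z (norm (G' * Q) * real N)" using trace_bound_mult_right[OF trace_bound_Pn] by (simp add: Z_def mult.assoc)
  have "fredholm_det (1 + Z) = sdet N (1 + Z)"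
    by (rule fredholm_det_section[OF Z]) (simp add: Z_def mult.assoc)
  also have "\<dots> = sdet N 1"
  proof (rule sdet_cong)
    fix i j assume "i < N" "j < N"
    moreover have "Z = P * G' - (P * G') * P" by (simp add: Z_def algebra_simps)
    ultimately show "entry (1 + Z) i j = entry 1 i j" by (simp add: entry_simps entry_Pn_right)
  qed
  finally have dZ: "fredholm_det (1 + Z) = 1" by (simp add: sdet_one)
  have tZ: "\<exists>c. trace_bound ((1 + Z) - 1) c" using Z by auto
  have eq: "P + G' * Q = (P + Q * G' * Q) * (1 + Z)"
  proof -
    have "(P + Q * G' * Q) * (1 + Z) = P + Q * G' * Q + P * Z + Q * (G' * (Q * Z))"
      by (simp add: distrib_left distrib_right mult.assoc)
    moreover have "Q * Z = 0" "P * Z = Z" by (simp_all add: Z_def mult.assoc)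
    moreover have "P + Q * G' * Q + Z + Q * (G' * 0) = P + G' * Q" by (simp add: Z_def algebra_simps)
    ultimately show ?thesis by simp
  qed
  show "fredholm_det (P + G' * Q) = fredholm_det (exp_prod (\<lambda>a. S' * X a * S) xs * (S' * Tm' * S))"
    unfolding eq trace_bound_mult_one_plus(2)[OF tS tZ] dZ dS B by simp
  show "\<exists>c. trace_bound (P + G' * Q - 1) c" unfolding eq by (rule trace_bound_mult_one_plus[OF tS tZ])
qed

text \<open>Right multiplication by \<open>I - Q G P\<close> clears the lower left block of \<open>G P + Q - M Q\<close>.\<close>

lemma product_identity:
  "fredholm_det (Tm * exp_prod_inv X xs) * fredholm_det (exp_prod (\<lambda>a. S' * X a * S) xs * (S' * Tm' * S))
    = fredholm_det (1 + (P * G * P - P) + M * Q * (G * P - 1))"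
proof -
  define Z where "Z = - (Q * G * P)"
  have Z: "trace_bound Z (norm (Q * G) * real N)"
    unfolding Z_def by (rule trace_bound_uminus[OF trace_bound_mult_left[OF trace_bound_Pn]])
  have "fredholm_det (1 + Z) = sdet N (1 + Z)"
    by (rule fredholm_det_section[OF Z]) (simp add: Z_def mult.assoc)
  also have "\<dots> = sdet N 1"
  proof (rule sdet_cong)
    fix i j assume "i < N" "j < N"
    moreover have "Z = P * (G * P) - G * P" by (simp add: Z_def algebra_simps)
    ultimately show "entry (1 + Z) i j = entry 1 i j" by (simp add: entry_simps entry_Pn_left)
  qed
  finally have dZ: "fredholm_det (1 + Z) = 1" by (simp add: sdet_one)
  have tZ: "\<exists>c. trace_bound ((1 + Z) - 1) c" using Z by auto
  have GQ: "G * (P + G' * Q) = G * P + Q - M * Q"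
  proof -
    have "G * (P + G' * Q) = G * P + (G * G') * Q" by (simp add: distrib_left mult.assoc)
    then show ?thesis by (simp add: GG' algebra_simps)
  qed
  have eq: "G * (P + G' * Q) * (1 + Z) = 1 + (P * G * P - P) + M * Q * (G * P - 1)"
  proof -
    have PZ: "P * Z = 0" "Q * Z = Z" by (simp_all add: Z_def mult.assoc)
    have "G * (P + G' * Q) * (1 + Z) = G * P + Q - M * Q + (G * (P * Z) + Q * Z - M * (Q * Z))"
      unfolding GQ by (simp add: algebra_simps)
    also have "\<dots> = G * P + Q - M * Q + Z - M * Z" by (simp only: PZ) simp
    also have "\<dots> = 1 + (P * G * P - P) + M * Q * (G * P - 1)"
      by (simp add: Z_def algebra_simps)
    finally show ?thesis .
  qed
  note m1 = trace_bound_mult_one_plus[OF G_det(1) corner_trace_bound]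
  note m2 = trace_bound_mult_one_plus[OF m1(1) tZ]
  show ?thesis using m2(2) by (simp add: eq m1(2) G_det(2) corner_det dZ)
qed

lemma section_eq: "P * G * P = P * Tm * P * exp_prod_inv (\<lambda>a. P * X a * P) xs"
proof -
  have 1: "exp_prod_inv (\<lambda>a. P * X a * P) xs * P = P * exp_prod_inv D xs"
    by (rule exp_prod_inv_intertwine) (simp add: D_def distrib_left mult.assoc)
  have 2: "exp_prod_inv (\<lambda>a. P * X a * P) xs * P = P * exp_prod_inv (\<lambda>a. P * X a * P) xs"
    by (rule exp_prod_inv_intertwine) (simp add: mult.assoc)
  have "P * G * P = P * Tm * (exp_prod_inv D xs * P)" by (simp add: G_def mult.assoc)
  also have "exp_prod_inv D xs * P = P * exp_prod_inv (\<lambda>a. P * X a * P) xs"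
    by (simp only: exp_prod_D_comm 1[symmetric] 2)
  finally show ?thesis by (simp add: mult.assoc)
qed

text \<open>On the range of \<open>P\<close> the inverse exponentials of the sections have determinant
  \<open>exp (- trace)\<close>.\<close>

lemma section_det:
  "fredholm_det (1 + (P * G * P - P)) = sdet N Tm * exp (- (\<Sum>a\<leftarrow>xs. \<Sum>i<N. entry (X a) i i))"
proof -
  let ?Y = "\<lambda>a. P * X a * P"
  let ?E = "exp_prod_inv ?Y xs"
  have t0: "trace_bound (P * Tm * P - P) (norm (Tm * P - 1) * real N)"
    using trace_bound_mult_right[OF trace_bound_Pn, of N "Tm * P - 1"] by (simp add: right_diff_distrib mult.assoc)
  have d0: "fredholm_det (1 + (P * Tm * P - P)) = sdet N Tm"
  proof -
    have "fredholm_det (1 + (P * Tm * P - P)) = sdet N (1 + (P * Tm * P - P))"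
      by (rule fredholm_det_section[OF t0]) (simp add: right_diff_distrib mult.assoc)
    also have "\<dots> = sdet N Tm"
      by (rule sdet_cong) (simp add: entry_simps entry_one entry_Pn entry_Pn_left entry_Pn_right)
    finally show ?thesis .
  qed
  have "trace_bound (?Y a) (norm (X a * P) * real N)" for a
    using trace_bound_mult_right[OF trace_bound_Pn, of N "X a * P"] by (simp add: mult.assoc)
  then have c1: "\<exists>c. trace_bound (- ?Y a - 0) c" for a using trace_bound_uminus by fastforce
  have tr: "(\<lambda>K. \<Sum>i<K. entry (- ?Y a - 0) i i) \<longlonglongrightarrow> - (\<Sum>i<N. entry (X a) i i)" for a
  proof (rule tendsto_eventually)
    have "(\<Sum>i<K. entry (- ?Y a - 0) i i) = - (\<Sum>i<N. entry (X a) i i)" if "K \<ge> N" for K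
    proof -
      have "(\<Sum>i<K. entry (- ?Y a - 0) i i) = (\<Sum>i<K. if i < N then - entry (X a) i i else 0)"
        by (intro sum.cong refl) (simp add: entry_simps entry_Pn_left entry_Pn_right)
      also have "\<dots> = (\<Sum>i\<in>{..<K} \<inter> {..<N}. - entry (X a) i i)"
        by (subst sum.inter_restrict) auto
      also have "{..<K} \<inter> {..<N} = {..<N}" using that by auto
      finally show ?thesis by (simp add: sum_negf)
    qed
    then show "\<forall>\<^sub>F K in sequentially. (\<Sum>i<K. entry (- ?Y a - 0) i i) = - (\<Sum>i<N. entry (X a) i i)"
      by (auto simp: eventually_sequentially)
  qed
  have one: "prod_list (map (\<lambda>a. exp (- 0 :: nat l2op)) ys) = 1" for ys :: "'b list" by (induction ys) auto
  have E: "(\<exists>C. trace_bound (?E - 1) C) \<and> fredholm_det ?E = exp (\<Sum>a\<leftarrow>rev xs. - (\<Sum>i<N. entry (X a) i i))"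
    using fredholm_det_prod_exp[of "rev xs" "\<lambda>a. - ?Y a" "\<lambda>_. 0" "\<lambda>a. - (\<Sum>i<N. entry (X a) i i)"] c1 tr
    by (simp only: one mult_1_right)
  have PE: "?E * P = P * ?E"
    by (rule exp_prod_inv_intertwine) (simp add: mult.assoc)
  have QE: "Q * ?E = Q"
  proof -
    have "exp_prod_inv (\<lambda>a. 0 :: nat l2op) xs * Q = Q * ?E"
      by (rule exp_prod_inv_intertwine) (simp add: mult.assoc)
    then show ?thesis by (simp only: one mult_1_left)
  qed
  have eq: "1 + (P * G * P - P) = (1 + (P * Tm * P - P)) * ?E"
  proof -
    have "1 + (P * Tm * P - P) = P * Tm * P + Q" by simp
    then have "(1 + (P * Tm * P - P)) * ?E = (P * Tm * P + Q) * ?E" by (simp only:)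
    also have "\<dots> = P * G * P + Q" by (simp only: distrib_right QE section_eq)
    finally show ?thesis by simp
  qed
  have t0': "\<exists>c. trace_bound ((1 + (P * Tm * P - P)) - 1) c" using t0 by auto
  have "fredholm_det (1 + (P * G * P - P))
      = fredholm_det (1 + (P * Tm * P - P)) * fredholm_det ?E"
    unfolding eq by (rule trace_bound_mult_one_plus(2)[OF t0']) (use E in blast)
  also have "\<dots> = sdet N Tm * exp (\<Sum>a\<leftarrow>rev xs. - (\<Sum>i<N. entry (X a) i i))" using E by (simp add: d0)
  also have "(\<Sum>a\<leftarrow>rev xs. - (\<Sum>i<N. entry (X a) i i)) = - (\<Sum>a\<leftarrow>xs. \<Sum>i<N. entry (X a) i i)"
    by (induction xs) auto
  finally show ?thesis .
qed

lemma norm_G_le: "norm G \<le> norm Tm * exp (2 * (\<Sum>a\<leftarrow>xs. norm (X a)))"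
proof -
  have D: "norm (- D a) \<le> 2 * norm (X a)" for a
  proof -
    have "norm (P * X a * P) \<le> norm (X a)" "norm (Q * X a * Q) \<le> norm (X a)"
      by (rule order_trans[OF norm_Pn_mult_le(2) norm_Pn_mult_le(1)],
          rule order_trans[OF norm_Pn_mult_le(4) norm_Pn_mult_le(3)])
    then have "norm (D a) \<le> norm (X a) + norm (X a)" unfolding D_def by (rule norm_triangle_le[OF add_mono])
    then show ?thesis by simp
  qed
  have "(\<Sum>a\<leftarrow>rev xs. norm (- D a)) \<le> (\<Sum>a\<leftarrow>rev xs. 2 * norm (X a))"
    by (rule sum_list_mono) (rule D)
  also have "\<dots> = 2 * (\<Sum>a\<leftarrow>xs. norm (X a))" by (induction xs) auto
  finally have "norm (exp_prod_inv D xs) \<le> exp (2 * (\<Sum>a\<leftarrow>xs. norm (X a)))"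
    using norm_exp_prod_le[of "\<lambda>a. - D a" "rev xs"] by (meson exp_le_cancel_iff order_trans)
  then show ?thesis unfolding G_def
    by (intro order_trans[OF norm_mult_ineq] mult_left_mono) auto
qed

end

section \<open>Toeplitz and Hankel operators\<close>

lemma norm_coord_map_le:
  fixes f :: "'b \<Rightarrow> 'a"
  assumes f: "inj_on f S"
  shows "norm (blinfun_apply (coord_map S f) x) \<le> norm x"
  unfolding norm_l2.rep_eq[of "blinfun_apply (coord_map S f) x"]
proof (rule l2_memI(2))
  fix F :: "'b set" assume F: "finite F"
  have "L2_set (\<lambda>k. cmod (coord (blinfun_apply (coord_map S f) x) k)) F
      = L2_set (\<lambda>k. cmod (coord x (f k))) (F \<inter> S)"
    unfolding L2_set_def using F
    by (auto simp: coord_coord_map[OF f] sum.inter_restrict intro!: sum.cong)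
  also have "\<dots> = L2_set (\<lambda>j. cmod (coord x j)) (f ` (F \<inter> S))"
    unfolding L2_set_def using inj_on_subset[OF f, of "F \<inter> S"] by (simp add: sum.reindex)
  also have "\<dots> \<le> norm x"
    using l2_finite_le[of "coord x" "f ` (F \<inter> S)"] Rep_l2[of x] F by (simp add: norm_l2.rep_eq)
  finally show "L2_set (\<lambda>k. cmod (coord (blinfun_apply (coord_map S f) x) k)) F \<le> norm x" .
qed

lemma app_on_nat:
  "app (on_nat A) x = blinfun_apply (coord_map UNIV int) (app A (blinfun_apply (coord_map {0..} nat) x))"
  by (simp add: app.rep_eq on_nat.rep_eq)

lemma norm_on_nat_le: "norm (on_nat A) \<le> norm A"
proof (rule norm_l2op_le)
  fix x :: "nat l2"
  have "norm (app (on_nat A) x) \<le> norm (app A (blinfun_apply (coord_map {0..} nat) x))"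
    unfolding app_on_nat by (rule norm_coord_map_le) simp
  also have "\<dots> \<le> norm A * norm (blinfun_apply (coord_map {0..} nat) x)" by (rule norm_app)
  also have "\<dots> \<le> norm A * norm x" by (intro mult_left_mono norm_coord_map_le inj_on_nat) simp
  finally show "norm (app (on_nat A) x) \<le> norm A * norm x" .
qed simp

lemma norm_U_op_le: "norm (U_op n) \<le> 1"
  by (rule norm_l2op_le) (auto simp: app.rep_eq U_op.rep_eq inj_on_def intro!: norm_coord_map_le)

lemma norm_J_op_le: "norm J_op \<le> 1"
  by (rule norm_l2op_le) (auto simp: app.rep_eq J_op.rep_eq inj_on_def intro!: norm_coord_map_le)

lemma on_nat_mult: "on_nat A * on_nat B = on_nat (A * P_op * B)"
proof (rule op_eqI)
  fix x :: "nat l2"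
  have "blinfun_apply (coord_map {0..} nat) (blinfun_apply (coord_map UNIV int) y) = app P_op y" for y
    by (rule l2_eqI) (simp add: coord_coord_map inj_on_nat P_op_def coord_proj_op)
  then show "app (on_nat A * on_nat B) x = app (on_nat (A * P_op * B)) x"
    by (simp add: app_times app_on_nat)
qed

lemma entry_proj_left: "entry (proj_op S * A) i j = (if i \<in> S then entry A i j else 0)"
  by (simp add: entry_def app_times coord_proj_op)

lemma entry_proj_right: "entry (A * proj_op S) i j = (if j \<in> S then entry A i j else 0)"
proof -
  have "app (proj_op S) (l2_basis j) = (if j \<in> S then l2_basis j else 0)"
    by (rule l2_eqI) (auto simp: coord_proj_op coord_simps)
  then show ?thesis by (simp add: entry_def app_times coord_simps)
qed

lemma entry_proj: "entry (proj_op S) i j = (if i = j \<and> i \<in> S then 1 else 0)"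
  using entry_proj_left[of S 1 i j] by (simp add: entry_one)

lemma on_nat_simps:
  "on_nat (A + B) = on_nat A + on_nat B" "on_nat (A - B) = on_nat A - on_nat B"
  "on_nat (r *\<^sub>R A) = r *\<^sub>R on_nat A" "on_nat 1 = 1"
  "on_nat (P_op * A) = on_nat A" "on_nat (A * P_op) = on_nat A"
  by (rule op_eq_entryI; simp add: entry_on_nat entry_simps entry_one P_op_def entry_proj_left entry_proj_right)+

lemma Pn_on_nat:
  "Pn N * on_nat A = on_nat (proj_op {..<int N} * A)" "on_nat A * Pn N = on_nat (A * proj_op {..<int N})"
  "(1 - Pn N) * on_nat A = on_nat (proj_op {int N..} * A)"
  by (rule op_eq_entryI; simp add: entry_on_nat entry_simps entry_proj_left entry_proj_right left_diff_distrib)+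

lemma T_op_on_nat: "T_op A = on_nat A"
  unfolding T_op_def on_nat_simps ..

lemma H_op_on_nat: "H_op A = on_nat (A * J_op)"
  unfolding H_op_def on_nat_simps by (simp add: mult.assoc on_nat_simps)

lemma T_op_simps:
  "T_op (A + B) = T_op A + T_op B" "T_op (A - B) = T_op A - T_op B"
  "T_op (r *\<^sub>R A) = r *\<^sub>R T_op A" "T_op 1 = 1"
  by (simp_all add: T_op_on_nat on_nat_simps)

lemma norm_T_op_le: "norm (T_op A) \<le> norm A"
  by (simp add: T_op_on_nat norm_on_nat_le)

lemma int_op_eqI: "(\<And>x k. coord (app A x) k = coord (app B x) k) \<Longrightarrow> A = B"
  by (intro op_eqI l2_eqI)

lemma J_op_J_op [simp]: "J_op * J_op = 1" "J_op * (J_op * A) = A"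
proof -
  show 1: "J_op * J_op = 1" by (rule int_op_eqI) (simp add: app_times coord_J_op)
  show "J_op * (J_op * A) = A" by (simp flip: mult.assoc add: 1)
qed

lemma U_op_U_op: "U_op m * U_op n = U_op (m + n)" "U_op 0 = 1"
  by (rule int_op_eqI, simp add: app_times coord_U_op algebra_simps)+

lemma J_P_J: "J_op * P_op * J_op = 1 - P_op"
  by (rule int_op_eqI) (simp add: app_simps coord_J_op coord_proj_op P_op_def coord_simps)

text \<open>Widom's identity: the part of \<open>A B\<close> that passes through negative indices is a product of
  Hankel operators.\<close>

lemma T_op_mult: "T_op (A * B) = T_op A * T_op B + H_op A * H_op (flip B)"
proof -
  have "H_op A * H_op (flip B) = on_nat (A * (J_op * P_op * J_op) * B)"
    by (simp add: H_op_on_nat on_nat_mult flip_def mult.assoc)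
  also have "\<dots> = on_nat (A * B - A * P_op * B)" unfolding J_P_J by (simp add: algebra_simps)
  finally show ?thesis by (simp add: T_op_on_nat on_nat_mult on_nat_simps)
qed

definition shift :: "int l2op \<Rightarrow> int \<Rightarrow> int l2op"
  where "shift A n = U_op (- n) * A * U_op n"

lemma U_op_cancel: "U_op n * (U_op (- n) * A) = A" "U_op (- n) * (U_op n * A) = A"
  by (simp_all flip: mult.assoc add: U_op_U_op)

lemma shift_simps:
  "shift (A + B) n = shift A n + shift B n" "shift (A - B) n = shift A n - shift B n"
  "shift (r *\<^sub>R A) n = r *\<^sub>R shift A n" "shift (A * B) n = shift A n * shift B n" "shift 1 n = 1"
  by (simp_all add: shift_def algebra_simps U_op_cancel U_op_U_op)

lemma shift_shift: "shift (shift A m) n = shift A (m + n)"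
proof -
  have "shift (shift A m) n = (U_op (- n) * U_op (- m)) * A * (U_op m * U_op n)"
    by (simp add: shift_def mult.assoc)
  then show ?thesis by (simp add: U_op_U_op shift_def add.commute)
qed

lemma norm_shift_le: "norm (shift A n) \<le> norm A"
proof -
  have "norm (shift A n) \<le> norm (U_op (- n)) * norm A * norm (U_op n)"
    unfolding shift_def by (rule order_trans[OF norm_mult_ineq]) (intro mult_right_mono norm_mult_ineq norm_ge_zero)
  also have "\<dots> \<le> 1 * norm A * 1" by (intro mult_mono norm_U_op_le) auto
  finally show ?thesis by simp
qed

lemma entry_shift: "entry (shift A n) i j = entry A (n + i) (n + j)"
proof -
  have "app (U_op n) (l2_basis j) = l2_basis (n + j)"
    by (rule l2_eqI) (auto simp: coord_U_op coord_simps)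
  then show ?thesis by (simp add: shift_def entry_def app_times coord_U_op add.commute)
qed

abbreviation fwd :: "nat \<Rightarrow> nat l2op" where "fwd N \<equiv> on_nat (U_op (int N))"
abbreviation bwd :: "nat \<Rightarrow> nat l2op" where "bwd N \<equiv> on_nat (U_op (- int N))"

lemma bwd_fwd: "bwd N * fwd N = 1" "fwd N * bwd N = 1 - Pn N"
proof -
  have 1: "U_op (- int N) * P_op * U_op (int N) = proj_op {- int N..}"
    by (rule int_op_eqI) (simp add: app_times coord_U_op coord_proj_op P_op_def)
  have 2: "U_op (int N) * P_op * U_op (- int N) = proj_op {int N..}"
    by (rule int_op_eqI) (simp add: app_times coord_U_op coord_proj_op P_op_def)
  show "bwd N * fwd N = 1" "fwd N * bwd N = 1 - Pn N"
    unfolding on_nat_mult 1 2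
    by (rule op_eq_entryI; simp add: entry_on_nat entry_simps entry_one entry_proj)+
qed

lemma bwd_T_op_fwd: "bwd N * T_op A * fwd N = T_op (shift A (int N))"
proof -
  have 1: "U_op (- int N) * P_op = proj_op {- int N..} * U_op (- int N)"
    by (rule int_op_eqI) (simp add: app_times coord_U_op coord_proj_op P_op_def)
  have 2: "P_op * U_op (int N) = U_op (int N) * proj_op {- int N..}"
    by (rule int_op_eqI) (simp add: app_times coord_U_op coord_proj_op P_op_def)
  have "bwd N * T_op A * fwd N = on_nat ((U_op (- int N) * P_op) * A * (P_op * U_op (int N)))"
    by (simp add: T_op_on_nat on_nat_mult mult.assoc)
  also have "\<dots> = on_nat (proj_op {- int N..} * (shift A (int N) * proj_op {- int N..}))"
    unfolding 1 2 by (simp add: shift_def mult.assoc)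
  also have "\<dots> = on_nat (shift A (int N))"
    by (rule op_eq_entryI) (simp add: entry_on_nat entry_proj_left entry_proj_right)
  finally show ?thesis by (simp add: T_op_on_nat)
qed

text \<open>Reflecting the interval \<open>[0, N)\<close> turns the part of a product that passes through indices
  beyond \<open>N\<close> into a Hankel product of the shifted operators.\<close>

lemma section_reflect:
  "Pn N * T_op A * (1 - Pn N) * T_op B * Pn N
    = on_nat (U_op (int N) * J_op) * (H_op (flip (shift A (int N))) * H_op (shift B (int N)))
      * on_nat (U_op (int N) * J_op)"
proof -
  let ?U = "U_op (int N)" and ?V = "U_op (- int N)"
  have 1: "?U * J_op * P_op * J_op * ?V = proj_op {..<int N}"
    by (rule int_op_eqI) (auto simp: app_times coord_U_op coord_J_op coord_proj_op P_op_def)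
  have 2: "?U * P_op * ?V = proj_op {int N..}"
    by (rule int_op_eqI) (simp add: app_times coord_U_op coord_proj_op P_op_def)
  have 3: "?U * J_op * P_op * ?U * J_op = proj_op {..<int N}"
    by (rule int_op_eqI) (auto simp: app_times coord_U_op coord_J_op coord_proj_op P_op_def)
  have P: "P_op * (proj_op {int N..} * X) = proj_op {int N..} * X" for X
  proof -
    have "P_op * proj_op {int N..} = proj_op {int N..}"
      by (rule int_op_eqI) (simp add: app_times coord_proj_op P_op_def)
    then show ?thesis by (simp flip: mult.assoc)
  qed
  have "on_nat (?U * J_op) * (H_op (flip (shift A (int N))) * H_op (shift B (int N))) * on_nat (?U * J_op)
      = on_nat ((?U * J_op * P_op * J_op * ?V) * A * (?U * P_op * ?V) * B * (?U * J_op * P_op * ?U * J_op))"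
    by (simp add: H_op_on_nat on_nat_mult flip_def shift_def mult.assoc)
  also have "\<dots> = on_nat (proj_op {..<int N} * A * proj_op {int N..} * B * proj_op {..<int N})"
    unfolding 1 2 3 ..
  also have "\<dots> = Pn N * T_op A * (1 - Pn N) * T_op B * Pn N"
    by (simp add: T_op_on_nat mult.assoc Pn_on_nat on_nat_mult P)
  finally show ?thesis ..
qed

lemma H_op_diff: "H_op (A - B) = H_op A - H_op B" "flip (A - B) = flip A - flip B"
  by (simp_all add: H_op_on_nat flip_def algebra_simps on_nat_simps)

section \<open>Almost multiplicative maps on the algebra\<close>

lemma trace_bound_entry_le: "trace_bound K C \<Longrightarrow> cmod (entry K i j) \<le> C"
proof -
  assume K: "trace_bound K C"
  obtain \<alpha> \<beta> where b: "\<And>i j. cmod (entry K i j) \<le> \<alpha> i * \<beta> j" "\<And>N. (\<Sum>i<N. (\<alpha> i)\<^sup>2) \<le> C" "\<And>N. (\<Sum>j<N. (\<beta> j)\<^sup>2) \<le> C"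
    using trace_bound_entry_bound[OF K] by metis
  have "(\<alpha> i)\<^sup>2 \<le> (\<Sum>i<Suc i. (\<alpha> i)\<^sup>2)" "(\<beta> j)\<^sup>2 \<le> (\<Sum>j<Suc j. (\<beta> j)\<^sup>2)" by (simp_all add: sum_nonneg)
  then have "(\<alpha> i)\<^sup>2 \<le> C" "(\<beta> j)\<^sup>2 \<le> C" using b(2)[of "Suc i"] b(3)[of "Suc j"] by linarith+
  then show ?thesis using b(1)[of i j] sum_squares_bound[of "\<alpha> i" "\<beta> j"] by simp
qed

lemma trace_tendsto_entry: "trace_tendsto K L \<Longrightarrow> (\<lambda>n. entry (K n) i j) \<longlonglongrightarrow> entry L i j"
proof (rule LIMSEQ_I)
  fix r :: real assume L: "trace_tendsto K L" and r: "0 < r"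
  have "\<forall>\<^sub>F n in sequentially. trace_bound (K n - L) (r / 2)" using L r by (simp add: trace_tendsto_def)
  then have "\<forall>\<^sub>F n in sequentially. norm (entry (K n) i j - entry L i j) < r"
  proof eventually_elim
    case (elim n)
    then show ?case using trace_bound_entry_le[OF elim, of i j] r by (simp add: entry_simps)
  qed
  then show "\<exists>no. \<forall>n\<ge>no. norm (entry (K n) i j - entry L i j) < r" by (simp add: eventually_sequentially)
qed

text \<open>Dominated convergence: the tails of the series are uniformly small in trace norm, also in the limit,
  since trace norm bounds survive limits of matrix entries.\<close>

lemma trace_tendsto_suminf:
  assumes sf: "\<And>n. summable (f n)" and lim: "(\<lambda>n. suminf (f n)) \<longlonglongrightarrow> L"
    and b: "summable b" and fb: "\<And>n k. trace_bound (f n k) (b k)" and fg: "\<And>k. trace_tendsto (\<lambda>n. f n k) (g k)"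
  shows "trace_tendsto (\<lambda>n. suminf (f n)) L"
  unfolding trace_tendsto_def
proof (intro allI impI)
  fix e :: real assume e: "e > 0"
  obtain m where m: "(\<Sum>k. b (k + m)) < e / 3"
  proof -
    have "(\<lambda>m. \<Sum>k. b (k + m)) \<longlonglongrightarrow> 0" by (rule suminf_exist_split2[OF b])
    then have "\<forall>\<^sub>F m in sequentially. (\<Sum>k. b (k + m)) < e / 3" using e by (intro order_tendstoD) auto
    then show ?thesis using that by (auto simp: eventually_sequentially)
  qed
  have tail: "trace_bound (suminf (f n) - (\<Sum>k<m. f n k)) (e / 3)" for n
  proof -
    have "suminf (f n) - (\<Sum>k<m. f n k) = (\<Sum>k. f n (k + m))"
      using suminf_split_initial_segment[OF sf[of n], of m] by simp
    moreover have "trace_bound \<dots> (\<Sum>k. b (k + m))"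
      by (rule trace_bound_suminf) (use sf b fb in \<open>auto simp: summable_iff_shift\<close>)
    ultimately show ?thesis using m by (auto elim: trace_bound_mono)
  qed
  have head: "trace_tendsto (\<lambda>n. \<Sum>k<m. f n k) (\<Sum>k<m. g k)" by (intro trace_tendsto_sum fg)
  have limtail: "trace_bound (L - (\<Sum>k<m. g k)) (e / 3)"
  proof (rule trace_bound_limit[OF _ tail])
    show "(\<lambda>n. entry (suminf (f n) - (\<Sum>k<m. f n k)) i j) \<longlonglongrightarrow> entry (L - (\<Sum>k<m. g k)) i j" for i j
      unfolding entry_simps by (intro tendsto_diff tendsto_entry[OF lim] trace_tendsto_entry[OF head])
  qed
  have "\<forall>\<^sub>F n in sequentially. trace_bound ((\<Sum>k<m. f n k) - (\<Sum>k<m. g k)) (e / 3)"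
    using head e unfolding trace_tendsto_def by simp
  then show "\<forall>\<^sub>F n in sequentially. trace_bound (suminf (f n) - L) e"
  proof eventually_elim
    case (elim n)
    from trace_bound_diff[OF trace_bound_add[OF tail[of n] elim] limtail] show ?case by (simp add: algebra_simps)
  qed
qed

locale suitable_algebra =
  fixes R :: "int l2op set" and nrm :: "int l2op \<Rightarrow> real"
  assumes sub: "banach_subalgebra R nrm" and unit: "unital R"
    and suit: "suitable R nrm" and inv: "shift_invariant R nrm"
begin

lemma closed: "0 \<in> R" "1 \<in> R" "A \<in> R \<Longrightarrow> B \<in> R \<Longrightarrow> A + B \<in> R" "A \<in> R \<Longrightarrow> B \<in> R \<Longrightarrow> A * B \<in> R"
  "A \<in> R \<Longrightarrow> op_scale c A \<in> R"
  using sub unit by (auto simp: banach_subalgebra_def unital_def)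

lemma scaleR_op_scale: "r *\<^sub>R (A :: int l2op) = op_scale (of_real r) A"
  by (rule int_op_eqI) (simp add: app_simps app_op_scale coord_simps scaleR_conv_of_real[where 'a=complex])

lemma closed': "A \<in> R \<Longrightarrow> r *\<^sub>R A \<in> R" "A \<in> R \<Longrightarrow> - A \<in> R" "A \<in> R \<Longrightarrow> B \<in> R \<Longrightarrow> A - B \<in> R"
  "A \<in> R \<Longrightarrow> A ^ k \<in> R"
proof -
  show s: "r *\<^sub>R A \<in> R" if "A \<in> R" for r A using that by (simp add: scaleR_op_scale closed)
  show n: "- A \<in> R" if "A \<in> R" for A using s[OF that, of "-1"] by simp
  show "A - B \<in> R" if "A \<in> R" "B \<in> R" using closed(3)[OF that(1) n[OF that(2)]] by simp
  show "A ^ k \<in> R" if "A \<in> R" using that by (induction k) (auto intro: closed)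
qed

lemma closed_sum: "(\<And>i. i \<in> I \<Longrightarrow> f i \<in> R) \<Longrightarrow> (\<Sum>i\<in>I. f i) \<in> R"
  by (induction I rule: infinite_finite_induct) (auto intro: closed)

lemma nrm_nonneg: "A \<in> R \<Longrightarrow> 0 \<le> nrm A"
  and nrm_add: "A \<in> R \<Longrightarrow> B \<in> R \<Longrightarrow> nrm (A + B) \<le> nrm A + nrm B"
  and norm_le_nrm: "A \<in> R \<Longrightarrow> norm A \<le> nrm A"
  using sub suit by (auto simp: banach_subalgebra_def suitable_def)

lemma nrm_zero: "nrm 0 = 0"
  using sub by (auto simp: banach_subalgebra_def)

lemma nrm_scaleR: "A \<in> R \<Longrightarrow> nrm (r *\<^sub>R A) = \<bar>r\<bar> * nrm A"
  using sub unfolding banach_subalgebra_def by (simp add: scaleR_op_scale)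

lemma nrm_sum: "(\<And>i. i \<in> I \<Longrightarrow> f i \<in> R) \<Longrightarrow> nrm (\<Sum>i\<in>I. f i) \<le> (\<Sum>i\<in>I. nrm (f i))"
proof (induction I rule: infinite_finite_induct)
  case (insert x F)
  then show ?case using nrm_add[of "f x" "sum f F"] closed_sum[of F f] by fastforce
qed (auto simp: nrm_zero)

lemma shift_in: "A \<in> R \<Longrightarrow> shift A n \<in> R" and nrm_shift: "A \<in> R \<Longrightarrow> nrm (shift A n) = nrm A"
  using inv by (auto simp: shift_invariant_def shift_def)

lemma nrm_mult: "\<exists>C\<ge>1. \<forall>A\<in>R. \<forall>B\<in>R. nrm (A * B) \<le> C * nrm A * nrm B"
proof -
  obtain C where C: "\<forall>A\<in>R. \<forall>B\<in>R. nrm (A * B) \<le> C * nrm A * nrm B"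
    using sub by (auto simp: banach_subalgebra_def)
  have "nrm (A * B) \<le> max C 1 * nrm A * nrm B" if "A \<in> R" "B \<in> R" for A B
  proof -
    have "C * nrm A * nrm B \<le> max C 1 * nrm A * nrm B"
      using that by (intro mult_right_mono nrm_nonneg) auto
    then show ?thesis using C that by fastforce
  qed
  then show ?thesis by (intro exI[of _ "max C 1"]) auto
qed

lemma nrm_power:
  assumes A: "A \<in> R"
  shows "\<exists>b\<ge>nrm A. \<forall>k. nrm (A ^ k) \<le> nrm 1 * b ^ k"
proof -
  obtain C where C: "C \<ge> 1" "\<And>A B. A \<in> R \<Longrightarrow> B \<in> R \<Longrightarrow> nrm (A * B) \<le> C * nrm A * nrm B"
    using nrm_mult by blast
  have A0: "nrm A \<ge> 0" using A by (rule nrm_nonneg)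
  have "nrm (A ^ k) \<le> nrm 1 * (C * nrm A) ^ k" for k
  proof (induction k)
    case (Suc k)
    have "nrm (A ^ Suc k) \<le> C * nrm A * nrm (A ^ k)" using C(2)[OF A closed'(4)[OF A, of k]] by simp
    also have "\<dots> \<le> C * nrm A * (nrm 1 * (C * nrm A) ^ k)" using C(1) A0 by (intro mult_left_mono Suc) auto
    finally show ?case by (simp add: algebra_simps)
  qed simp
  moreover have "nrm A \<le> C * nrm A" using C(1) A0 mult_right_mono by fastforce
  ultimately show ?thesis by blast
qed

lemma complete:
  assumes "\<And>n. X n \<in> R" and "\<forall>e>0. \<exists>M. \<forall>m\<ge>M. \<forall>n\<ge>M. nrm (X m - X n) < e"
  shows "\<exists>L\<in>R. (\<lambda>n. nrm (X n - L)) \<longlonglongrightarrow> 0"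
proof -
  have "\<forall>X. (\<forall>n. X n \<in> R) \<and> (\<forall>e>0. \<exists>M. \<forall>m\<ge>M. \<forall>n\<ge>M. nrm (X m - X n) < e) \<longrightarrow>
      (\<exists>L\<in>R. (\<lambda>n::nat. nrm (X n - L)) \<longlonglongrightarrow> 0)"
    using sub unfolding banach_subalgebra_def by (elim conjE) assumption
  from spec[OF this, of X] show ?thesis using assms by simp
qed

text \<open>The exponential series converges in the norm of the algebra by completeness, and its sum
  agrees with the limit in operator norm because the latter norm is smaller.\<close>

lemma exp_in:
  assumes A: "A \<in> R"
  shows "exp A \<in> R"
proof -
  obtain b where b: "nrm A \<le> b" "\<And>k. nrm (A ^ k) \<le> nrm 1 * b ^ k" using nrm_power[OF A] by blast
  define f where "f k = A ^ k /\<^sub>R fact k" for k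
  define g where "g k = nrm 1 * (b ^ k /\<^sub>R fact k)" for k
  have fR: "f k \<in> R" for k unfolding f_def by (intro closed' A)
  have fg: "nrm (f k) \<le> g k" for k
    using b(2)[of k] by (simp add: f_def g_def nrm_scaleR closed' A divide_inverse mult.commute[of "inverse _"] mult_right_mono mult.assoc[symmetric])
  have "summable g" unfolding g_def using exp_converges[of b] by (intro summable_mult) (auto simp: sums_iff)
  define X where "X n = (\<Sum>k<n. f k)" for n
  have XR: "X n \<in> R" for n unfolding X_def by (intro closed_sum fR)
  have diff: "nrm (X m - X n) \<le> (\<Sum>k\<in>{min m n..<max m n}. g k)" for m n
  proof -
    have 1: "nrm (X n - X m) \<le> (\<Sum>k\<in>{m..<n}. g k)" if "m \<le> n" for m n
    proof -
      have "X n - X m = (\<Sum>k\<in>{m..<n}. f k)"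
        using that sum.atLeastLessThan_concat[of 0 m n f] by (simp add: X_def atLeast0LessThan[symmetric] algebra_simps)
      then have "nrm (X n - X m) \<le> (\<Sum>k\<in>{m..<n}. nrm (f k))" using nrm_sum[of "{m..<n}" f] fR by simp
      also have "\<dots> \<le> (\<Sum>k\<in>{m..<n}. g k)" by (intro sum_mono fg)
      finally show ?thesis .
    qed
    have sym: "nrm (X m - X n) = nrm (X n - X m)"
      using nrm_scaleR[of "X n - X m" "-1"] closed'(3)[OF XR XR] by simp
    show ?thesis using 1[of m n] 1[of n m] sym by (cases "m \<le> n") (auto simp: min_def max_def)
  qed
  have "\<forall>e>0. \<exists>M. \<forall>m\<ge>M. \<forall>n\<ge>M. nrm (X m - X n) < e"
  proof (intro allI impI)
    fix e :: real assume "e > 0"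
    then obtain M where M: "\<And>m n. m \<ge> M \<Longrightarrow> norm (sum g {m..<n}) < e"
      using \<open>summable g\<close> unfolding summable_Cauchy by blast
    have "nrm (X m - X n) < e" if "m \<ge> M" "n \<ge> M" for m n
      using diff[of m n] M[of "min m n" "max m n"] that by simp
    then show "\<exists>M. \<forall>m\<ge>M. \<forall>n\<ge>M. nrm (X m - X n) < e" by blast
  qed
  then obtain L where L: "L \<in> R" "(\<lambda>n. nrm (X n - L)) \<longlonglongrightarrow> 0"
    using complete[of X] XR by blast
  have "(\<lambda>n. norm (X n - L)) \<longlonglongrightarrow> 0"
    by (rule tendsto_sandwich[OF _ _ tendsto_const L(2)]) (auto simp: norm_le_nrm closed' XR L)
  then have "X \<longlonglongrightarrow> L" by (simp add: tendsto_norm_zero_iff LIM_zero_iff)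
  moreover have "X \<longlonglongrightarrow> exp A"
    using exp_converges[of A] unfolding sums_def X_def f_def .
  ultimately have "L = exp A" by (rule LIMSEQ_unique)
  then show ?thesis using L by simp
qed

lemma exp_prod_in: "set xs \<subseteq> R \<Longrightarrow> exp_prod (\<lambda>X. X) xs \<in> R"
  by (induction xs) (auto intro: closed exp_in)

text \<open>An almost homomorphism is multiplicative up to trace class, with a bilinear bound.
  The index \<open>n\<close> carries the dependence on the section, uniformly in which all bounds hold.\<close>

definition almost_hom :: "(nat \<Rightarrow> int l2op \<Rightarrow> nat l2op) \<Rightarrow> real \<Rightarrow> bool"
  where "almost_hom \<phi> M \<longleftrightarrow> 0 \<le> M \<and>
    (\<forall>n X Y. \<phi> n (X + Y) = \<phi> n X + \<phi> n Y) \<and> (\<forall>n r X. \<phi> n (r *\<^sub>R X) = r *\<^sub>R \<phi> n X) \<and>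
    (\<forall>n X. norm (\<phi> n X) \<le> norm X) \<and> (\<forall>n X. \<phi> n X * \<phi> n 1 = \<phi> n X) \<and>
    (\<forall>n. \<forall>X\<in>R. \<forall>Y\<in>R. trace_bound (\<phi> n (X * Y) - \<phi> n X * \<phi> n Y) (M * nrm X * nrm Y))"

context
  fixes \<phi> :: "nat \<Rightarrow> int l2op \<Rightarrow> nat l2op" and M :: real
  assumes ah: "almost_hom \<phi> M"
begin

lemma \<phi>_linear: "bounded_linear (\<phi> n)"
  using ah unfolding almost_hom_def
  by (intro bounded_linear_intro[where K=1]) auto

lemma \<phi>_norm: "norm (\<phi> n X) \<le> norm X" and \<phi>_one: "\<phi> n X * \<phi> n 1 = \<phi> n X"
  and M0: "0 \<le> M"
  and \<phi>_defect: "X \<in> R \<Longrightarrow> Y \<in> R \<Longrightarrow> trace_bound (\<phi> n (X * Y) - \<phi> n X * \<phi> n Y) (M * nrm X * nrm Y)"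
  using ah by (auto simp: almost_hom_def)

text \<open>The defect of the \<open>k\<close>-th power satisfies a recursion whose inhomogeneous term is a bilinear
  defect; this gives linear growth in \<open>k\<close> times a geometric factor.\<close>

definition defect where "defect n k A = \<phi> n (A ^ k) - \<phi> n 1 * \<phi> n A ^ k"

lemma defect_Suc: "defect n (Suc k) A
    = (\<phi> n (A ^ k * A) - \<phi> n (A ^ k) * \<phi> n A) + defect n k A * \<phi> n A"
  by (simp add: defect_def algebra_simps power_commutes)

lemma defect_bound:
  assumes A: "A \<in> R" and b: "nrm A \<le> b" "\<And>k. nrm (A ^ k) \<le> nrm 1 * b ^ k"
  shows "trace_bound (defect n k A) (real k * (M * nrm 1 * b ^ k))"
proof (induction k)
  case 0
  then show ?case by (simp add: defect_def trace_bound_zero)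
next
  case (Suc k)
  have b0: "b \<ge> 0" using b(1) nrm_nonneg[OF A] by simp
  have n1: "nrm 1 \<ge> 0" by (intro nrm_nonneg closed)
  have "trace_bound (defect n (Suc k) A) (M * nrm (A ^ k) * nrm A + norm (\<phi> n A) * (real k * (M * nrm 1 * b ^ k)))"
    unfolding defect_Suc by (intro trace_bound_add \<phi>_defect trace_bound_mult_right[OF Suc] closed' A)
  moreover have "M * nrm (A ^ k) * nrm A \<le> M * (nrm 1 * b ^ k) * b"
    using b M0 b0 n1 nrm_nonneg[OF A] nrm_nonneg[OF closed'(4)[OF A]]
    by (intro mult_mono mult_left_mono) auto
  moreover have "norm (\<phi> n A) * (real k * (M * nrm 1 * b ^ k)) \<le> b * (real k * (M * nrm 1 * b ^ k))"
    using order_trans[OF \<phi>_norm order_trans[OF norm_le_nrm[OF A] b(1)], of n] M0 b0 n1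
    by (intro mult_right_mono) auto
  ultimately show ?case by (elim trace_bound_mono) (simp add: algebra_simps)
qed

lemma defect_series:
  shows "(\<lambda>k. defect n k A /\<^sub>R fact k) sums (\<phi> n (exp A) - \<phi> n 1 * exp (\<phi> n A))"
proof -
  have "(\<lambda>k. \<phi> n (A ^ k /\<^sub>R fact k)) sums \<phi> n (exp A)"
    by (rule bounded_linear.sums[OF \<phi>_linear exp_converges])
  moreover have "(\<lambda>k. \<phi> n 1 * (\<phi> n A ^ k /\<^sub>R fact k)) sums (\<phi> n 1 * exp (\<phi> n A))"
    by (rule sums_mult[OF exp_converges])
  ultimately have "(\<lambda>k. \<phi> n (A ^ k /\<^sub>R fact k) - \<phi> n 1 * (\<phi> n A ^ k /\<^sub>R fact k))
      sums (\<phi> n (exp A) - \<phi> n 1 * exp (\<phi> n A))" by (rule sums_diff)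
  moreover have "\<phi> n (r *\<^sub>R X) = r *\<^sub>R \<phi> n X" for r X using ah by (simp add: almost_hom_def)
  ultimately show ?thesis by (simp add: defect_def scaleR_diff_right)
qed

lemma defect_summable_bound: "summable (\<lambda>k. real k * (M * nrm 1 * b ^ k) / fact k)"
proof -
  have "summable (\<lambda>k. M * nrm 1 * b * (b ^ k /\<^sub>R fact k))"
    using exp_converges[of b] by (intro summable_mult) (auto simp: sums_iff)
  moreover have "real (Suc k) * (M * nrm 1 * b ^ Suc k) / fact (Suc k) = M * nrm 1 * b * (b ^ k /\<^sub>R fact k)" for k
  proof -
    have "real (Suc k) * c / fact (Suc k) = c / fact k" for c :: real by (simp del: of_nat_Suc)
    then have "real (Suc k) * (M * nrm 1 * b ^ Suc k) / fact (Suc k) = (M * nrm 1 * b ^ Suc k) / fact k" .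
    then show ?thesis by (simp only: power_Suc real_scaleR_def divide_inverse mult_ac)
  qed
  ultimately have "summable (\<lambda>k. real (Suc k) * (M * nrm 1 * b ^ Suc k) / fact (Suc k))" by simp
  then show ?thesis by (subst (asm) summable_Suc_iff)
qed

lemma exp_defect_bounded:
  assumes A: "A \<in> R"
  shows "\<exists>C. \<forall>n. trace_bound (\<phi> n (exp A) - \<phi> n 1 * exp (\<phi> n A)) C"
proof -
  obtain b where b: "nrm A \<le> b" "\<And>k. nrm (A ^ k) \<le> nrm 1 * b ^ k" using nrm_power[OF A] by blast
  have "trace_bound (defect n k A /\<^sub>R fact k) (real k * (M * nrm 1 * b ^ k) / fact k)" for n k
    using trace_bound_scaleR[OF defect_bound[OF A b], of "inverse (fact k)" n k] by (simp add: divide_inverse mult.commute)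
  then have "trace_bound (\<phi> n (exp A) - \<phi> n 1 * exp (\<phi> n A)) (\<Sum>k. real k * (M * nrm 1 * b ^ k) / fact k)" for n
    unfolding sums_unique[OF defect_series]
    by (intro trace_bound_suminf[OF sums_summable[OF defect_series] defect_summable_bound])
  then show ?thesis by blast
qed

lemma exp_prod_snoc_defect:
  "\<phi> n (X * exp B) - \<phi> n 1 * (Y * exp (\<phi> n B))
    = (\<phi> n (X * exp B) - \<phi> n X * \<phi> n (exp B))
      + \<phi> n X * (\<phi> n (exp B) - \<phi> n 1 * exp (\<phi> n B)) + (\<phi> n X - \<phi> n 1 * Y) * exp (\<phi> n B)"
proof -
  have "\<phi> n X * (\<phi> n 1 * exp (\<phi> n B)) = \<phi> n X * exp (\<phi> n B)"
    by (simp only: mult.assoc[symmetric] \<phi>_one)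
  then show ?thesis by (simp add: algebra_simps)
qed

lemma exp_prod_defect_bounded:
  assumes "set xs \<subseteq> R"
  shows "\<exists>C. \<forall>n. trace_bound (\<phi> n (exp_prod (\<lambda>X. X) xs) - \<phi> n 1 * exp_prod (\<phi> n) xs) C"
  using assms
proof (induction xs rule: rev_induct)
  case Nil
  then show ?case using trace_bound_zero by auto
next
  case (snoc B xs)
  let ?X = "exp_prod (\<lambda>X. X) xs"
  have B: "B \<in> R" and X: "?X \<in> R" using snoc.prems by (auto intro: exp_prod_in)
  obtain C1 where C1: "\<And>n. trace_bound (\<phi> n ?X - \<phi> n 1 * exp_prod (\<phi> n) xs) C1" using snoc by auto
  obtain C2 where C2: "\<And>n. trace_bound (\<phi> n (exp B) - \<phi> n 1 * exp (\<phi> n B)) C2"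
    using exp_defect_bounded[OF B] by blast
  have c: "0 \<le> C1" "0 \<le> C2" using trace_bound_nonneg[OF C1] trace_bound_nonneg[OF C2] by auto
  have "trace_bound (\<phi> n (exp_prod (\<lambda>X. X) (xs @ [B])) - \<phi> n 1 * exp_prod (\<phi> n) (xs @ [B]))
      (M * nrm ?X * nrm (exp B) + norm ?X * C2 + exp (norm B) * C1)" for n
  proof -
    have "trace_bound (\<phi> n ?X * (\<phi> n (exp B) - \<phi> n 1 * exp (\<phi> n B))) (norm ?X * C2)"
      by (rule trace_bound_mono[OF trace_bound_mult_left[OF C2]]) (intro mult_right_mono \<phi>_norm c)
    moreover have "norm (exp (\<phi> n B)) \<le> exp (norm B)"
      by (rule order_trans[OF norm_exp]) (simp add: \<phi>_norm)
    then have "trace_bound ((\<phi> n ?X - \<phi> n 1 * exp_prod (\<phi> n) xs) * exp (\<phi> n B)) (exp (norm B) * C1)"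
      by (intro trace_bound_mono[OF trace_bound_mult_right[OF C1]] mult_right_mono c)
    ultimately have "trace_bound (\<phi> n (?X * exp B) - \<phi> n 1 * (exp_prod (\<phi> n) xs * exp (\<phi> n B)))
        (M * nrm ?X * nrm (exp B) + norm ?X * C2 + exp (norm B) * C1)"
      unfolding exp_prod_snoc_defect by (intro trace_bound_add \<phi>_defect X exp_in B)
    then show ?thesis by simp
  qed
  then show ?case by blast
qed

text \<open>If moreover the maps and their bilinear defects converge, so do the defects of products of
  exponentials. The recursion above gives convergence term by term, and the uniform bounds
  allow summation.\<close>

context
  fixes \<psi> :: "int l2op \<Rightarrow> nat l2op"
  assumes \<psi>: "\<And>X. X \<in> R \<Longrightarrow> (\<lambda>n. \<phi> n X) \<longlonglongrightarrow> \<psi> X"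
    and \<psi>_defect: "\<And>X Y. X \<in> R \<Longrightarrow> Y \<in> R \<Longrightarrow>
      trace_tendsto (\<lambda>n. \<phi> n (X * Y) - \<phi> n X * \<phi> n Y) (\<psi> (X * Y) - \<psi> X * \<psi> Y)"
begin

lemma trace_tendsto_trace_bound:
  assumes "trace_tendsto K L" "\<And>n. trace_bound (K n) C"
  shows "trace_bound L C"
  using trace_bound_limit[OF trace_tendsto_entry[OF assms(1)] assms(2)] .

lemma defect_trace_tendsto:
  assumes A: "A \<in> R"
  shows "trace_tendsto (\<lambda>n. defect n k A) (\<psi> (A ^ k) - \<psi> 1 * \<psi> A ^ k)"
proof (induction k)
  case 0
  then show ?case by (simp add: defect_def trace_tendsto_zero)
next
  case (Suc k)
  obtain b where b: "nrm A \<le> b" "\<And>k. nrm (A ^ k) \<le> nrm 1 * b ^ k" using nrm_power[OF A] by blast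
  have "trace_tendsto (\<lambda>n. defect n k A * \<phi> n A) ((\<psi> (A ^ k) - \<psi> 1 * \<psi> A ^ k) * \<psi> A)"
    by (rule trace_tendsto_mult_right[OF Suc trace_tendsto_trace_bound[OF Suc defect_bound[OF A b]] \<psi>[OF A]])
  from trace_tendsto_add[OF \<psi>_defect[OF closed'(4)[OF A, of k] A] this] show ?case
    by (simp add: defect_Suc algebra_simps power_commutes)
qed

lemma exp_defect_trace_tendsto:
  assumes A: "A \<in> R"
  shows "trace_tendsto (\<lambda>n. \<phi> n (exp A) - \<phi> n 1 * exp (\<phi> n A)) (\<psi> (exp A) - \<psi> 1 * exp (\<psi> A))"
proof -
  obtain b where b: "nrm A \<le> b" "\<And>k. nrm (A ^ k) \<le> nrm 1 * b ^ k" using nrm_power[OF A] by blast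
  have eq: "\<phi> n (exp A) - \<phi> n 1 * exp (\<phi> n A) = (\<Sum>k. defect n k A /\<^sub>R fact k)" for n
    by (rule sums_unique[OF defect_series])
  have lim: "(\<lambda>n. \<phi> n (exp A) - \<phi> n 1 * exp (\<phi> n A)) \<longlonglongrightarrow> \<psi> (exp A) - \<psi> 1 * exp (\<psi> A)"
    by (intro tendsto_intros tendsto_exp_l2op \<psi> A exp_in closed)
  show ?thesis
    unfolding eq
  proof (rule trace_tendsto_suminf[OF sums_summable[OF defect_series] _ defect_summable_bound[of b]])
    show "(\<lambda>n. \<Sum>k. defect n k A /\<^sub>R fact k) \<longlonglongrightarrow> \<psi> (exp A) - \<psi> 1 * exp (\<psi> A)"
      using lim unfolding eq .
    show "trace_bound (defect n k A /\<^sub>R fact k) (real k * (M * nrm 1 * b ^ k) / fact k)" for n k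
      using trace_bound_scaleR[OF defect_bound[OF A b], of "inverse (fact k)" n k] by (simp add: divide_inverse mult.commute)
    show "trace_tendsto (\<lambda>n. defect n k A /\<^sub>R fact k) ((\<psi> (A ^ k) - \<psi> 1 * \<psi> A ^ k) /\<^sub>R fact k)" for k
      by (intro trace_tendsto_scaleR defect_trace_tendsto A)
  qed
qed

lemma exp_prod_defect_trace_tendsto:
  assumes "set xs \<subseteq> R"
  shows "trace_tendsto (\<lambda>n. \<phi> n (exp_prod (\<lambda>X. X) xs) - \<phi> n 1 * exp_prod (\<phi> n) xs)
    (\<psi> (exp_prod (\<lambda>X. X) xs) - \<psi> 1 * exp_prod \<psi> xs)"
  using assms
proof (induction xs rule: rev_induct)
  case Nil
  then show ?case by (simp add: trace_tendsto_zero)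
next
  case (snoc B xs)
  let ?X = "exp_prod (\<lambda>X. X) xs"
  have B: "B \<in> R" and X: "?X \<in> R" and xs: "set xs \<subseteq> R" using snoc.prems by (auto intro: exp_prod_in)
  note IH = snoc.IH[OF xs]
  obtain C1 where C1: "\<And>n. trace_bound (\<phi> n ?X - \<phi> n 1 * exp_prod (\<phi> n) xs) C1"
    using exp_prod_defect_bounded[OF xs] by blast
  obtain C2 where C2: "\<And>n. trace_bound (\<phi> n (exp B) - \<phi> n 1 * exp (\<phi> n B)) C2"
    using exp_defect_bounded[OF B] by blast
  have "\<psi> ?X * \<psi> 1 = \<psi> ?X"
  proof (rule LIMSEQ_unique)
    show "(\<lambda>n. \<phi> n ?X * \<phi> n 1) \<longlonglongrightarrow> \<psi> ?X * \<psi> 1" by (intro tendsto_mult \<psi> X closed)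
    show "(\<lambda>n. \<phi> n ?X * \<phi> n 1) \<longlonglongrightarrow> \<psi> ?X" unfolding \<phi>_one by (rule \<psi>[OF X])
  qed
  then have eq: "\<psi> (?X * exp B) - \<psi> 1 * (exp_prod \<psi> xs * exp (\<psi> B))
      = (\<psi> (?X * exp B) - \<psi> ?X * \<psi> (exp B))
        + \<psi> ?X * (\<psi> (exp B) - \<psi> 1 * exp (\<psi> B)) + (\<psi> ?X - \<psi> 1 * exp_prod \<psi> xs) * exp (\<psi> B)"
    by (simp add: right_diff_distrib left_diff_distrib mult.assoc[symmetric])
  have "trace_tendsto (\<lambda>n. \<phi> n ?X * (\<phi> n (exp B) - \<phi> n 1 * exp (\<phi> n B))) (\<psi> ?X * (\<psi> (exp B) - \<psi> 1 * exp (\<psi> B)))"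
    by (rule trace_tendsto_mult_left[OF exp_defect_trace_tendsto[OF B] trace_tendsto_trace_bound[OF exp_defect_trace_tendsto[OF B] C2] \<psi>[OF X]])
  moreover have "trace_tendsto (\<lambda>n. (\<phi> n ?X - \<phi> n 1 * exp_prod (\<phi> n) xs) * exp (\<phi> n B))
      ((\<psi> ?X - \<psi> 1 * exp_prod \<psi> xs) * exp (\<psi> B))"
    by (rule trace_tendsto_mult_right[OF IH trace_tendsto_trace_bound[OF IH C1] tendsto_exp_l2op[OF \<psi>[OF B]]])
  ultimately have "trace_tendsto (\<lambda>n. \<phi> n (?X * exp B) - \<phi> n 1 * (exp_prod (\<phi> n) xs * exp (\<phi> n B)))
      (\<psi> (?X * exp B) - \<psi> 1 * (exp_prod \<psi> xs * exp (\<psi> B)))"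
    unfolding exp_prod_snoc_defect eq
    by (intro trace_tendsto_add \<psi>_defect X exp_in B)
  then show ?case by simp
qed

end

end

end

section \<open>Shifted Toeplitz operators along fractal sequences\<close>

lemma trace_tendstoI:
  assumes "\<And>n. trace_bound (K n - L) (a n)" "a \<longlonglongrightarrow> 0"
  shows "trace_tendsto K L"
  unfolding trace_tendsto_def
proof (intro allI impI)
  fix e :: real assume "e > 0"
  then have "\<forall>\<^sub>F n in sequentially. a n < e" using assms(2) by (intro order_tendstoD) auto
  then show "\<forall>\<^sub>F n in sequentially. trace_bound (K n - L) e"
    by eventually_elim (rule trace_bound_mono[OF assms(1)], simp)
qed

context suitable_algebra
begin

lemma hankel_bound:
  "\<exists>M\<ge>0. \<forall>A\<in>R. \<forall>B\<in>R. trace_bound (H_op A * H_op (flip B)) (M * nrm A * nrm B) \<and>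
    trace_bound (H_op (flip A) * H_op B) (M * nrm A * nrm B)"
proof -
  obtain M where M: "M > 0" "\<And>A B. A \<in> R \<Longrightarrow> B \<in> R \<Longrightarrow>
      max (trace_norm (H_op A * H_op (flip B))) (trace_norm (H_op (flip A) * H_op B)) \<le> M * nrm A * nrm B"
    using suit unfolding suitable_def by blast
  have "trace_bound (H_op A * H_op (flip B)) (M * nrm A * nrm B) \<and> trace_bound (H_op (flip A) * H_op B) (M * nrm A * nrm B)"
    if "A \<in> R" "B \<in> R" for A B
  proof -
    have "trace_class (H_op A * H_op (flip B))" "trace_class (H_op (flip A) * H_op B)"
      using suit that by (auto simp: suitable_def)
    then show ?thesis using M(2)[OF that] trace_class_trace_bound trace_bound_mono by (meson max.boundedE)
  qed
  then show ?thesis using M(1) by (intro exI[of _ M]) auto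
qed

lemma toeplitz_defect:
  "T_op (shift (X * Y) n) - T_op (shift X n) * T_op (shift Y n) = H_op (shift X n) * H_op (flip (shift Y n))"
  by (simp add: shift_simps T_op_mult)

lemma toeplitz_almost_hom: "\<exists>M. \<forall>h. almost_hom (\<lambda>n X. T_op (shift X (h n))) M"
proof -
  obtain M where M: "M \<ge> 0" "\<And>A B. A \<in> R \<Longrightarrow> B \<in> R \<Longrightarrow> trace_bound (H_op A * H_op (flip B)) (M * nrm A * nrm B)"
    using hankel_bound by blast
  have "trace_bound (T_op (shift (X * Y) m) - T_op (shift X m) * T_op (shift Y m)) (M * nrm X * nrm Y)"
    if "X \<in> R" "Y \<in> R" for X Y m
    using M(2)[OF shift_in[OF that(1), of m] shift_in[OF that(2), of m]] that
    by (simp add: toeplitz_defect nrm_shift)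
  moreover have "norm (T_op (shift X m)) \<le> norm X" for X m
    by (rule order_trans[OF norm_T_op_le norm_shift_le])
  ultimately show ?thesis using M(1) unfolding almost_hom_def
    by (intro exI[of _ M]) (simp add: shift_simps T_op_simps)
qed

text \<open>Truncation to an interval loses what passes through indices below and beyond it, and each of
  the two losses is a Hankel product. This explains the factor two in the bound.\<close>

lemma section_almost_hom:
  "\<exists>M. \<forall>h N. almost_hom (\<lambda>n X. Pn (N n) * T_op (shift X (h n)) * Pn (N n)) M"
proof -
  obtain M where M: "M \<ge> 0" "\<And>A B. A \<in> R \<Longrightarrow> B \<in> R \<Longrightarrow> trace_bound (H_op A * H_op (flip B)) (M * nrm A * nrm B)"
    "\<And>A B. A \<in> R \<Longrightarrow> B \<in> R \<Longrightarrow> trace_bound (H_op (flip A) * H_op B) (M * nrm A * nrm B)"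
    using hankel_bound by blast
  have PP: "Pn N * (Pn N * A) = Pn N * A" for N A by (simp flip: mult.assoc)
  have contr: "trace_bound (A * K * B) C" if K: "trace_bound K C" and "norm A \<le> 1" "norm B \<le> 1" for A K B C
  proof -
    have "trace_bound (A * K) (norm A * C)" by (rule trace_bound_mult_left[OF K])
    then have "trace_bound (A * K) C" by (rule trace_bound_mono) (use that trace_bound_nonneg[OF K] in \<open>simp add: mult_left_le_one_le\<close>)
    then have "trace_bound (A * K * B) (norm B * C)" by (rule trace_bound_mult_right)
    then show ?thesis by (rule trace_bound_mono) (use that trace_bound_nonneg[OF K] in \<open>simp add: mult_left_le_one_le\<close>)
  qed
  have nUJ: "norm (on_nat (U_op (int N) * J_op)) \<le> 1" for N
  proof -
    have "norm (on_nat (U_op (int N) * J_op)) \<le> norm (U_op (int N)) * norm J_op"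
      by (rule order_trans[OF norm_on_nat_le norm_mult_ineq])
    also have "\<dots> \<le> 1 * 1" by (intro mult_mono norm_U_op_le norm_J_op_le) auto
    finally show ?thesis by simp
  qed
  have defect: "trace_bound (Pn N * T_op (shift (X * Y) m) * Pn N
      - Pn N * T_op (shift X m) * Pn N * (Pn N * T_op (shift Y m) * Pn N)) (2 * M * nrm X * nrm Y)"
    if X: "X \<in> R" and Y: "Y \<in> R" for X Y m N
  proof -
    let ?X = "shift X m" and ?Y = "shift Y m"
    have R: "?X \<in> R" "?Y \<in> R" using X Y by (auto intro: shift_in)
    have "Pn N * T_op (shift (X * Y) m) * Pn N - Pn N * T_op ?X * Pn N * (Pn N * T_op ?Y * Pn N)
        = Pn N * (H_op ?X * H_op (flip ?Y)) * Pn N + Pn N * T_op ?X * (1 - Pn N) * T_op ?Y * Pn N"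
      by (simp add: shift_simps T_op_mult algebra_simps PP)
    moreover have 1: "trace_bound (Pn N * (H_op ?X * H_op (flip ?Y)) * Pn N) (M * nrm X * nrm Y)"
      using contr[OF M(2)[OF R]] X Y by (simp add: nrm_shift norm_proj_op_le)
    moreover have 2: "trace_bound (Pn N * T_op ?X * (1 - Pn N) * T_op ?Y * Pn N) (M * nrm X * nrm Y)"
      unfolding section_reflect
      using contr[OF M(3)[OF shift_in[OF R(1)] shift_in[OF R(2)]] nUJ nUJ] X Y R by (simp add: nrm_shift)
    ultimately show ?thesis using trace_bound_add[OF 1 2] by (simp add: mult.assoc[where 'a=real])
  qed
  have "norm (Pn N * T_op (shift X m) * Pn N) \<le> norm X" for X m N
    by (meson norm_Pn_mult_le norm_T_op_le norm_shift_le order_trans)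
  then show ?thesis using M(1) defect unfolding almost_hom_def
    by (intro exI[of _ "2 * M"]) (simp add: shift_simps T_op_simps distrib_left distrib_right mult.assoc PP)
qed

context
  fixes h :: "nat \<Rightarrow> int" and U :: "int l2op \<Rightarrow> int l2op"
  assumes fr: "fractal R nrm h U"
begin

lemma U_in: "X \<in> R \<Longrightarrow> U X \<in> R"
  and U_nrm: "X \<in> R \<Longrightarrow> (\<lambda>n. nrm (shift X (h n) - U X)) \<longlonglongrightarrow> 0"
  using fr by (auto simp: fractal_def shift_def)

lemma U_tendsto: "X \<in> R \<Longrightarrow> (\<lambda>n. shift X (h n)) \<longlonglongrightarrow> U X"
proof -
  assume X: "X \<in> R"
  have "(\<lambda>n. norm (shift X (h n) - U X)) \<longlonglongrightarrow> 0"
    by (rule tendsto_sandwich[OF _ _ tendsto_const U_nrm[OF X]])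
      (simp, intro always_eventually allI norm_le_nrm closed'(3) shift_in U_in X)
  then show ?thesis by (simp add: tendsto_norm_zero_iff LIM_zero_iff)
qed

lemma U_mult: "X \<in> R \<Longrightarrow> Y \<in> R \<Longrightarrow> U (X * Y) = U X * U Y"
  using LIMSEQ_unique[OF U_tendsto[of "X * Y"] tendsto_mult[OF U_tendsto[of X] U_tendsto[of Y], folded shift_simps(4)]]
  by (simp add: closed)

lemma U_uminus: "X \<in> R \<Longrightarrow> U (- X) = - U X"
proof -
  assume X: "X \<in> R"
  have "shift (- X) m = - shift X m" for m by (simp add: shift_def)
  then have "(\<lambda>n. shift (- X) (h n)) \<longlonglongrightarrow> - U X" using tendsto_minus[OF U_tendsto[OF X]] by simp
  then show ?thesis using U_tendsto[OF closed'(2)[OF X]] LIMSEQ_unique by blast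
qed

lemma U_one: "U 1 = 1"
  using LIMSEQ_unique[OF U_tendsto[OF closed(2)], of 1] by (simp add: shift_simps)

lemma T_op_U_tendsto: "X \<in> R \<Longrightarrow> (\<lambda>n. T_op (shift X (h n))) \<longlonglongrightarrow> T_op (U X)"
proof -
  have "bounded_linear T_op"
    by (rule bounded_linear_intro[where K=1]) (auto simp: T_op_simps norm_T_op_le)
  then show "X \<in> R \<Longrightarrow> (\<lambda>n. T_op (shift X (h n))) \<longlonglongrightarrow> T_op (U X)"
    by (intro bounded_linear.tendsto[where f=T_op] U_tendsto)
qed

lemma T_op_U_defect_trace_tendsto:
  assumes X: "X \<in> R" and Y: "Y \<in> R"
  shows "trace_tendsto (\<lambda>n. T_op (shift (X * Y) (h n)) - T_op (shift X (h n)) * T_op (shift Y (h n)))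
    (T_op (U (X * Y)) - T_op (U X) * T_op (U Y))"
proof -
  obtain M where M: "M \<ge> 0" "\<And>A B. A \<in> R \<Longrightarrow> B \<in> R \<Longrightarrow> trace_bound (H_op A * H_op (flip B)) (M * nrm A * nrm B)"
    using hankel_bound by blast
  let ?X = "\<lambda>n. shift X (h n)" and ?Y = "\<lambda>n. shift Y (h n)"
  have lim: "T_op (U (X * Y)) - T_op (U X) * T_op (U Y) = H_op (U X) * H_op (flip (U Y))"
    by (simp add: U_mult X Y T_op_mult)
  show ?thesis
    unfolding toeplitz_defect lim
  proof (rule trace_tendstoI)
    show "trace_bound (H_op (?X n) * H_op (flip (?Y n)) - H_op (U X) * H_op (flip (U Y)))
        (M * nrm (?X n - U X) * nrm Y + M * nrm (U X) * nrm (?Y n - U Y))" for n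
    proof -
      have "H_op (?X n) * H_op (flip (?Y n)) - H_op (U X) * H_op (flip (U Y))
          = H_op (?X n - U X) * H_op (flip (?Y n)) + H_op (U X) * H_op (flip (?Y n - U Y))"
        by (simp add: H_op_diff algebra_simps)
      moreover have "trace_bound \<dots> (M * nrm (?X n - U X) * nrm (?Y n) + M * nrm (U X) * nrm (?Y n - U Y))"
        by (intro trace_bound_add M closed' shift_in U_in X Y)
      ultimately show ?thesis by (simp add: nrm_shift Y)
    qed
    have "(\<lambda>n. M * nrm (?X n - U X) * nrm Y + M * nrm (U X) * nrm (?Y n - U Y))
        \<longlonglongrightarrow> M * 0 * nrm Y + M * nrm (U X) * 0"
      by (intro tendsto_intros U_nrm X Y)
    then show "(\<lambda>n. M * nrm (?X n - U X) * nrm Y + M * nrm (U X) * nrm (?Y n - U Y)) \<longlonglongrightarrow> 0" by simp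
  qed
qed

lemma toeplitz_exp_prod_trace_tendsto:
  assumes "set xs \<subseteq> R"
  shows "trace_tendsto (\<lambda>n. T_op (shift (exp_prod (\<lambda>X. X) xs) (h n)) - exp_prod (\<lambda>X. T_op (shift X (h n))) xs)
      (T_op (U (exp_prod (\<lambda>X. X) xs)) - exp_prod (\<lambda>X. T_op (U X)) xs)"
    and "\<exists>C. trace_bound (T_op (U (exp_prod (\<lambda>X. X) xs)) - exp_prod (\<lambda>X. T_op (U X)) xs) C"
    and "\<exists>C. \<forall>n. trace_bound (T_op (shift (exp_prod (\<lambda>X. X) xs) (h n)) - exp_prod (\<lambda>X. T_op (shift X (h n))) xs) C"
proof -
  obtain M where M: "almost_hom (\<lambda>n X. T_op (shift X (h n))) M" using toeplitz_almost_hom by blast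
  have one: "T_op (shift 1 m) = 1" "T_op (U 1) = 1" for m by (simp_all add: shift_simps T_op_simps U_one)
  note t = exp_prod_defect_trace_tendsto[OF M T_op_U_tendsto T_op_U_defect_trace_tendsto assms, unfolded one mult_1_left]
  show "trace_tendsto (\<lambda>n. T_op (shift (exp_prod (\<lambda>X. X) xs) (h n)) - exp_prod (\<lambda>X. T_op (shift X (h n))) xs)
      (T_op (U (exp_prod (\<lambda>X. X) xs)) - exp_prod (\<lambda>X. T_op (U X)) xs)"
    by (rule t)
  show b: "\<exists>C. \<forall>n. trace_bound (T_op (shift (exp_prod (\<lambda>X. X) xs) (h n)) - exp_prod (\<lambda>X. T_op (shift X (h n))) xs) C"
    using exp_prod_defect_bounded[OF M assms] by (simp add: one)
  then show "\<exists>C. trace_bound (T_op (U (exp_prod (\<lambda>X. X) xs)) - exp_prod (\<lambda>X. T_op (U X)) xs) C"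
    using trace_bound_limit[OF trace_tendsto_entry[OF t]] by blast
qed

text \<open>With \<open>W\<close> the ordered product of the exponentials, \<open>T(A) W\<^sup>-\<^sup>1 - I = (T(A) - W) W\<^sup>-\<^sup>1\<close>: the first
  factor converges in trace norm, the second in operator norm.\<close>

lemma left_operator_limit:
  assumes xs: "set xs \<subseteq> R"
  defines "A \<equiv> exp_prod (\<lambda>X. X) xs"
  defines "B \<equiv> T_op (U A) * exp_prod_inv (\<lambda>X. T_op (U X)) xs"
  shows "\<exists>C. trace_bound (B - 1) C"
    and "(\<lambda>n. fredholm_det (T_op (shift A (h n)) * exp_prod_inv (\<lambda>X. T_op (shift X (h n))) xs))
      \<longlonglongrightarrow> fredholm_det B"
    and "\<exists>c. trace_bound (T_op (shift A (h n)) * exp_prod_inv (\<lambda>X. T_op (shift X (h n))) xs - 1) c"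
proof -
  have eq: "(Z - exp_prod Y xs) * exp_prod_inv Y xs = Z * exp_prod_inv Y xs - 1" for Z and Y :: "int l2op \<Rightarrow> nat l2op"
    by (simp add: left_diff_distrib exp_prod_inverse)
  obtain C where C: "trace_bound (T_op (U A) - exp_prod (\<lambda>X. T_op (U X)) xs) C"
    using toeplitz_exp_prod_trace_tendsto(2)[OF xs] by (auto simp: A_def)
  have inv: "(\<lambda>n. exp_prod_inv (\<lambda>X. T_op (shift X (h n))) xs) \<longlonglongrightarrow> exp_prod_inv (\<lambda>X. T_op (U X)) xs"
    by (rule tendsto_exp_prod) (use xs in \<open>auto intro!: tendsto_minus T_op_U_tendsto\<close>)
  have t: "trace_tendsto (\<lambda>n. T_op (shift A (h n)) * exp_prod_inv (\<lambda>X. T_op (shift X (h n))) xs - 1) (B - 1)"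
    using trace_tendsto_mult_right[OF toeplitz_exp_prod_trace_tendsto(1)[OF xs, folded A_def] C inv] by (simp only: eq B_def)
  have tB: "trace_bound (B - 1) (norm (exp_prod_inv (\<lambda>X. T_op (U X)) xs) * C)"
    using trace_bound_mult_right[OF C, of "exp_prod_inv (\<lambda>X. T_op (U X)) xs"] by (simp only: eq B_def)
  then show "\<exists>C. trace_bound (B - 1) C" by blast
  show "(\<lambda>n. fredholm_det (T_op (shift A (h n)) * exp_prod_inv (\<lambda>X. T_op (shift X (h n))) xs))
      \<longlonglongrightarrow> fredholm_det B"
    using fredholm_det_trace_tendsto[OF t tB] by simp
  obtain C' where C': "\<And>n. trace_bound (T_op (shift A (h n)) - exp_prod (\<lambda>X. T_op (shift X (h n))) xs) C'"
    using toeplitz_exp_prod_trace_tendsto(3)[OF xs] by (auto simp: A_def)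
  let ?E = "exp_prod_inv (\<lambda>X. T_op (shift X (h n))) xs"
  have "trace_bound (T_op (shift A (h n)) * ?E - 1) (norm ?E * C')"
    using trace_bound_mult_right[OF C'[of n], of ?E] by (simp only: eq)
  then show "\<exists>c. trace_bound (T_op (shift A (h n)) * ?E - 1) c" by blast
qed

text \<open>The inverse of the symbol is again a product of exponentials, of the negatives in reversed
  order.\<close>

lemma right_operator_limit:
  assumes xs: "set xs \<subseteq> R"
  defines "A' \<equiv> exp_prod_inv (\<lambda>X. X) xs"
  defines "B \<equiv> exp_prod (\<lambda>X. T_op (U X)) xs * T_op (U A')"
  shows "\<exists>C. trace_bound (B - 1) C"
    and "(\<lambda>n. fredholm_det (exp_prod (\<lambda>X. T_op (shift X (h n))) xs * T_op (shift A' (h n))))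
      \<longlonglongrightarrow> fredholm_det B"
    and "\<exists>c. trace_bound (exp_prod (\<lambda>X. T_op (shift X (h n))) xs * T_op (shift A' (h n)) - 1) c"
proof -
  let ?ys = "map uminus (rev xs)"
  have ys: "set ?ys \<subseteq> R" using xs by (auto intro: closed')
  have A': "A' = exp_prod (\<lambda>X. X) ?ys" by (simp add: A'_def o_def)
  have "shift (- X) m = - shift X m" for X m by (simp add: shift_def)
  moreover have T_neg: "T_op (- X) = - T_op X" for X using T_op_simps(3)[of "-1" X] by simp
  ultimately have 1: "exp_prod (\<lambda>X. T_op (shift X m)) ?ys = exp_prod_inv (\<lambda>X. T_op (shift X m)) xs" for m
    by (simp add: o_def)
  have "T_op (U (- X)) = - T_op (U X)" if "X \<in> set xs" for X
    using that xs by (simp add: U_uminus T_neg subset_iff)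
  then have 2: "exp_prod (\<lambda>X. T_op (U X)) ?ys = exp_prod_inv (\<lambda>X. T_op (U X)) xs"
    by (auto simp: o_def intro!: arg_cong[where f=prod_list])
  have eq: "exp_prod Y xs * (Z - exp_prod_inv Y xs) = exp_prod Y xs * Z - 1" for Z and Y :: "int l2op \<Rightarrow> nat l2op"
    by (simp add: right_diff_distrib exp_prod_inverse)
  note t0 = toeplitz_exp_prod_trace_tendsto[OF ys, folded A', unfolded 1 2]
  obtain C where C: "trace_bound (T_op (U A') - exp_prod_inv (\<lambda>X. T_op (U X)) xs) C" using t0(2) by blast
  have lim: "(\<lambda>n. exp_prod (\<lambda>X. T_op (shift X (h n))) xs) \<longlonglongrightarrow> exp_prod (\<lambda>X. T_op (U X)) xs"
    by (rule tendsto_exp_prod) (use xs in \<open>auto intro!: T_op_U_tendsto\<close>)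
  have t: "trace_tendsto (\<lambda>n. exp_prod (\<lambda>X. T_op (shift X (h n))) xs * T_op (shift A' (h n)) - 1) (B - 1)"
    using trace_tendsto_mult_left[OF t0(1) C lim] by (simp only: eq B_def)
  have tB: "trace_bound (B - 1) (norm (exp_prod (\<lambda>X. T_op (U X)) xs) * C)"
    using trace_bound_mult_left[OF C, of "exp_prod (\<lambda>X. T_op (U X)) xs"] by (simp only: eq B_def)
  then show "\<exists>C. trace_bound (B - 1) C" by blast
  show "(\<lambda>n. fredholm_det (exp_prod (\<lambda>X. T_op (shift X (h n))) xs * T_op (shift A' (h n))))
      \<longlonglongrightarrow> fredholm_det B"
    using fredholm_det_trace_tendsto[OF t tB] by simp
  obtain C' where C': "\<And>n. trace_bound (T_op (shift A' (h n)) - exp_prod_inv (\<lambda>X. T_op (shift X (h n))) xs) C'"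
    using t0(3) by blast
  let ?E = "exp_prod (\<lambda>X. T_op (shift X (h n))) xs"
  have "trace_bound (?E * T_op (shift A' (h n)) - 1) (norm ?E * C')"
    using trace_bound_mult_left[OF C'[of n], of ?E] by (simp only: eq)
  then show "\<exists>c. trace_bound (?E * T_op (shift A' (h n)) - 1) c" by blast
qed

end

section \<open>The limit of the section determinants\<close>

text \<open>The exact identity expresses the product of the determinants of the two corner operators as the
  wanted quotient, perturbed by \<open>D n\<close>. The factor \<open>M (I - P\<^sub>N)\<close> of \<open>D n\<close> is a tail of a sequence
  convergent in trace norm, and the unperturbed operators \<open>I + X n\<close> stay bounded in trace norm.\<close>

lemma section_ratio_limit:
  assumes fr1: "fractal R nrm h1 U1" and fr2: "fractal R nrm h2 U2"
    and pos: "\<And>n. h2 n - h1 n > 0" and lim: "filterlim (\<lambda>n. h2 n - h1 n) at_top sequentially"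
    and xs: "set xs \<subseteq> R"
  defines "A \<equiv> exp_prod (\<lambda>X. X) xs" and "A' \<equiv> exp_prod_inv (\<lambda>X. X) xs"
    and "N \<equiv> \<lambda>n. nat (h2 n - h1 n)"
  shows "(\<lambda>n. sdet (N n) (T_op (shift A (h1 n)))
      * exp (- (\<Sum>X\<leftarrow>xs. \<Sum>i<N n. entry (T_op (shift X (h1 n))) i i)))
    \<longlonglongrightarrow> fredholm_det (T_op (U1 A) * exp_prod_inv (\<lambda>X. T_op (U1 X)) xs)
      * fredholm_det (exp_prod (\<lambda>X. T_op (U2 X)) xs * T_op (U2 A'))"
proof -
  define \<phi> where "\<phi> n X = T_op (shift X (h1 n))" for n X
  define b1 where "b1 n = fredholm_det (\<phi> n A * exp_prod_inv (\<phi> n) xs)" for n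
  define b2 where "b2 n = fredholm_det (exp_prod (\<lambda>X. T_op (shift X (h2 n))) xs * T_op (shift A' (h2 n)))" for n
  define r where "r n = sdet (N n) (\<phi> n A) * exp (- (\<Sum>X\<leftarrow>xs. \<Sum>i<N n. entry (\<phi> n X) i i))" for n
  define Mn where "Mn n = 1 - \<phi> n A * \<phi> n A'" for n
  define L where "L = T_op (U1 (A * A')) - T_op (U1 A) * T_op (U1 A')"
  have AA': "A * A' = 1" unfolding A_def A'_def by (rule exp_prod_inverse)
  have A: "A \<in> R" unfolding A_def by (rule exp_prod_in[OF xs])
  have A': "A' \<in> R"
  proof -
    have "A' = exp_prod (\<lambda>X. X) (map uminus (rev xs))" by (simp add: A'_def o_def)
    then show ?thesis using exp_prod_in[of "map uminus (rev xs)"] xs by (auto intro: closed')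
  qed
  have Meq: "Mn n = \<phi> n (A * A') - \<phi> n A * \<phi> n A'" for n
    by (simp add: Mn_def AA' \<phi>_def shift_simps T_op_simps)
  have M_lim: "trace_tendsto Mn L"
    using T_op_U_defect_trace_tendsto[OF fr1 A A'] unfolding Meq[abs_def] \<phi>_def L_def .
  obtain M where M: "almost_hom \<phi> M" using toeplitz_almost_hom unfolding \<phi>_def by blast
  have tM: "\<exists>c. trace_bound (Mn n) c" for n
    using \<phi>_defect[OF M A A', of n] by (auto simp: Meq)
  obtain CM where CM: "\<And>n. trace_bound (Mn n) CM"
    using \<phi>_defect[OF M A A'] by (auto simp: Meq)
  have L: "trace_bound L CM" by (rule trace_bound_limit[OF trace_tendsto_entry[OF M_lim] CM])
  define \<sigma> where "\<sigma> n X = Pn (N n) * \<phi> n X * Pn (N n)" for n X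
  obtain M' where M': "almost_hom \<sigma> M'" using section_almost_hom unfolding \<sigma>_def \<phi>_def by blast
  obtain C where C: "\<And>n. trace_bound (\<sigma> n A - \<sigma> n 1 * exp_prod (\<sigma> n) xs) C"
    using exp_prod_defect_bounded[OF M' xs] by (auto simp: A_def)
  have \<sigma>1: "\<sigma> n 1 = Pn (N n)" for n by (simp add: \<sigma>_def \<phi>_def shift_simps T_op_simps)
  (* c bounds P G P - P in trace norm, K bounds G P - I in operator norm, uniformly in n *)
  define c where "c = exp (\<Sum>X\<leftarrow>xs. norm X) * C"
  define K where "K = norm A * exp (2 * (\<Sum>X\<leftarrow>xs. norm X)) + 1"
  have K: "K > 0" by (simp add: K_def add_nonneg_pos)
  have "\<exists>X D. b1 n * b2 n = fredholm_det (1 + X + D) \<and> fredholm_det (1 + X) = r n \<and> trace_bound X c \<and>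
      (\<forall>d. trace_bound (Mn n * (1 - Pn (N n))) d \<longrightarrow> trace_bound D (K * d))" for n
  proof -
    have shifted: "bwd (N n) * \<phi> n X * fwd (N n) = T_op (shift X (h2 n))" for X
    proof -
      have "h1 n + int (N n) = h2 n" using pos[of n] by (simp add: N_def)
      then show ?thesis by (simp only: \<phi>_def bwd_T_op_fwd shift_shift)
    qed
    interpret si: section_identity "N n" "\<phi> n" xs "\<phi> n A" "\<phi> n A'" "fwd (N n)" "bwd (N n)"
    proof
      show "\<exists>c. trace_bound (\<phi> n A * exp_prod_inv (\<phi> n) xs - 1) c"
        using left_operator_limit(3)[OF fr1 xs, of n] by (simp add: A_def \<phi>_def)
      show "\<exists>c. trace_bound (exp_prod (\<phi> n) xs * \<phi> n A' - 1) c"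
        using right_operator_limit(3)[OF fr1 xs, of n] by (simp add: A'_def \<phi>_def)
      show "\<exists>c. trace_bound (1 - \<phi> n A * \<phi> n A') c" using tM[of n] by (simp add: Mn_def)
    qed (rule bwd_fwd)+
    let ?P = "Pn (N n)"
    let ?X = "?P * si.G * ?P - ?P" and ?D = "Mn n * (1 - ?P) * (si.G * ?P - 1)"
    have sM: "si.M = Mn n" by (simp add: si.M_def Mn_def)
    have 1: "b1 n * b2 n = fredholm_det (1 + ?X + ?D)"
      using si.product_identity by (simp only: b1_def b2_def shifted sM)
    have 2: "fredholm_det (1 + ?X) = r n" by (simp only: si.section_det r_def)
    have "norm (exp_prod_inv (\<sigma> n) xs) \<le> exp (\<Sum>X\<leftarrow>rev xs. norm (- \<sigma> n X))" by (rule norm_exp_prod_le)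
    also have "(\<Sum>X\<leftarrow>rev xs. norm (- \<sigma> n X)) \<le> (\<Sum>X\<leftarrow>rev xs. norm X)"
      by (rule sum_list_mono) (simp add: \<phi>_norm[OF M'])
    also have "\<dots> = (\<Sum>X\<leftarrow>xs. norm X)" by (induction xs) auto
    finally have n\<sigma>: "norm (exp_prod_inv (\<sigma> n) xs) \<le> exp (\<Sum>X\<leftarrow>xs. norm X)" by simp
    have "?X = (\<sigma> n A - \<sigma> n 1 * exp_prod (\<sigma> n) xs) * exp_prod_inv (\<sigma> n) xs"
    proof -
      have "?P * exp_prod (\<sigma> n) xs * exp_prod_inv (\<sigma> n) xs = ?P" by (simp add: mult.assoc exp_prod_inverse)
      then show ?thesis unfolding \<sigma>1 left_diff_distrib using si.section_eq by (simp add: \<sigma>_def)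
    qed
    then have "trace_bound ?X (norm (exp_prod_inv (\<sigma> n) xs) * C)" using trace_bound_mult_right[OF C[of n]] by simp
    then have 3: "trace_bound ?X c"
      by (rule trace_bound_mono) (unfold c_def, intro mult_right_mono n\<sigma> trace_bound_nonneg[OF C[of n]])
    have "norm si.G \<le> norm (\<phi> n A) * exp (2 * (\<Sum>X\<leftarrow>xs. norm (\<phi> n X)))" by (rule si.norm_G_le)
    also have "\<dots> \<le> norm A * exp (2 * (\<Sum>X\<leftarrow>xs. norm X))"
      by (intro mult_mono) (auto simp: \<phi>_norm[OF M] intro: sum_list_mono)
    finally have "norm (si.G * ?P - 1) \<le> K"
      unfolding K_def by (intro norm_triangle_le_diff add_mono order_trans[OF norm_Pn_mult_le(2)]) auto
    then have 4: "trace_bound ?D (K * d)" if d: "trace_bound (Mn n * (1 - ?P)) d" for d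
      by (intro trace_bound_mono[OF trace_bound_mult_right[OF d]] mult_right_mono trace_bound_nonneg[OF d])
    show ?thesis using 1 2 3 4 by blast
  qed
  then obtain X D where XD: "\<And>n. b1 n * b2 n = fredholm_det (1 + X n + D n)" "\<And>n. fredholm_det (1 + X n) = r n"
    "\<And>n. trace_bound (X n) c" "\<And>n d. trace_bound (Mn n * (1 - Pn (N n))) d \<Longrightarrow> trace_bound (D n) (K * d)"
    by metis
  have Nlim: "filterlim N at_top sequentially"
    unfolding N_def by (rule filterlim_compose[OF filterlim_nat_sequentially lim])
  have "trace_tendsto D 0"
    unfolding trace_tendsto_def
  proof (intro allI impI)
    fix e :: real assume e: "e > 0"
    define d where "d = e / (2 * K)"
    have d: "d > 0" "K * (d + d) = e" using e K by (auto simp: d_def)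
    have "\<forall>\<^sub>F n in sequentially. trace_bound (Mn n - L) d" using M_lim d by (simp add: trace_tendsto_def)
    moreover have "\<forall>\<^sub>F n in sequentially. trace_bound (L * (1 - Pn (N n))) d"
      using Nlim trace_bound_tail_right[OF L d(1)] by (auto simp: filterlim_iff)
    ultimately show "\<forall>\<^sub>F n in sequentially. trace_bound (D n - 0) e"
    proof eventually_elim
      case (elim n)
      have "trace_bound ((Mn n - L) * (1 - Pn (N n))) (norm (1 - Pn (N n)) * d)" by (rule trace_bound_mult_right[OF elim(1)])
      then have "trace_bound ((Mn n - L) * (1 - Pn (N n))) d"
        by (rule trace_bound_mono) (use d norm_co_proj_op_le[of "{..<N n}"] in \<open>simp add: mult_left_le_one_le\<close>)
      from trace_bound_add[OF this elim(2)] have "trace_bound (Mn n * (1 - Pn (N n))) (d + d)" by (simp add: algebra_simps)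
      from XD(4)[OF this] show ?case by (simp only: d diff_zero)
    qed
  qed
  then have "(\<lambda>n. fredholm_det (1 + X n + D n) - fredholm_det (1 + X n)) \<longlonglongrightarrow> 0"
    by (intro fredholm_det_diff_tendsto[where c=c]) (auto simp: XD(3))
  then have "(\<lambda>n. b1 n * b2 n - r n) \<longlonglongrightarrow> 0" by (simp add: XD(1,2))
  moreover have "b1 \<longlonglongrightarrow> fredholm_det (T_op (U1 A) * exp_prod_inv (\<lambda>X. T_op (U1 X)) xs)"
    using left_operator_limit(2)[OF fr1 xs] by (simp add: b1_def[abs_def] \<phi>_def A_def)
  moreover have "b2 \<longlonglongrightarrow> fredholm_det (exp_prod (\<lambda>X. T_op (U2 X)) xs * T_op (U2 A'))"
    using right_operator_limit(2)[OF fr2 xs] by (simp add: b2_def[abs_def] A'_def)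
  ultimately have "(\<lambda>n. b1 n * b2 n - (b1 n * b2 n - r n)) \<longlonglongrightarrow>
      fredholm_det (T_op (U1 A) * exp_prod_inv (\<lambda>X. T_op (U1 X)) xs)
      * fredholm_det (exp_prod (\<lambda>X. T_op (U2 X)) xs * T_op (U2 A')) - 0"
    by (intro tendsto_diff tendsto_mult)
  then show ?thesis by (simp add: r_def[abs_def] \<phi>_def)
qed

end

lemma entry_T_op_shift: "entry (T_op (shift A m)) i j = entry A (m + int i) (m + int j)"
  by (simp add: T_op_on_nat entry_on_nat entry_shift)

lemma sec_mat_entry:
  "sec_mat m k A = mat (nat (k - m)) (nat (k - m)) (\<lambda>(i, j). entry (T_op (shift A m)) i j)"
  unfolding sec_mat_def P_sec_def
  by (intro eq_matI) (auto simp: entry_proj_left entry_proj_right entry_T_op_shift)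

lemma sec_det_eq: "sec_det m k A = sdet (nat (k - m)) (T_op (shift A m))"
  by (simp add: sec_det_def sdet_def sec_mat_entry)

lemma sec_trace_eq:
  "sec_trace m k (sum_list xs) = (\<Sum>X\<leftarrow>xs. \<Sum>i<nat (k - m). entry (T_op (shift X m)) i i)"
proof -
  have "sec_trace m k A = (\<Sum>i<nat (k - m). entry (T_op (shift A m)) i i)" for A
    by (simp add: sec_trace_def sec_mat_entry)
  then show ?thesis
    by (induction xs) (auto simp: shift_simps T_op_simps entry_simps entry_T_op_shift sum.distrib)
qed

lemma op_inv_eqI: "A * B = 1 \<Longrightarrow> B * A = 1 \<Longrightarrow> op_inv A = B"
  unfolding op_inv_def by (rule the_equality) (auto, metis mult.assoc mult_1_left mult_1_right)

theorem theorem5p3: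
  fixes R :: "int l2op set" and nrm :: "int l2op \<Rightarrow> real"
    and h\<^sub>1 h\<^sub>2 :: "nat \<Rightarrow> int" and \<U>\<^sub>1 \<U>\<^sub>2 :: "int l2op \<Rightarrow> int l2op"
    and As :: "int l2op list" and A :: "int l2op" and \<B>\<^sub>1 \<B>\<^sub>2 :: "nat l2op"
  assumes "banach_subalgebra R nrm" and "unital R"
    and "rigid R" and "suitable R nrm" and "shift_invariant R nrm"
    and "fractal R nrm h\<^sub>1 \<U>\<^sub>1" and "fractal R nrm h\<^sub>2 \<U>\<^sub>2"
    and "\<And>n. h\<^sub>2 n - h\<^sub>1 n > 0"
    and "filterlim (\<lambda>n. h\<^sub>2 n - h\<^sub>1 n) at_top sequentially"
    and "set As \<subseteq> R"
    and "A = prod_list (map exp As)"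
    and "\<B>\<^sub>1 = T_op (\<U>\<^sub>1 A) * prod_list (map (\<lambda>X. exp (- T_op (\<U>\<^sub>1 X))) (rev As))"
    and "\<B>\<^sub>2 = prod_list (map (\<lambda>X. exp (T_op (\<U>\<^sub>2 X))) As) * T_op (\<U>\<^sub>2 (op_inv A))"
  shows "trace_class (\<B>\<^sub>1 - 1) \<and> trace_class (\<B>\<^sub>2 - 1) \<and>
    (\<lambda>n. sec_det (h\<^sub>1 n) (h\<^sub>2 n) A / exp (sec_trace (h\<^sub>1 n) (h\<^sub>2 n) (sum_list As)))
      \<longlonglongrightarrow> fredholm_det \<B>\<^sub>1 * fredholm_det \<B>\<^sub>2"
proof -
  interpret suitable_algebra R nrm by unfold_locales fact+
  have A: "A = exp_prod (\<lambda>X. X) As" using assms(11) by (simp only:)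
  have inv: "op_inv A = exp_prod_inv (\<lambda>X. X) As"
    unfolding A by (rule op_inv_eqI[OF exp_prod_inverse exp_prod_inverse'])
  have "trace_class (\<B>\<^sub>1 - 1)"
    using left_operator_limit(1)[OF assms(6,10)] trace_bound_trace_class(1) unfolding assms(12) A by blast
  moreover have "trace_class (\<B>\<^sub>2 - 1)"
    using right_operator_limit(1)[OF assms(7,10)] trace_bound_trace_class(1) unfolding assms(13) inv by blast
  moreover have "(\<lambda>n. sec_det (h\<^sub>1 n) (h\<^sub>2 n) A / exp (sec_trace (h\<^sub>1 n) (h\<^sub>2 n) (sum_list As)))
      \<longlonglongrightarrow> fredholm_det \<B>\<^sub>1 * fredholm_det \<B>\<^sub>2"
    using section_ratio_limit[OF assms(6-10)]
    unfolding assms(12,13) inv unfolding A sec_det_eq sec_trace_eq by (simp add: exp_minus divide_inverse)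
  ultimately show ?thesis by blast
qed

end
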